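(* For each $k\in\mathbb Z$ let $\mathcal F_k$ be a closed subspace of $\mathcal U_k$ and let $\omega_k=\begin{bmatrix}\omega_{k,1}\\ \omega_{k,2}\end{bmatrix}:\mathcal F_k\to\begin{bmatrix}\mathcal Y_k\\ \mathcal U_{k-1}\end{bmatrix}$ be a contraction. Let $H\in\mathbb{UM}^2_{\mathrm{ball}}(\mathbf U,\mathbf Y)$ satisfy $$H_{k,k}|_{\mathcal F_k}=\omega_{k,1}\quad(k\in\mathbb Z),\qquad H_{j,k}|_{\mathcal F_k}=H_{j,k-1}\omega_{k,2}\quad(j,k\in\mathbb Z,\ j<k).$$ Fix $C\in\mathbf C_{H,\omega}$ and put $$F=N+\Pi_H^*\nabla_H(I_{\mathbf D_H}-C)^{-1}\nabla_H\Pi_H.$$ Then $F\in\mathbb{UM}(\mathbf U)$, $F+F^*\ge H^*H+I_{\mathbf U}$, $F_{j,j}=I_{\mathcal U_j}$ for all $j\in\mathbb Z$, and $$F_{j,k}|_{\mathcal F_k}=F_{j,k-1}\omega_{k,2}\quad(j,k\in\mathbb Z,\ j<k).$$ Put $Z^{(1)}=HF^{-1}$ and $Z^{(2)}=I_{\mathbf U}-F^{-1}$. Then the pair $(Z^{(1)},Z^{(2)})$ has the following properties: (a) $Z^{(1)}\in\mathbb{UM}^\infty(\mathbf U,\mathbf Y)$ and $Z^{(2)}\in\mathbb{UM}^\infty_0(\mathbf U)$; (b) $\|Z^{(1)}u\|^2+\|Z^{(2)}u\|^2\le\|u\|^2$ for all $u\in\mathbf U$; (c) for all $j,k\in\mathbb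 Z$: $Z^{(1)}_{j,k}|_{\mathcal F_k}$ equals $\omega_{k,1}$ if $j=k$ and $0$ if $j\ne k$, and $Z^{(2)}_{j,k}|_{\mathcal F_k}$ equals $\omega_{k,2}$ if $j=k-1$ and $0$ if $j\ne k-1$; (d) $H=Z^{(1)}(I_{\mathbf U}-Z^{(2)})^{-1}$. Furthermore, the map $C\mapsto(Z^{(1)},Z^{(2)})$ is a one-to-one map from $\mathbf C_{H,\omega}$ onto the set of all pairs $(Z^{(1)},Z^{(2)})$ satisfying (a), (b), (c) and (d). In particular, there exists a unique pair $(Z^{(1)},Z^{(2)})$ satisfying (a), (b), (c) and (d) if and only if one of the following three conditions is satisfied: (1) $\mathcal F_{H_k}=\mathcal D_{H_k}$ for each $k\in\mathbb Z$; (2) $\omega_{H_k}$ is a co-isometry for each $k\in\mathbb Z$; (3) there exists $k\in\mathbb Z$ such that $\mathcal F_{H_j}=\mathcal D_{H_j}$ for each $j>k$ and the operator $\omega_{H_j}$ is a co-isometry for each $j\le k$.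
   Context: For each $k\in\mathbb Z$, $\mathcal U_k$ and $\mathcal Y_k$ are Hilbert spaces; $\mathbf U=\oplus_{k\in\mathbb Z}\mathcal U_k$ and $\mathbf Y=\oplus_{k\in\mathbb Z}\mathcal Y_k$ are the Hilbert direct sums. $\mathbb M(\mathbf U,\mathbf Y)$ is the set of all operator matrices $H=[H_{j,k}]_{j,k\in\mathbb Z}$ with $H_{j,k}:\mathcal U_k\to\mathcal Y_j$ bounded, and $\mathbb{UM}(\mathbf U,\mathbf Y)$ is the subset of upper triangular ones ($H_{j,k}=0$ for $k<j$). $\mathbb{UM}^2_{\mathrm{ball}}(\mathbf U,\mathbf Y)$ is the set of $H\in\mathbb{UM}(\mathbf U,\mathbf Y)$ with $\sum_{j=-\infty}^k\|H_{j,k}u_k\|^2\le\|u_k\|^2$ for all $u_k\in\mathcal U_k$, $k\in\mathbb Z$. $\mathbb{UM}^\infty(\mathbf U,\mathbf Y)$ (respectively $\mathbb{UM}^\infty_{\mathrm{ball}}(\mathbf U,\mathbf Y)$) is the set of $H\in\mathbb{UM}(\mathbf U,\mathbf Y)$ that induce bounded (respectively contractive) operators $\mathbf U\to\mathbf Y$; a further subscript $0$ denotes the strictly upper triangular ones ($H_{j,k}=0$ for $k\le j$). When $\mathbf U=\mathbf Y$ one writes $(\mathbf U)$ in place of $(\mathbf U,\mathbf U)$. Products of upper triangular operator matrices are the usual matrix products (finite sums); $\mathbb{UM}(\mathbf U)$ is an algebra with unit $I_{\mathbf U}$, and inverses are taken in this algebra; $M\in\mathbb{UM}(\mathbf U)$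 is invertible there if and only if every diagonal entry $M_{j,j}$ is invertible. For $M\in\mathbb M(\mathbf U)$, $M^*=[(M_{k,j})^*]_{j,k}$. $M$ is non-negative if for all $j\le k$ the finite section $[M_{a,b}]_{a,b=j}^k$ is a non-negative operator on $\mathcal U_j\oplus\cdots\oplus\mathcal U_k$; $M\ge N$ means $M-N$ is non-negative. Let $H$ be as in the claim. $H_k:\mathcal U_k\to\mathbf Y$ is the contraction given by the $k$-th column of $H$; $H^*H=[(H_j)^*H_k]_{j,k\in\mathbb Z}\in\mathbb M(\mathbf U)$; $D_{H_k}=(I_{\mathcal U_k}-H_k^*H_k)^{1/2}$; $\mathcal D_{H_k}=\overline{D_{H_k}\mathcal U_k}$; $\mathbf D_H=\oplus_{k\in\mathbb Z}\mathcal D_{H_k}$. $N\in\mathbb{UM}(\mathbf U)$ is given by $N_{j,k}=(H_j)^*H_k$ for $j\le k$ and $N_{j,k}=0$ for $j>k$. $\nabla_H\in\mathbb{UM}(\mathbf D_H)$ is the diagonal operator matrix with $(k,k)$ entry $D_{H_k}$ viewed as an operator on $\mathcal D_{H_k}$; $\Pi_H\in\mathbb{UM}(\mathbf U,\mathbf D_H)$ is the diagonal operator matrix whose $(k,k)$ entry is the orthogonal projection of $\mathcal U_k$ onto $\mathcal D_{H_k}$ (so $\Pi_H^*$ is the diagonal matrix of canonical embeddings). Put $\mathcal F_{H_k}=\overline{D_{H_k}\mathcal F_k}$. Because of the interpolation conditions on $H$, $\|D_{H_k}f\|^2=\|D_{\omega_k}f\|^2+\|D_{H_{k-1}}\omega_{k,2}f\|^2$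 for $f\in\mathcal F_k$ (with $D_{\omega_k}=(I-\omega_k^*\omega_k)^{1/2}$), so a contraction $\omega_{H_k}:\mathcal F_{H_k}\to\mathcal D_{H_{k-1}}$ is defined by $\omega_{H_k}D_{H_k}f=D_{H_{k-1}}\omega_{k,2}f$ ($f\in\mathcal F_k$). $\mathbf C_{H,\omega}$ is the set of all $C=[C_{j,k}]_{j,k\in\mathbb Z}\in\mathbb{UM}^\infty_{\mathrm{ball},0}(\mathbf D_H)$ such that for all $j,k\in\mathbb Z$, $C_{j,k}|_{\mathcal F_{H_k}}=\omega_{H_k}$ if $j=k-1$ and $C_{j,k}|_{\mathcal F_{H_k}}=0$ if $j\neq k-1$. *)

theory Defs
  imports "HOL-Analysis.Analysis"
begin

section \<open>Complex Hilbert spaces\<close>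

text \<open>The real structure (\<open>scaleR\<close>, \<open>inner\<close>, \<open>norm\<close>, topology) of a complex inner product space
  is the underlying real one; \<open>cinner\<close> is linear in the first argument.\<close>

class complex_inner = real_inner +
  fixes scaleC :: "complex \<Rightarrow> 'a \<Rightarrow> 'a"  (infixr "*\<^sub>C" 75)
    and cinner :: "'a \<Rightarrow> 'a \<Rightarrow> complex"
  assumes scaleC_add_right: "a *\<^sub>C (x + y) = a *\<^sub>C x + a *\<^sub>C y"
    and scaleC_add_left: "(a + b) *\<^sub>C x = a *\<^sub>C x + b *\<^sub>C x"
    and scaleC_scaleC: "a *\<^sub>C (b *\<^sub>C x) = (a * b) *\<^sub>C x"
    and scaleC_of_real: "complex_of_real r *\<^sub>C x = r *\<^sub>R x"
    and cinner_commute: "cinner x y = cnj (cinner y x)"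
    and cinner_add_left: "cinner (x + y) z = cinner x z + cinner y z"
    and cinner_scaleC_left: "cinner (a *\<^sub>C x) y = a * cinner x y"
    and Re_cinner: "Re (cinner x y) = inner x y"

class chilbert = complex_inner + complete_space

global_interpretation complex_vector: vector_space "scaleC :: complex \<Rightarrow> 'a \<Rightarrow> 'a::complex_inner"
  by standard
    (simp_all add: scaleC_add_right scaleC_add_left scaleC_scaleC scaleC_of_real[of 1, simplified])

instantiation complex :: chilbert
begin

definition scaleC_complex :: "complex \<Rightarrow> complex \<Rightarrow> complex"
  where "scaleC_complex a x = a * x"

definition cinner_complex :: "complex \<Rightarrow> complex \<Rightarrow> complex"
  where "cinner_complex x y = x * cnj y"

instance
  by standard
    (auto simp: scaleC_complex_def cinner_complex_def algebra_simps inner_complex_def scaleR_conv_of_real)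

end

instantiation prod :: (complex_inner, complex_inner) complex_inner
begin

definition scaleC_prod :: "complex \<Rightarrow> 'a \<times> 'b \<Rightarrow> 'a \<times> 'b"
  where "scaleC_prod a x = (a *\<^sub>C fst x, a *\<^sub>C snd x)"

definition cinner_prod :: "'a \<times> 'b \<Rightarrow> 'a \<times> 'b \<Rightarrow> complex"
  where "cinner_prod x y = cinner (fst x) (fst y) + cinner (snd x) (snd y)"

instance
proof
  fix x y :: "'a \<times> 'b"
  show "cinner x y = cnj (cinner y x)"
    unfolding cinner_prod_def by (simp flip: cinner_commute)
qed (auto simp: scaleC_prod_def cinner_prod_def scaleC_add_right scaleC_add_left scaleC_scaleC
      scaleC_of_real cinner_add_left cinner_scaleC_left Re_cinner inner_prod_def prod_eq_iff
      algebra_simps)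

end

instance prod :: (chilbert, chilbert) chilbert ..

lemma norm_scaleC: "norm (a *\<^sub>C x) = cmod a * norm (x :: 'a :: complex_inner)"
proof -
  have "cinner x x \<in> \<real>"
    using cinner_commute[of x x] by (simp add: complex_is_Real_iff complex_eq_iff)
  then have x: "cinner x x = of_real (inner x x)"
    by (metis Re_cinner of_real_Re)
  have "cinner (a *\<^sub>C x) (a *\<^sub>C x) = a * cnj a * cinner x x"
    by (metis (no_types, lifting) cinner_commute cinner_scaleC_left complex_cnj_mult mult.assoc)
  then have "inner (a *\<^sub>C x) (a *\<^sub>C x) = (cmod a)\<^sup>2 * inner x x"
    using x by (metis Re_cinner Re_complex_of_real complex_norm_square of_real_mult)
  then show ?thesis
    by (simp add: norm_eq_sqrt_inner real_sqrt_mult)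
qed

lemma cmod_cinner_le: "cmod (cinner x y) \<le> norm x * norm (y :: 'a :: complex_inner)"
proof (cases "cinner x y = 0")
  case False
  define a where "a = cnj (cinner x y) / cmod (cinner x y)"
  have a: "cmod a = 1" using False by (simp add: a_def norm_divide)
  have "cinner (a *\<^sub>C x) y = complex_of_real (cmod (cinner x y))"
    using False complex_norm_square[of "cinner x y"]
    by (simp add: cinner_scaleC_left a_def field_simps power2_eq_square)
  then have "cmod (cinner x y) = inner (a *\<^sub>C x) y"
    by (metis Re_cinner Re_complex_of_real)
  also have "\<dots> \<le> norm (a *\<^sub>C x) * norm y"
    by (rule norm_cauchy_schwarz)
  finally show ?thesis by (simp add: norm_scaleC a)
qed auto

section \<open>The Hilbert space of square summable two-sided sequences\<close>

typedef (overloaded) 'a ell2 =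
  "{f :: int \<Rightarrow> 'a::complex_inner. (\<lambda>k. (norm (f k))\<^sup>2) summable_on UNIV}"
  morphisms ell2_nth Abs_ell2
  by (rule exI[of _ "\<lambda>_. 0"]) simp

setup_lifting type_definition_ell2

lemma ell2_mult:
  fixes f g :: "int \<Rightarrow> 'a::complex_inner"
  assumes "(\<lambda>k. (norm (f k))\<^sup>2) summable_on A" "(\<lambda>k. (norm (g k))\<^sup>2) summable_on A"
  shows "(\<lambda>k. norm (f k) * norm (g k)) summable_on A"
proof -
  have "(\<lambda>k. (norm (f k))\<^sup>2 + (norm (g k))\<^sup>2) summable_on A"
    using assms by (rule summable_on_add)
  then have "(\<lambda>k. norm (norm (f k) * norm (g k))) summable_on A"
  proof (rule Infinite_Sum.abs_summable_on_comparison_test')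
    fix k
    have "2 * (norm (f k) * norm (g k)) \<le> (norm (f k))\<^sup>2 + (norm (g k))\<^sup>2"
      using sum_squares_bound[of "norm (f k)" "norm (g k)"] by simp
    moreover have "0 \<le> norm (f k) * norm (g k)" by simp
    ultimately have "norm (f k) * norm (g k) \<le> (norm (f k))\<^sup>2 + (norm (g k))\<^sup>2" by linarith
    then show "norm (norm (f k) * norm (g k)) \<le> (norm (f k))\<^sup>2 + (norm (g k))\<^sup>2" by simp
  qed
  then show ?thesis by simp
qed

lemma ell2_cinner:
  fixes f g :: "int \<Rightarrow> 'a::complex_inner"
  assumes "(\<lambda>k. (norm (f k))\<^sup>2) summable_on A" "(\<lambda>k. (norm (g k))\<^sup>2) summable_on A"
  shows "(\<lambda>k. cinner (f k) (g k)) summable_on A"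
  by (rule abs_summable_summable, rule Infinite_Sum.abs_summable_on_comparison_test'[OF ell2_mult[OF assms]])
     (rule cmod_cinner_le)

lemma ell2_inner:
  fixes f g :: "int \<Rightarrow> 'a::complex_inner"
  assumes "(\<lambda>k. (norm (f k))\<^sup>2) summable_on A" "(\<lambda>k. (norm (g k))\<^sup>2) summable_on A"
  shows "(\<lambda>k. inner (f k) (g k)) summable_on A"
  using summable_on_Re[OF ell2_cinner[OF assms]] by (simp add: Re_cinner)

lemma ell2_add:
  fixes f g :: "int \<Rightarrow> 'a::complex_inner"
  assumes "(\<lambda>k. (norm (f k))\<^sup>2) summable_on A" "(\<lambda>k. (norm (g k))\<^sup>2) summable_on A"
  shows "(\<lambda>k. (norm (f k + g k))\<^sup>2) summable_on A"
proof -
  have "(\<lambda>k. (norm (f k))\<^sup>2 + (norm (g k))\<^sup>2 + 2 * inner (f k) (g k)) summable_on A"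
    by (intro summable_on_add assms summable_on_cmult_right ell2_inner)
  moreover have "(norm (f k))\<^sup>2 + (norm (g k))\<^sup>2 + 2 * inner (f k) (g k) = (norm (f k + g k))\<^sup>2" for k
    by (simp add: power2_norm_eq_inner inner_add_left inner_add_right inner_commute)
  ultimately show ?thesis by simp
qed

lemma ell2_scaleC:
  fixes f :: "int \<Rightarrow> 'a::complex_inner"
  assumes "(\<lambda>k. (norm (f k))\<^sup>2) summable_on A"
  shows "(\<lambda>k. (norm (a *\<^sub>C f k))\<^sup>2) summable_on A"
  unfolding norm_scaleC power_mult_distrib by (intro summable_on_cmult_right assms)

instantiation ell2 :: (complex_inner) complex_inner
begin

lift_definition zero_ell2 :: "'a ell2" is "\<lambda>_. 0" by simp
lift_definition plus_ell2 :: "'a ell2 \<Rightarrow> 'a ell2 \<Rightarrow> 'a ell2" is "\<lambda>f g k. f k + g k"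
  by (rule ell2_add)
lift_definition uminus_ell2 :: "'a ell2 \<Rightarrow> 'a ell2" is "\<lambda>f k. - f k" by simp
lift_definition minus_ell2 :: "'a ell2 \<Rightarrow> 'a ell2 \<Rightarrow> 'a ell2" is "\<lambda>f g k. f k - g k"
  subgoal for f g using ell2_add[of f UNIV "\<lambda>k. - g k"] by simp
  done
lift_definition scaleC_ell2 :: "complex \<Rightarrow> 'a ell2 \<Rightarrow> 'a ell2" is "\<lambda>a f k. a *\<^sub>C f k"
  by (rule ell2_scaleC)
lift_definition scaleR_ell2 :: "real \<Rightarrow> 'a ell2 \<Rightarrow> 'a ell2" is "\<lambda>a f k. a *\<^sub>R f k"
  subgoal for r f using ell2_scaleC[of f UNIV "of_real r"] by (simp add: scaleC_of_real)
  done

definition cinner_ell2 :: "'a ell2 \<Rightarrow> 'a ell2 \<Rightarrow> complex"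
  where "cinner_ell2 u v = (\<Sum>\<^sub>\<infinity>k. cinner (ell2_nth u k) (ell2_nth v k))"
definition inner_ell2 :: "'a ell2 \<Rightarrow> 'a ell2 \<Rightarrow> real"
  where "inner_ell2 u v = (\<Sum>\<^sub>\<infinity>k. inner (ell2_nth u k) (ell2_nth v k))"
definition norm_ell2 :: "'a ell2 \<Rightarrow> real"
  where "norm_ell2 u = sqrt (inner u u)"
definition sgn_ell2 :: "'a ell2 \<Rightarrow> 'a ell2"
  where "sgn_ell2 u = scaleR (inverse (norm u)) u"
definition dist_ell2 :: "'a ell2 \<Rightarrow> 'a ell2 \<Rightarrow> real"
  where "dist_ell2 u v = norm (u - v)"
definition uniformity_ell2 :: "('a ell2 \<times> 'a ell2) filter"
  where "uniformity_ell2 = (INF e\<in>{0<..}. principal {(x, y). dist x y < e})"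
definition open_ell2 :: "'a ell2 set \<Rightarrow> bool"
  where "open_ell2 S = (\<forall>x\<in>S. \<forall>\<^sub>F (x', y) in uniformity. x' = x \<longrightarrow> y \<in> S)"

instance
proof
  fix x y z :: "'a ell2" and a b :: real and c d :: complex
  have sm: "(\<lambda>k. (norm (ell2_nth x k))\<^sup>2) summable_on UNIV" for x :: "'a ell2"
    using ell2_nth[of x] by simp
  have I: "(\<lambda>k. inner (ell2_nth x k) (ell2_nth y k)) summable_on UNIV" for x y :: "'a ell2"
    by (intro ell2_inner sm)
  have C: "(\<lambda>k. cinner (ell2_nth x k) (ell2_nth y k)) summable_on UNIV" for x y :: "'a ell2"
    by (intro ell2_cinner sm)
  show "x + y + z = x + (y + z)" by transfer (simp add: add.assoc)
  show "x + y = y + x" by transfer (simp add: add.commute)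
  show "0 + x = x" by transfer simp
  show "- x + x = 0" by transfer simp
  show "x - y = x + - y" by transfer simp
  show "a *\<^sub>R (x + y) = a *\<^sub>R x + a *\<^sub>R y" by transfer (simp add: scaleR_add_right)
  show "(a + b) *\<^sub>R x = a *\<^sub>R x + b *\<^sub>R x" by transfer (simp add: scaleR_add_left)
  show "a *\<^sub>R b *\<^sub>R x = (a * b) *\<^sub>R x" by transfer simp
  show "1 *\<^sub>R x = x" by transfer simp
  show "sgn x = scaleR (inverse (norm x)) x" by (rule sgn_ell2_def)
  show "dist x y = norm (x - y)" by (rule dist_ell2_def)
  show "uniformity = (INF e\<in>{0<..}. principal {(x, y :: 'a ell2). dist x y < e})"
    by (rule uniformity_ell2_def)
  show "open S = (\<forall>x\<in>S. \<forall>\<^sub>F (x', y) in uniformity. x' = x \<longrightarrow> y \<in> S)" for S :: "'a ell2 set"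
    by (rule open_ell2_def)
  show "inner x y = inner y x" by (simp add: inner_ell2_def inner_commute)
  show "inner (x + y) z = inner x z + inner y z"
    unfolding inner_ell2_def using infsum_add[OF I[of x z] I[of y z]]
    by (simp add: plus_ell2.rep_eq inner_add_left)
  show "inner (a *\<^sub>R x) y = a * inner x y"
    unfolding inner_ell2_def by (simp add: scaleR_ell2.rep_eq infsum_cmult_right')
  show "0 \<le> inner x x" unfolding inner_ell2_def by (rule infsum_nonneg) simp
  show "inner x x = 0 \<longleftrightarrow> x = 0"
  proof
    assume "inner x x = 0"
    then have "inner (ell2_nth x k) (ell2_nth x k) = 0" for k
      using nonneg_infsum_le_0D[OF _ I[of x x], of k] by (simp add: inner_ell2_def)
    then show "x = 0" by (simp add: ell2_nth_inject[symmetric] zero_ell2.rep_eq fun_eq_iff)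
  qed (simp add: inner_ell2_def zero_ell2.rep_eq)
  show "norm x = sqrt (inner x x)" by (rule norm_ell2_def)
  show "c *\<^sub>C (x + y) = c *\<^sub>C x + c *\<^sub>C y" by transfer (simp add: scaleC_add_right)
  show "(c + d) *\<^sub>C x = c *\<^sub>C x + d *\<^sub>C x" by transfer (simp add: scaleC_add_left)
  show "c *\<^sub>C d *\<^sub>C x = (c * d) *\<^sub>C x" by transfer (simp add: scaleC_scaleC)
  show "complex_of_real a *\<^sub>C x = a *\<^sub>R x" by transfer (simp add: scaleC_of_real)
  show "cinner x y = cnj (cinner y x)"
    unfolding cinner_ell2_def infsum_cnj[symmetric] cinner_commute[symmetric] ..
  show "cinner (x + y) z = cinner x z + cinner y z"
    unfolding cinner_ell2_def using infsum_add[OF C[of x z] C[of y z]]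
    by (simp add: plus_ell2.rep_eq cinner_add_left)
  show "cinner (c *\<^sub>C x) y = c * cinner x y"
    unfolding cinner_ell2_def by (simp add: scaleC_ell2.rep_eq cinner_scaleC_left infsum_cmult_right')
  show "Re (cinner x y) = inner x y"
    unfolding cinner_ell2_def inner_ell2_def Re_cinner[symmetric] using infsum_Re[OF C[of x y]] by simp
qed

end

lemma ell2_summable: "(\<lambda>k. (norm (ell2_nth u k))\<^sup>2) summable_on UNIV"
  using ell2_nth[of u] by simp

lemma norm_ell2_sq: "(norm u)\<^sup>2 = (\<Sum>\<^sub>\<infinity>k. (norm (ell2_nth u k))\<^sup>2)"
  by (simp add: power2_norm_eq_inner inner_ell2_def)

lemma ell2_finite_le: "finite A \<Longrightarrow> (\<Sum>k\<in>A. (norm (ell2_nth u k))\<^sup>2) \<le> (norm u)\<^sup>2"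
  unfolding norm_ell2_sq by (rule finite_sum_le_infsum[OF ell2_summable]) auto

lemma norm_ell2_nth_le: "norm (ell2_nth u k) \<le> norm u"
  using ell2_finite_le[of "{k}" u] by (simp add: power2_le_iff_abs_le)

instance ell2 :: (chilbert) chilbert
proof
  fix X :: "nat \<Rightarrow> 'a ell2"
  assume X: "Cauchy X"
  have nth_diff: "ell2_nth (u - v) k = ell2_nth u k - ell2_nth v k" for u v :: "'a ell2" and k
    by (simp add: minus_ell2.rep_eq)
  have "Cauchy (\<lambda>n. ell2_nth (X n) k)" for k
  proof (rule metric_CauchyI)
    fix e :: real assume "e > 0"
    then obtain M where "\<forall>m\<ge>M. \<forall>n\<ge>M. dist (X m) (X n) < e"
      using metric_CauchyD[OF X] by blast
    moreover have "dist (ell2_nth (X m) k) (ell2_nth (X n) k) \<le> dist (X m) (X n)" for m n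
      using norm_ell2_nth_le[of "X m - X n" k] by (simp add: dist_norm nth_diff)
    ultimately show "\<exists>M. \<forall>m\<ge>M. \<forall>n\<ge>M. dist (ell2_nth (X m) k) (ell2_nth (X n) k) < e"
      by (meson le_less_trans)
  qed
  then have "\<forall>k. \<exists>l. (\<lambda>n. ell2_nth (X n) k) \<longlonglongrightarrow> l"
    by (simp add: Cauchy_convergent_iff convergent_def)
  then obtain L where L: "\<And>k. (\<lambda>n. ell2_nth (X n) k) \<longlonglongrightarrow> L k" by metis
  have key: "\<exists>M. \<forall>n\<ge>M. \<forall>A. finite A \<longrightarrow> (\<Sum>k\<in>A. (norm (L k - ell2_nth (X n) k))\<^sup>2) \<le> e\<^sup>2"
    if "e > 0" for e
  proof -
    from \<open>e > 0\<close> obtain M where M: "\<And>m n. m \<ge> M \<Longrightarrow> n \<ge> M \<Longrightarrow> dist (X m) (X n) < e"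
      using metric_CauchyD[OF X] by blast
    have "(\<Sum>k\<in>A. (norm (L k - ell2_nth (X n) k))\<^sup>2) \<le> e\<^sup>2" if "n \<ge> M" "finite A" for n A
    proof (rule LIMSEQ_le_const2)
      show "(\<lambda>m. \<Sum>k\<in>A. (norm (ell2_nth (X m) k - ell2_nth (X n) k))\<^sup>2)
              \<longlonglongrightarrow> (\<Sum>k\<in>A. (norm (L k - ell2_nth (X n) k))\<^sup>2)"
        by (intro tendsto_intros L)
      have "(\<Sum>k\<in>A. (norm (ell2_nth (X m) k - ell2_nth (X n) k))\<^sup>2) \<le> e\<^sup>2" if "m \<ge> M" for m
      proof -
        have "(\<Sum>k\<in>A. (norm (ell2_nth (X m - X n) k))\<^sup>2) \<le> (norm (X m - X n))\<^sup>2"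
          by (rule ell2_finite_le) fact
        also have "\<dots> \<le> e\<^sup>2"
          using M[OF \<open>m \<ge> M\<close> \<open>n \<ge> M\<close>] by (intro power_mono) (auto simp: dist_norm)
        finally show ?thesis by (simp add: nth_diff)
      qed
      then show "\<exists>N. \<forall>m\<ge>N. (\<Sum>k\<in>A. (norm (ell2_nth (X m) k - ell2_nth (X n) k))\<^sup>2) \<le> e\<^sup>2"
        by blast
    qed
    then show ?thesis by blast
  qed
  obtain M where M: "\<forall>n\<ge>M. \<forall>A. finite A \<longrightarrow> (\<Sum>k\<in>A. (norm (L k - ell2_nth (X n) k))\<^sup>2) \<le> 1\<^sup>2"
    using key[of 1] by auto
  have "(\<lambda>k. (norm (L k - ell2_nth (X M) k))\<^sup>2) summable_on UNIV"
    using M by (intro nonneg_bdd_above_summable_on) (auto intro!: bdd_aboveI[of _ 1])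
  then have "(\<lambda>k. (norm ((L k - ell2_nth (X M) k) + ell2_nth (X M) k))\<^sup>2) summable_on UNIV"
    by (intro ell2_add ell2_summable)
  then have "(\<lambda>k. (norm (L k))\<^sup>2) summable_on UNIV" by simp
  then have nth_L: "ell2_nth (Abs_ell2 L) k = L k" for k by (simp add: Abs_ell2_inverse)
  have "X \<longlonglongrightarrow> Abs_ell2 L"
  proof (rule metric_LIMSEQ_I)
    fix r :: real assume "r > 0"
    then obtain M where M: "\<forall>n\<ge>M. \<forall>A. finite A \<longrightarrow> (\<Sum>k\<in>A. (norm (L k - ell2_nth (X n) k))\<^sup>2) \<le> (r/2)\<^sup>2"
      using key[of "r/2"] by auto
    have "dist (X n) (Abs_ell2 L) < r" if "n \<ge> M" for n
    proof -
      have "(norm (Abs_ell2 L - X n))\<^sup>2 \<le> (r/2)\<^sup>2"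
        unfolding norm_ell2_sq
        using M \<open>n \<ge> M\<close> ell2_summable[of "Abs_ell2 L - X n"]
        by (intro infsum_le_finite_sums) (auto simp: nth_diff nth_L)
      then have "norm (Abs_ell2 L - X n) \<le> r/2"
        using \<open>r > 0\<close> by (auto intro: power2_le_imp_le)
      then show ?thesis using \<open>r > 0\<close> by (simp add: dist_norm norm_minus_commute)
    qed
    then show "\<exists>no. \<forall>n\<ge>no. dist (X n) (Abs_ell2 L) < r" by blast
  qed
  then show "convergent X" by (rule convergentI)
qed

section \<open>Bounded operators between closed subspaces\<close>

text \<open>All Hilbert spaces of the theory are closed subspaces of some space of class \<open>chilbert\<close>.
  An operator from \<open>X\<close> to \<open>W\<close> is an extensional function on \<open>X\<close> (it is \<open>undefined\<close> outside \<open>X\<close>),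
  so that equality of operators is equality on \<open>X\<close>.\<close>

definition closed_csubspace :: "'a::complex_inner set \<Rightarrow> bool"
  where "closed_csubspace X \<longleftrightarrow> complex_vector.subspace X \<and> closed X"

definition bdd_op :: "'a::complex_inner set \<Rightarrow> 'b::complex_inner set \<Rightarrow> ('a \<Rightarrow> 'b) set"
  where "bdd_op X W = {T \<in> X \<rightarrow>\<^sub>E W.
           (\<forall>x\<in>X. \<forall>y\<in>X. T (x + y) = T x + T y) \<and>
           (\<forall>a. \<forall>x\<in>X. T (a *\<^sub>C x) = a *\<^sub>C T x) \<and>
           (\<exists>K. \<forall>x\<in>X. norm (T x) \<le> K * norm x)}"

definition contraction_op :: "'a::complex_inner set \<Rightarrow> 'b::complex_inner set \<Rightarrow> ('a \<Rightarrow> 'b) set"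
  where "contraction_op X W = {T \<in> bdd_op X W. \<forall>x\<in>X. norm (T x) \<le> norm x}"

definition adj :: "'a::complex_inner set \<Rightarrow> 'b::complex_inner set \<Rightarrow> ('a \<Rightarrow> 'b) \<Rightarrow> 'b \<Rightarrow> 'a"
  where "adj X W T = (THE S. S \<in> bdd_op W X \<and> (\<forall>x\<in>X. \<forall>y\<in>W. cinner (T x) y = cinner x (S y)))"

definition nonneg_op :: "'a::complex_inner set \<Rightarrow> ('a \<Rightarrow> 'a) \<Rightarrow> bool"
  where "nonneg_op X A \<longleftrightarrow> A \<in> bdd_op X X \<and> (\<forall>x\<in>X. cinner (A x) x \<in> \<real>\<^sub>\<ge>\<^sub>0)"

definition op_sqrt :: "'a::complex_inner set \<Rightarrow> ('a \<Rightarrow> 'a) \<Rightarrow> 'a \<Rightarrow> 'a"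
  where "op_sqrt X A = (THE R. nonneg_op X R \<and> compose X R R = A)"

definition oproj :: "'a::complex_inner set \<Rightarrow> 'a \<Rightarrow> 'a"
  where "oproj X x = (THE y. y \<in> X \<and> (\<forall>z\<in>X. cinner (x - y) z = 0))"

definition coisometry :: "'a::complex_inner set \<Rightarrow> 'b::complex_inner set \<Rightarrow> ('a \<Rightarrow> 'b) \<Rightarrow> bool"
  where "coisometry X W T \<longleftrightarrow> compose W T (adj X W T) = (\<lambda>y\<in>W. y)"

section \<open>Operator matrices\<close>

text \<open>\<open>H j k\<close> is the entry \<open>H\<^sub>j\<^sub>,\<^sub>k : U\<^sub>k \<rightarrow> Y\<^sub>j\<close>, and \<open>hsum U\<close> is the Hilbert direct sum of the \<open>U\<^sub>k\<close>.\<close>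

type_synonym ('u, 'y) opmat = "int \<Rightarrow> int \<Rightarrow> 'u \<Rightarrow> 'y"

definition hsum :: "(int \<Rightarrow> 'a::complex_inner set) \<Rightarrow> 'a ell2 set"
  where "hsum U = {u. \<forall>k. ell2_nth u k \<in> U k}"

definition single :: "int \<Rightarrow> 'a::complex_inner \<Rightarrow> 'a ell2"
  where "single k x = Abs_ell2 (\<lambda>i. if i = k then x else 0)"

definition opmats :: "(int \<Rightarrow> 'u::complex_inner set) \<Rightarrow> (int \<Rightarrow> 'y::complex_inner set) \<Rightarrow> ('u, 'y) opmat set"
  where "opmats U Y = {H. \<forall>j k. H j k \<in> bdd_op (U k) (Y j)}"

definition UM :: "(int \<Rightarrow> 'u::complex_inner set) \<Rightarrow> (int \<Rightarrow> 'y::complex_inner set) \<Rightarrow> ('u, 'y) opmat set"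
  where "UM U Y = {H \<in> opmats U Y. \<forall>j k. k < j \<longrightarrow> (\<forall>u\<in>U k. H j k u = 0)}"

definition UM_strict :: "(int \<Rightarrow> 'u::complex_inner set) \<Rightarrow> (int \<Rightarrow> 'y::complex_inner set) \<Rightarrow> ('u, 'y) opmat set"
  where "UM_strict U Y = {H \<in> opmats U Y. \<forall>j k. k \<le> j \<longrightarrow> (\<forall>u\<in>U k. H j k u = 0)}"

definition UM2_ball :: "(int \<Rightarrow> 'u::complex_inner set) \<Rightarrow> (int \<Rightarrow> 'y::complex_inner set) \<Rightarrow> ('u, 'y) opmat set"
  where "UM2_ball U Y = {H \<in> UM U Y. \<forall>k. \<forall>u\<in>U k.
           (\<lambda>j. (norm (H j k u))\<^sup>2) summable_on {..k} \<and>
           (\<Sum>\<^sub>\<infinity>j\<in>{..k}. (norm (H j k u))\<^sup>2) \<le> (norm u)\<^sup>2}"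

text \<open>A matrix induces the bounded operator \<open>T\<close> on the direct sums if its entries are the matrix
  entries of \<open>T\<close>; by linearity and continuity there is at most one such \<open>T\<close>.\<close>

definition induces ::
    "(int \<Rightarrow> 'u::complex_inner set) \<Rightarrow> (int \<Rightarrow> 'y::complex_inner set) \<Rightarrow> ('u, 'y) opmat \<Rightarrow> ('u ell2 \<Rightarrow> 'y ell2) \<Rightarrow> bool"
  where "induces U Y M T \<longleftrightarrow> T \<in> bdd_op (hsum U) (hsum Y) \<and>
           (\<forall>j k. \<forall>u\<in>U k. ell2_nth (T (single k u)) j = M j k u)"

definition induced_op ::
    "(int \<Rightarrow> 'u::complex_inner set) \<Rightarrow> (int \<Rightarrow> 'y::complex_inner set) \<Rightarrow> ('u, 'y) opmat \<Rightarrow> 'u ell2 \<Rightarrow> 'y ell2"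
  where "induced_op U Y M = (THE T. induces U Y M T)"

definition UMinf :: "(int \<Rightarrow> 'u::complex_inner set) \<Rightarrow> (int \<Rightarrow> 'y::complex_inner set) \<Rightarrow> ('u, 'y) opmat set"
  where "UMinf U Y = {M \<in> UM U Y. \<exists>T. induces U Y M T}"

definition UMinf_ball :: "(int \<Rightarrow> 'u::complex_inner set) \<Rightarrow> (int \<Rightarrow> 'y::complex_inner set) \<Rightarrow> ('u, 'y) opmat set"
  where "UMinf_ball U Y = {M \<in> UM U Y. \<exists>T \<in> contraction_op (hsum U) (hsum Y). induces U Y M T}"

definition diag_mat :: "(int \<Rightarrow> 'u set) \<Rightarrow> (int \<Rightarrow> 'u \<Rightarrow> 'y::zero) \<Rightarrow> ('u, 'y) opmat"
  where "diag_mat U d = (\<lambda>j k. if j = k then (\<lambda>u\<in>U k. d k u) else (\<lambda>u\<in>U k. 0))"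

definition mat_id :: "(int \<Rightarrow> 'u::zero set) \<Rightarrow> ('u, 'u) opmat"
  where "mat_id U = diag_mat U (\<lambda>k u. u)"

definition mat_add :: "(int \<Rightarrow> 'u set) \<Rightarrow> ('u, 'y::plus) opmat \<Rightarrow> ('u, 'y) opmat \<Rightarrow> ('u, 'y) opmat"
  where "mat_add U A B = (\<lambda>j k. \<lambda>u\<in>U k. A j k u + B j k u)"

definition mat_sub :: "(int \<Rightarrow> 'u set) \<Rightarrow> ('u, 'y::minus) opmat \<Rightarrow> ('u, 'y) opmat \<Rightarrow> ('u, 'y) opmat"
  where "mat_sub U A B = (\<lambda>j k. \<lambda>u\<in>U k. A j k u - B j k u)"

text \<open>Product of upper triangular matrices, for which only \<open>j \<le> i \<le> k\<close> contributes to the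
  \<open>(j, k)\<close> entry; \<open>U\<close> is the family on which the right factor \<open>B\<close> acts.\<close>

definition mat_mul ::
    "(int \<Rightarrow> 'u set) \<Rightarrow> ('v, 'y::comm_monoid_add) opmat \<Rightarrow> ('u, 'v) opmat \<Rightarrow> ('u, 'y) opmat"
  where "mat_mul U A B = (\<lambda>j k. \<lambda>u\<in>U k. \<Sum>i\<in>{j..k}. A j i (B i k u))"

text \<open>Inverse in the algebra \<open>UM U U\<close>; only meaningful for matrices that are invertible there.\<close>

definition mat_inv :: "(int \<Rightarrow> 'u::complex_inner set) \<Rightarrow> ('u, 'u) opmat \<Rightarrow> ('u, 'u) opmat"
  where "mat_inv U M = (THE G. G \<in> UM U U \<and> mat_mul U M G = mat_id U \<and> mat_mul U G M = mat_id U)"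

definition mat_adj ::
    "(int \<Rightarrow> 'u::complex_inner set) \<Rightarrow> (int \<Rightarrow> 'y::complex_inner set) \<Rightarrow> ('u, 'y) opmat \<Rightarrow> ('y, 'u) opmat"
  where "mat_adj U Y M = (\<lambda>j k. adj (U j) (Y k) (M k j))"

text \<open>Every finite section is a non-negative operator on \<open>U\<^sub>j \<oplus> \<dots> \<oplus> U\<^sub>k\<close>;
  the sum is the inner product of the section applied to \<open>u\<close> with \<open>u\<close>.\<close>

definition mat_nonneg :: "(int \<Rightarrow> 'u::complex_inner set) \<Rightarrow> ('u, 'u) opmat \<Rightarrow> bool"
  where "mat_nonneg U M \<longleftrightarrow> (\<forall>j k. j \<le> k \<longrightarrow> (\<forall>u. (\<forall>a\<in>{j..k}. u a \<in> U a) \<longrightarrow>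
           (\<Sum>a\<in>{j..k}. cinner (\<Sum>b\<in>{j..k}. M a b (u b)) (u a)) \<in> \<real>\<^sub>\<ge>\<^sub>0))"

definition mat_ge :: "(int \<Rightarrow> 'u::complex_inner set) \<Rightarrow> ('u, 'u) opmat \<Rightarrow> ('u, 'u) opmat \<Rightarrow> bool"
  where "mat_ge U M N \<longleftrightarrow> mat_nonneg U (mat_sub U M N)"

section \<open>The operators associated with H\<close>

definition mat_col :: "(int \<Rightarrow> 'u set) \<Rightarrow> ('u, 'y::complex_inner) opmat \<Rightarrow> int \<Rightarrow> 'u \<Rightarrow> 'y ell2"
  where "mat_col U H k = (\<lambda>u\<in>U k. Abs_ell2 (\<lambda>j. H j k u))"

text \<open>\<open>H\<^sup>*H\<close>, which need not be upper triangular.\<close>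

definition gram ::
    "(int \<Rightarrow> 'u::complex_inner set) \<Rightarrow> (int \<Rightarrow> 'y::complex_inner set) \<Rightarrow> ('u, 'y) opmat \<Rightarrow> ('u, 'u) opmat"
  where "gram U Y H = (\<lambda>j k. compose (U k) (adj (U j) (hsum Y) (mat_col U H j)) (mat_col U H k))"

definition upper_gram ::
    "(int \<Rightarrow> 'u::complex_inner set) \<Rightarrow> (int \<Rightarrow> 'y::complex_inner set) \<Rightarrow> ('u, 'y) opmat \<Rightarrow> ('u, 'u) opmat"
  where "upper_gram U Y H = (\<lambda>j k. if j \<le> k then gram U Y H j k else (\<lambda>u\<in>U k. 0))"

definition defect ::
    "(int \<Rightarrow> 'u::complex_inner set) \<Rightarrow> (int \<Rightarrow> 'y::complex_inner set) \<Rightarrow> ('u, 'y) opmat \<Rightarrow> int \<Rightarrow> 'u \<Rightarrow> 'u"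
  where "defect U Y H k = op_sqrt (U k) (\<lambda>u\<in>U k. u - gram U Y H k k u)"

definition defect_space ::
    "(int \<Rightarrow> 'u::complex_inner set) \<Rightarrow> (int \<Rightarrow> 'y::complex_inner set) \<Rightarrow> ('u, 'y) opmat \<Rightarrow> int \<Rightarrow> 'u set"
  where "defect_space U Y H k = closure (defect U Y H k ` U k)"

definition Nabla ::
    "(int \<Rightarrow> 'u::complex_inner set) \<Rightarrow> (int \<Rightarrow> 'y::complex_inner set) \<Rightarrow> ('u, 'y) opmat \<Rightarrow> ('u, 'u) opmat"
  where "Nabla U Y H = diag_mat (defect_space U Y H) (defect U Y H)"

definition PiH ::
    "(int \<Rightarrow> 'u::complex_inner set) \<Rightarrow> (int \<Rightarrow> 'y::complex_inner set) \<Rightarrow> ('u, 'y) opmat \<Rightarrow> ('u, 'u) opmat"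
  where "PiH U Y H = diag_mat U (\<lambda>k. oproj (defect_space U Y H k))"

definition F_space ::
    "(int \<Rightarrow> 'u::complex_inner set) \<Rightarrow> (int \<Rightarrow> 'y::complex_inner set) \<Rightarrow> (int \<Rightarrow> 'u set) \<Rightarrow> ('u, 'y) opmat \<Rightarrow> int \<Rightarrow> 'u set"
  where "F_space U Y \<F> H k = closure (defect U Y H k ` \<F> k)"

text \<open>\<open>\<omega> k\<close> takes values in the product \<open>'y \<times> 'u\<close>, whose norm is the Hilbert space norm;
  \<open>\<omega>\<^sub>k\<^sub>,\<^sub>1\<close> and \<open>\<omega>\<^sub>k\<^sub>,\<^sub>2\<close> are its \<open>fst\<close> and \<open>snd\<close>.
  The operator below is unique because the vectors \<open>defect U Y H k f\<close> are dense in its domain.\<close>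

definition omega_H ::
    "(int \<Rightarrow> 'u::complex_inner set) \<Rightarrow> (int \<Rightarrow> 'y::complex_inner set) \<Rightarrow> (int \<Rightarrow> 'u set) \<Rightarrow>
     (int \<Rightarrow> 'u \<Rightarrow> 'y \<times> 'u) \<Rightarrow> ('u, 'y) opmat \<Rightarrow> int \<Rightarrow> 'u \<Rightarrow> 'u"
  where "omega_H U Y \<F> \<omega> H k = (THE W. W \<in> bdd_op (F_space U Y \<F> H k) (defect_space U Y H (k - 1)) \<and>
           (\<forall>f\<in>\<F> k. W (defect U Y H k f) = defect U Y H (k - 1) (snd (\<omega> k f))))"

definition C_set ::
    "(int \<Rightarrow> 'u::complex_inner set) \<Rightarrow> (int \<Rightarrow> 'y::complex_inner set) \<Rightarrow> (int \<Rightarrow> 'u set) \<Rightarrow>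
     (int \<Rightarrow> 'u \<Rightarrow> 'y \<times> 'u) \<Rightarrow> ('u, 'y) opmat \<Rightarrow> ('u, 'u) opmat set"
  where "C_set U Y \<F> \<omega> H =
           {C \<in> UMinf_ball (defect_space U Y H) (defect_space U Y H)
                \<inter> UM_strict (defect_space U Y H) (defect_space U Y H).
             \<forall>j k. \<forall>f\<in>F_space U Y \<F> H k.
               C j k f = (if j = k - 1 then omega_H U Y \<F> \<omega> H k f else 0)}"

definition F_mat ::
    "(int \<Rightarrow> 'u::complex_inner set) \<Rightarrow> (int \<Rightarrow> 'y::complex_inner set) \<Rightarrow> ('u, 'y) opmat \<Rightarrow> ('u, 'u) opmat \<Rightarrow> ('u, 'u) opmat"
  where "F_mat U Y H C =
    (let D = defect_space U Y H in
     mat_add U (upper_gram U Y H)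
       (mat_mul U (mat_adj U D (PiH U Y H))
         (mat_mul U (Nabla U Y H)
           (mat_mul U (mat_inv D (mat_sub D (mat_id D) C))
             (mat_mul U (Nabla U Y H) (PiH U Y H))))))"

definition Z1_mat ::
    "(int \<Rightarrow> 'u::complex_inner set) \<Rightarrow> (int \<Rightarrow> 'y::complex_inner set) \<Rightarrow> ('u, 'y) opmat \<Rightarrow> ('u, 'u) opmat \<Rightarrow> ('u, 'y) opmat"
  where "Z1_mat U Y H C = mat_mul U H (mat_inv U (F_mat U Y H C))"

definition Z2_mat ::
    "(int \<Rightarrow> 'u::complex_inner set) \<Rightarrow> (int \<Rightarrow> 'y::complex_inner set) \<Rightarrow> ('u, 'y) opmat \<Rightarrow> ('u, 'u) opmat \<Rightarrow> ('u, 'u) opmat"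
  where "Z2_mat U Y H C = mat_sub U (mat_id U) (mat_inv U (F_mat U Y H C))"

definition Z_props ::
    "(int \<Rightarrow> 'u::complex_inner set) \<Rightarrow> (int \<Rightarrow> 'y::complex_inner set) \<Rightarrow> (int \<Rightarrow> 'u set) \<Rightarrow>
     (int \<Rightarrow> 'u \<Rightarrow> 'y \<times> 'u) \<Rightarrow> ('u, 'y) opmat \<Rightarrow> ('u, 'y) opmat \<Rightarrow> ('u, 'u) opmat \<Rightarrow> bool"
  where "Z_props U Y \<F> \<omega> H Z1 Z2 \<longleftrightarrow>
    (Z1 \<in> UMinf U Y \<and> Z2 \<in> UMinf U U \<inter> UM_strict U U) \<and>
    (\<forall>u\<in>hsum U. (norm (induced_op U Y Z1 u))\<^sup>2 + (norm (induced_op U U Z2 u))\<^sup>2 \<le> (norm u)\<^sup>2) \<and>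
    (\<forall>j k. \<forall>f\<in>\<F> k. Z1 j k f = (if j = k then fst (\<omega> k f) else 0) \<and>
                     Z2 j k f = (if j = k - 1 then snd (\<omega> k f) else 0)) \<and>
    H = mat_mul U Z1 (mat_inv U (mat_sub U (mat_id U) Z2))"

end

theory Submission
  imports Defs
begin

text \<open>
  Put \<open>G = (I - C)\<inverse>\<close>, so that \<open>F = N + D G D\<close> with the diagonal defect operators \<open>D\<close>. Since \<open>N + N\<^sup>*\<close> is
  \<open>H\<^sup>*H\<close> plus its diagonal, \<open>F + F\<^sup>* - H\<^sup>*H - I = D (G + G\<^sup>* - I) D\<close>, and by the Cayley transform \<open>G + G\<^sup>* - I \<ge> 0\<close>
  means that \<open>C\<close> is contractive. On the other hand, for \<open>v = F u\<close> one has
  \<open>\<parallel>Z\<^sup>(\<^sup>1\<^sup>)v\<parallel>\<^sup>2 + \<parallel>Z\<^sup>(\<^sup>2\<^sup>)v\<parallel>\<^sup>2 = \<parallel>H u\<parallel>\<^sup>2 + \<parallel>v - u\<parallel>\<^sup>2\<close>, so that (b) says \<open>2 Re \<langle>F u, u\<rangle> \<ge> \<parallel>H u\<parallel>\<^sup>2 + \<parallel>u\<parallel>\<^sup>2\<close>. Hence both \<open>C\<close> and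
  the pairs \<open>(Z\<^sup>(\<^sup>1\<^sup>), Z\<^sup>(\<^sup>2\<^sup>))\<close> are in bijection with the unipotent \<open>F\<close> with \<open>F + F\<^sup>* \<ge> H\<^sup>*H + I\<close>; in the direction from \<open>F\<close>
  to \<open>C\<close>, the \<open>2 \<times> 2\<close> sections of the positive matrix give the factorization \<open>F - N = D G D\<close>. The
  interpolation conditions on \<open>C\<close>, \<open>G\<close>, \<open>F\<close>, \<open>F\<inverse>\<close> are columnwise equivalent. All estimates are made
  on finite windows \<open>{a..b}\<close> of indices, where the matrices act by finite sums.

  The operator \<open>C\<close> is forced to vanish on a vector orthogonal to \<open>\<F>\<^sub>H\<^sub>k\<close> in every row in which \<open>\<omega>\<^sub>H\<close> is a
  co-isometry, because a contraction preserves orthogonality to the vectors whose norm it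
  preserves; in a row where it is not, there is room for a nonzero rank one perturbation.
\<close>

section \<open>Complex inner products\<close>

text \<open>\<open>H\<close>, \<open>F\<close> and \<open>G\<close> need not induce bounded
  operators on the direct sums; only \<open>C\<close> and the pair do. Triangularity makes up for
  this: rows \<open>a..b\<close> of the image of a vector cut off above \<open>b\<close> involve
  only its components \<open>a..b\<close>, so identities and estimates live on windows, and only
  (a), (b) and the ball condition on \<open>C\<close> are translated to and from the direct sums.
  The one quantity that leaves the window is the norm of a combination of columns of
  \<open>H\<close>, which has entries in all earlier rows; hence the passage from (b) to positivity
  of \<open>F\<close> needs windows that grow downwards.

  The factorization is a Cauchy-Schwarz argument: as \<open>F\<close> has identity diagonal, the
  section of F + F* - H*H - I at \<open>j < k\<close> has diagonal entries D_j^2 and D_k^2 and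
  off-diagonal entry F_jk - N_jk, so this entry is dominated from both sides and the defect
  operators can be divided out.

  For uniqueness the three conditions are one: for each \<open>k\<close>, either column
  \<open>k\<close> has no free vectors, or every row that a free vector could reach is already
  saturated by a co-isometry.\<close>

lemma cinner_add_right: "cinner x (y + z) = cinner x y + cinner x (z::'a::complex_inner)"
  by (metis cinner_commute cinner_add_left complex_cnj_add)

lemma cinner_scaleC_right: "cinner x (a *\<^sub>C y) = cnj a * cinner x (y::'a::complex_inner)"
  by (metis cinner_commute cinner_scaleC_left complex_cnj_mult)

lemma bounded_bilinear_cinner: "bounded_bilinear (cinner :: 'a \<Rightarrow> 'a \<Rightarrow> complex)"
  for x :: "'a::complex_inner"
  by (rule bounded_bilinear.intro)
     (auto simp: cinner_add_left cinner_add_right cinner_scaleC_left cinner_scaleC_right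
       scaleR_conv_of_real simp flip: scaleC_of_real intro!: exI[of _ 1] cmod_cinner_le)

interpretation cinner: bounded_bilinear "cinner :: 'a::complex_inner \<Rightarrow> 'a \<Rightarrow> complex"
  by (rule bounded_bilinear_cinner)

lemma bounded_bilinear_scaleC: "bounded_bilinear (scaleC :: complex \<Rightarrow> 'a \<Rightarrow> 'a::complex_inner)"
proof (rule bounded_bilinear.intro)
  show "(r *\<^sub>R a) *\<^sub>C b = r *\<^sub>R a *\<^sub>C b" for r a and b :: 'a
    by (metis scaleC_of_real scaleC_scaleC scaleR_conv_of_real)
  show "a *\<^sub>C r *\<^sub>R b = r *\<^sub>R a *\<^sub>C b" for r a and b :: 'a
    by (metis scaleC_of_real scaleC_scaleC mult.commute)
qed (auto simp: scaleC_add_right scaleC_add_left norm_scaleC intro!: exI[of _ 1])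

interpretation scaleC: bounded_bilinear "scaleC :: complex \<Rightarrow> 'a \<Rightarrow> 'a::complex_inner"
  by (rule bounded_bilinear_scaleC)

lemma cinner_self: "cinner x x = complex_of_real ((norm x)\<^sup>2)"
proof -
  have "cinner x x \<in> \<real>"
    using cinner_commute[of x x] by (simp add: complex_is_Real_iff complex_eq_iff)
  then show ?thesis
    by (metis Re_cinner of_real_Re power2_norm_eq_inner)
qed

text \<open>The real part at \<open>\<i> *\<^sub>C x\<close> is minus the imaginary part at
  \<open>x\<close>, so equal real parts on a set closed under \<open>\<i>\<close> suffice.
  Variational arguments, which see only real parts, thus give complex identities.\<close>

lemma cinner_eqI:
  assumes "\<And>x. x \<in> X \<Longrightarrow> Re (f x) = Re (g x)" "\<And>x. x \<in> X \<Longrightarrow> \<i> *\<^sub>C x \<in> X"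
    and "\<And>x. x \<in> X \<Longrightarrow> f (\<i> *\<^sub>C x) = \<i> * f x" "\<And>x. x \<in> X \<Longrightarrow> g (\<i> *\<^sub>C x) = \<i> * g x"
    and "x \<in> X"
  shows "f x = g x"
  using assms(1)[OF assms(5)] assms(1)[OF assms(2)[OF assms(5)]] assms(3,4)[OF assms(5)]
  by (simp add: complex_eq_iff)

lemma norm_add_sq: "(norm (x + y))\<^sup>2 = (norm x)\<^sup>2 + (norm y)\<^sup>2 + 2 * inner x (y::'a::real_inner)"
  by (simp add: power2_norm_eq_inner inner_add_left inner_add_right inner_commute)

lemma norm_diff_sq: "(norm (x - y))\<^sup>2 = (norm x)\<^sup>2 + (norm y)\<^sup>2 - 2 * inner x (y::'a::real_inner)"
  by (simp add: power2_norm_eq_inner inner_diff_left inner_diff_right inner_commute)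

text \<open>Taking \<open>t\<close> as a real multiple of \<open>- cnj \<beta>\<close> leaves a real
  quadratic. For \<open>a = 0\<close> the conclusion forces \<open>\<beta> = 0\<close>, which is the
  form needed for first variations and for saturated contractions.\<close>

lemma cross_term_le:
  assumes nn: "\<And>t::complex. a + 2 * Re (t * \<beta>) + (cmod t)\<^sup>2 * b \<ge> 0" and "b \<ge> 0"
  shows "(cmod \<beta>)\<^sup>2 \<le> a * b"
proof -
  have q: "a - 2 * r * (cmod \<beta>)\<^sup>2 + r\<^sup>2 * (cmod \<beta>)\<^sup>2 * b \<ge> 0" for r :: real
  proof -
    have "Re (cnj \<beta> * \<beta>) = (cmod \<beta>)\<^sup>2"
      by (simp add: cmod_def power2_eq_square)
    then show ?thesis
      using nn[of "- of_real r * cnj \<beta>"] by (simp add: norm_mult power_mult_distrib mult.assoc)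
  qed
  show ?thesis
  proof (cases "b = 0")
    case True
    have "(cmod \<beta>)\<^sup>2 = 0"
    proof (rule ccontr)
      assume ne: "(cmod \<beta>)\<^sup>2 \<noteq> 0"
      \<comment> \<open>With \<open>b = 0\<close> the expression is affine in \<open>r\<close>; this
        \<open>r\<close> gives it the value -1.\<close>
      show False
        using q[of "(a + 1) / (2 * (cmod \<beta>)\<^sup>2)"] True ne by simp
    qed
    then show ?thesis by (simp add: True)
  next
    case False
    with \<open>b \<ge> 0\<close> have "b > 0" by simp
    \<comment> \<open>\<open>r = 1 / b\<close> is the minimizer.\<close>
    then show ?thesis
      using q[of "1 / b"] by (simp add: field_simps power2_eq_square)
  qed
qed

section \<open>Closed subspaces and operators between them\<close>

abbreviation csubspace :: "'a::complex_inner set \<Rightarrow> bool"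
  where "csubspace \<equiv> complex_vector.subspace"

lemmas csubspace_0 = complex_vector.subspace_0
  and csubspace_add = complex_vector.subspace_add
  and csubspace_diff = complex_vector.subspace_diff
  and csubspace_scaleC = complex_vector.subspace_scale
  and csubspace_sum = complex_vector.subspace_sum

lemma csubspace_scaleR: "csubspace X \<Longrightarrow> x \<in> X \<Longrightarrow> r *\<^sub>R x \<in> X"
  by (metis csubspace_scaleC scaleC_of_real)

lemma closed_csubspaceD: "closed_csubspace X \<Longrightarrow> csubspace X" "closed_csubspace X \<Longrightarrow> closed X"
  by (auto simp: closed_csubspace_def)

lemma bdd_opI:
  assumes "T \<in> extensional X" "\<And>x. x \<in> X \<Longrightarrow> T x \<in> W"
    "\<And>x y. x \<in> X \<Longrightarrow> y \<in> X \<Longrightarrow> T (x + y) = T x + T y"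
    "\<And>a x. x \<in> X \<Longrightarrow> T (a *\<^sub>C x) = a *\<^sub>C T x"
    "\<And>x. x \<in> X \<Longrightarrow> norm (T x) \<le> K * norm x"
  shows "T \<in> bdd_op X W"
  unfolding bdd_op_def PiE_def using assms by (intro CollectI conjI IntI Pi_I ballI allI exI[of _ K]) auto

lemma
  assumes "T \<in> bdd_op X W"
  shows bdd_op_ext: "T \<in> extensional X"
    and bdd_op_mem: "x \<in> X \<Longrightarrow> T x \<in> W"
    and bdd_op_add: "x \<in> X \<Longrightarrow> y \<in> X \<Longrightarrow> T (x + y) = T x + T y"
    and bdd_op_scaleC: "x \<in> X \<Longrightarrow> T (a *\<^sub>C x) = a *\<^sub>C T x"
  using assms unfolding bdd_op_def by (auto simp: PiE_def)

lemma bdd_op_bound: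
  assumes "T \<in> bdd_op X W"
  obtains K where "K \<ge> 0" "\<And>x. x \<in> X \<Longrightarrow> norm (T x) \<le> K * norm x"
proof -
  obtain K where K: "\<forall>x\<in>X. norm (T x) \<le> K * norm x"
    using assms unfolding bdd_op_def by blast
  have "norm (T x) \<le> max K 0 * norm x" if "x \<in> X" for x
    using K that by (meson max.cobounded1 mult_right_mono norm_ge_zero order_trans)
  then show ?thesis by (intro that[of "max K 0"]) auto
qed

lemma bdd_op_eqI:
  assumes "S \<in> bdd_op X W" "T \<in> bdd_op X W'" "\<And>x. x \<in> X \<Longrightarrow> S x = T x"
  shows "S = T"
  using bdd_op_ext[OF assms(1)] bdd_op_ext[OF assms(2)] assms(3) by (rule extensionalityI)

context
  fixes X :: "'a::complex_inner set" and W :: "'b::complex_inner set" and T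
  assumes T: "T \<in> bdd_op X W" and X: "csubspace X"
begin

lemma bdd_op_0: "T 0 = 0"
  using bdd_op_scaleC[OF T csubspace_0[OF X], of 0] by simp

lemma bdd_op_diff: "x \<in> X \<Longrightarrow> y \<in> X \<Longrightarrow> T (x - y) = T x - T y"
  using bdd_op_add[OF T, of "x - y" y] csubspace_diff[OF X, of x y] by simp

lemma bdd_op_sum: "(\<And>i. i \<in> I \<Longrightarrow> f i \<in> X) \<Longrightarrow> T (sum f I) = (\<Sum>i\<in>I. T (f i))"
proof (induction I rule: infinite_finite_induct)
  case (insert i I)
  then show ?case
    by (simp add: bdd_op_add[OF T] csubspace_sum[OF X])
qed (auto simp: bdd_op_0)

lemma bdd_op_tendsto:
  assumes f: "(f \<longlongrightarrow> l) G" "\<And>n. f n \<in> X" "l \<in> X"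
  shows "((\<lambda>n. T (f n)) \<longlongrightarrow> T l) G"
proof -
  obtain K where K: "\<And>x. x \<in> X \<Longrightarrow> norm (T x) \<le> K * norm x" using bdd_op_bound[OF T] by blast
  have "((\<lambda>n. K * norm (f n - l)) \<longlongrightarrow> K * norm (l - l)) G"
    by (intro tendsto_intros f)
  then have "((\<lambda>n. K * norm (f n - l)) \<longlongrightarrow> 0) G" by simp
  then have "((\<lambda>n. T (f n) - T l) \<longlongrightarrow> 0) G"
    by (rule Lim_null_comparison[rotated])
       (use K f csubspace_diff[OF X] in \<open>auto simp flip: bdd_op_diff\<close>)
  then show ?thesis by (simp add: LIM_zero_iff)
qed

end

lemma bdd_op_compose:
  assumes T: "T \<in> bdd_op X V" and S: "S \<in> bdd_op V W" and X: "csubspace X"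
  shows "(\<lambda>x\<in>X. S (T x)) \<in> bdd_op X W"
proof -
  obtain K where K: "K \<ge> 0" "\<And>x. x \<in> X \<Longrightarrow> norm (T x) \<le> K * norm x" using bdd_op_bound[OF T] by blast
  obtain L where L: "L \<ge> 0" "\<And>x. x \<in> V \<Longrightarrow> norm (S x) \<le> L * norm x" using bdd_op_bound[OF S] by blast
  show ?thesis
  proof (rule bdd_opI[where K = "L * K"])
    fix x assume "x \<in> X"
    then have "norm (S (T x)) \<le> L * (K * norm x)"
      using L K bdd_op_mem[OF T] by (meson mult_left_mono order_trans)
    then show "norm ((\<lambda>x\<in>X. S (T x)) x) \<le> L * K * norm x" using \<open>x \<in> X\<close> by (simp add: mult.assoc)
  qed (auto simp: bdd_op_add[OF T] bdd_op_add[OF S] bdd_op_scaleC[OF T] bdd_op_scaleC[OF S]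
      bdd_op_mem[OF T] bdd_op_mem[OF S] csubspace_add[OF X] csubspace_scaleC[OF X])
qed

lemma bdd_op_plus:
  assumes T: "T \<in> bdd_op X W" and S: "S \<in> bdd_op X W" and X: "csubspace X" and W: "csubspace W"
  shows "(\<lambda>x\<in>X. T x + S x) \<in> bdd_op X W"
proof -
  obtain K where K: "K \<ge> 0" "\<And>x. x \<in> X \<Longrightarrow> norm (T x) \<le> K * norm x" using bdd_op_bound[OF T] by blast
  obtain L where L: "L \<ge> 0" "\<And>x. x \<in> X \<Longrightarrow> norm (S x) \<le> L * norm x" using bdd_op_bound[OF S] by blast
  show ?thesis
  proof (rule bdd_opI[where K = "K + L"])
    fix x assume "x \<in> X"
    then show "norm ((\<lambda>x\<in>X. T x + S x) x) \<le> (K + L) * norm x"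
      using norm_triangle_mono[OF K(2) L(2)] by (simp add: algebra_simps)
  qed (auto simp: bdd_op_add[OF T] bdd_op_add[OF S] bdd_op_scaleC[OF T] bdd_op_scaleC[OF S]
      bdd_op_mem[OF T] bdd_op_mem[OF S] csubspace_add[OF X] csubspace_scaleC[OF X]
      csubspace_add[OF W] scaleC_add_right)
qed

lemma bdd_op_cmult:
  assumes T: "T \<in> bdd_op X W" and X: "csubspace X" and W: "csubspace W"
  shows "(\<lambda>x\<in>X. a *\<^sub>C T x) \<in> bdd_op X W"
proof -
  obtain K where K: "K \<ge> 0" "\<And>x. x \<in> X \<Longrightarrow> norm (T x) \<le> K * norm x" using bdd_op_bound[OF T] by blast
  show ?thesis
  proof (rule bdd_opI[where K = "cmod a * K"])
    fix x assume "x \<in> X"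
    then show "norm ((\<lambda>x\<in>X. a *\<^sub>C T x) x) \<le> cmod a * K * norm x"
      using K by (simp add: norm_scaleC mult.assoc mult_left_mono)
  qed (auto simp: bdd_op_add[OF T] bdd_op_scaleC[OF T] bdd_op_mem[OF T] csubspace_add[OF X]
      csubspace_scaleC[OF X] csubspace_scaleC[OF W] scaleC_add_right scaleC_scaleC mult.commute)
qed

lemma bdd_op_minus:
  assumes T: "T \<in> bdd_op X W" and S: "S \<in> bdd_op X W" and X: "csubspace X" and W: "csubspace W"
  shows "(\<lambda>x\<in>X. T x - S x) \<in> bdd_op X W"
proof -
  have "(\<lambda>x\<in>X. T x - S x) = (\<lambda>x\<in>X. T x + (\<lambda>x\<in>X. (-1) *\<^sub>C S x) x)"
    using scaleC_of_real[of "-1"] by (auto simp: fun_eq_iff)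
  with bdd_op_plus[OF T bdd_op_cmult[OF S X W, of "-1"] X W] show ?thesis by simp
qed

lemma bdd_op_zero: "csubspace W \<Longrightarrow> csubspace X \<Longrightarrow> (\<lambda>x\<in>X. 0) \<in> bdd_op X W"
  by (rule bdd_opI[where K = 0]) (auto simp: csubspace_0 csubspace_add csubspace_scaleC)

lemma bdd_op_id: "csubspace X \<Longrightarrow> X \<subseteq> W \<Longrightarrow> (\<lambda>x\<in>X. x) \<in> bdd_op X W"
  by (rule bdd_opI[where K = 1]) (auto simp: csubspace_0 csubspace_add csubspace_scaleC)

lemma bdd_op_setsum:
  assumes "\<And>i. i \<in> I \<Longrightarrow> T i \<in> bdd_op X W" and X: "csubspace X" and W: "csubspace W"
  shows "(\<lambda>x\<in>X. \<Sum>i\<in>I. T i x) \<in> bdd_op X W"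
  using assms(1)
proof (induction I rule: infinite_finite_induct)
  case (insert i I)
  have "(\<lambda>x\<in>X. \<Sum>i\<in>insert i I. T i x) = (\<lambda>x\<in>X. T i x + (\<lambda>x\<in>X. \<Sum>i\<in>I. T i x) x)"
    using insert.hyps by (auto simp: fun_eq_iff)
  moreover have "T i \<in> bdd_op X W" "(\<lambda>x\<in>X. \<Sum>i\<in>I. T i x) \<in> bdd_op X W"
    using insert by blast+
  ultimately show ?case using bdd_op_plus[OF _ _ X W] by metis
qed (simp_all add: bdd_op_zero[OF W X])

lemma bdd_op_restrict:
  assumes T: "T \<in> bdd_op X W" and X': "csubspace X'" "X' \<subseteq> X"
  shows "(\<lambda>x\<in>X'. T x) \<in> bdd_op X' W"
proof -
  obtain K where "\<And>x. x \<in> X \<Longrightarrow> norm (T x) \<le> K * norm x" using bdd_op_bound[OF T] by blast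
  then show ?thesis
    using X'(2) by (intro bdd_opI[where K = K])
      (auto simp: bdd_op_mem[OF T] bdd_op_add[OF T] bdd_op_scaleC[OF T] csubspace_add[OF X'(1)]
        csubspace_scaleC[OF X'(1)] subset_iff)
qed

lemma csubspace_closure: "csubspace X \<Longrightarrow> csubspace (closure X)"
proof -
  assume X: "csubspace X"
  have "x + y \<in> closure X" if xy: "x \<in> closure X" "y \<in> closure X" for x y
  proof -
    obtain f g where "\<forall>n. f n \<in> X" "f \<longlonglongrightarrow> x" "\<forall>n. g n \<in> X" "g \<longlonglongrightarrow> y"
      using xy unfolding closure_sequential by blast
    then show ?thesis
      unfolding closure_sequential
      by (intro exI[of _ "\<lambda>n. f n + g n"]) (auto intro: tendsto_add csubspace_add[OF X])
  qed
  moreover have "a *\<^sub>C x \<in> closure X" if x: "x \<in> closure X" for a x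
  proof -
    obtain f where "\<forall>n. f n \<in> X" "f \<longlonglongrightarrow> x" using x unfolding closure_sequential by blast
    then show ?thesis
      unfolding closure_sequential
      by (intro exI[of _ "\<lambda>n. a *\<^sub>C f n"]) (auto intro: scaleC.tendsto csubspace_scaleC[OF X])
  qed
  moreover have "0 \<in> closure X"
    using csubspace_0[OF X] closure_subset by blast
  ultimately show ?thesis
    by (simp add: complex_vector.subspace_def)
qed

lemma csubspace_image:
  assumes T: "T \<in> bdd_op X W" and X: "csubspace X"
  shows "csubspace (T ` X)"
  unfolding complex_vector.subspace_def
proof (intro conjI ballI allI)
  show "0 \<in> T ` X" using csubspace_0[OF X] bdd_op_0[OF T X] by (metis imageI)
qed (use csubspace_add[OF X] csubspace_scaleC[OF X] bdd_op_add[OF T] bdd_op_scaleC[OF T] in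
  \<open>auto simp flip: bdd_op_add[OF T] bdd_op_scaleC[OF T]\<close>)

lemma closed_csubspace_closure_image:
  assumes "T \<in> bdd_op X W" "csubspace X"
  shows "closed_csubspace (closure (T ` X))"
  using csubspace_closure[OF csubspace_image[OF assms]] by (simp add: closed_csubspace_def)

section \<open>Riesz representation, projections and adjoints\<close>

text \<open>The representing vector is the minimizer of \<open>\<parallel>x\<parallel>\<^sup>2 - 2 Re (\<phi> x)\<close>; minimizing sequences are
  Cauchy sequences by the parallelogram law.\<close>

lemma riesz:
  fixes X :: "'a::chilbert set" and \<phi> :: "'a \<Rightarrow> complex"
  assumes X: "closed_csubspace X"
    and add: "\<And>x y. x \<in> X \<Longrightarrow> y \<in> X \<Longrightarrow> \<phi> (x + y) = \<phi> x + \<phi> y"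
    and sc: "\<And>a x. x \<in> X \<Longrightarrow> \<phi> (a *\<^sub>C x) = a * \<phi> x"
    and bd: "\<And>x. x \<in> X \<Longrightarrow> cmod (\<phi> x) \<le> K * norm x"
  obtains y where "y \<in> X" "\<And>x. x \<in> X \<Longrightarrow> \<phi> x = cinner x y"
proof -
  note sub = closed_csubspaceD(1)[OF X]
  define J where "J x = (norm x)\<^sup>2 - 2 * Re (\<phi> x)" for x
  have scR: "\<phi> (r *\<^sub>R x) = of_real r * \<phi> x" if "x \<in> X" for r x
    using sc[OF that, of "of_real r"] by (simp add: scaleC_of_real)
  have J_low: "- (K\<^sup>2) \<le> J x" if "x \<in> X" for x
  proof -
    have "Re (\<phi> x) \<le> K * norm x" using bd[OF that] complex_Re_le_cmod order_trans by blast
    moreover have "0 \<le> (norm x - K)\<^sup>2" by simp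
    ultimately show ?thesis unfolding J_def power2_diff by (simp add: mult.commute)
  qed
  define m where "m = Inf (J ` X)"
  have bb: "bdd_below (J ` X)" using J_low by (auto intro!: bdd_belowI2)
  have m_le: "m \<le> J x" if "x \<in> X" for x
    unfolding m_def using bb that by (simp add: cInf_lower)
  have "\<exists>x\<in>X. J x < m + inverse (real (Suc n))" for n
  proof -
    have "Inf (J ` X) < m + inverse (real (Suc n))" by (simp add: m_def)
    then show ?thesis using cInf_lessD[of "J ` X"] csubspace_0[OF sub] by blast
  qed
  then obtain s where s: "\<And>n. s n \<in> X" "\<And>n. J (s n) < m + inverse (real (Suc n))" by metis
  have par: "(norm (x - y))\<^sup>2 \<le> 2 * (J x - m) + 2 * (J y - m)" if "x \<in> X" "y \<in> X" for x y
  proof -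
    have mem: "(1/2) *\<^sub>R (x + y) \<in> X" using that by (intro csubspace_scaleR csubspace_add sub)
    have "J ((1/2) *\<^sub>R (x + y)) = (norm (x + y))\<^sup>2 / 4 - Re (\<phi> x) - Re (\<phi> y)"
      unfolding J_def norm_scaleR power_mult_distrib
      by (subst scR) (use that in \<open>auto simp: add csubspace_add[OF sub] power_divide field_simps simp del: scaleR_add_right\<close>)
    moreover have "(norm (x + y))\<^sup>2 + (norm (x - y))\<^sup>2 = 2 * (norm x)\<^sup>2 + 2 * (norm y)\<^sup>2"
      by (simp add: norm_add_sq norm_diff_sq)
    ultimately show ?thesis using m_le[OF mem] by (simp add: J_def)
  qed
  have lim0: "(\<lambda>n. inverse (real (Suc n))) \<longlonglongrightarrow> 0" by (rule LIMSEQ_inverse_real_of_nat)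
  have "Cauchy s"
  proof (rule metric_CauchyI)
    fix e :: real assume "e > 0"
    \<comment> \<open>\<open>par\<close> counts each of the two excesses over \<open>m\<close>
      twice, hence the quarter.\<close>
    then obtain N where N: "\<And>n. n \<ge> N \<Longrightarrow> inverse (real (Suc n)) < e\<^sup>2 / 4"
      using order_tendstoD(2)[OF lim0, of "e\<^sup>2 / 4"] by (auto simp: eventually_sequentially)
    have "dist (s i) (s j) < e" if "i \<ge> N" "j \<ge> N" for i j
    proof -
      have "(norm (s i - s j))\<^sup>2 < e\<^sup>2"
      proof -
        have "J (s i) - m < e\<^sup>2 / 4" "J (s j) - m < e\<^sup>2 / 4"
          using less_trans[OF s(2)[of i] add_strict_left_mono[OF N[OF that(1)]]]
            less_trans[OF s(2)[of j] add_strict_left_mono[OF N[OF that(2)]]] by simp_all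
        then show ?thesis using par[OF s(1)[of i] s(1)[of j]] by argo
      qed
      then show ?thesis using \<open>e > 0\<close> by (simp add: dist_norm power_less_imp_less_base)
    qed
    then show "\<exists>M. \<forall>m\<ge>M. \<forall>n\<ge>M. dist (s m) (s n) < e" by blast
  qed
  then obtain y where y: "s \<longlonglongrightarrow> y" by (auto simp: Cauchy_convergent_iff convergent_def)
  then have yX: "y \<in> X"
    using closed_csubspaceD(2)[OF X] s(1) closed_sequentially by blast
  have Jy: "J y \<le> m"
  proof -
    \<comment> \<open>\<open>J y - J (s n)\<close> splits into a difference of squared norms and
      \<open>2 * Re (\<phi> (s n - y))\<close>; the former and the bound for the latter tend to
      0.\<close>
    have ineq: "J y \<le> J (s n) + (norm y - norm (s n)) * (norm y + norm (s n)) + 2 * (K * norm (s n - y))" for n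
    proof -
      have "\<phi> (s n) = \<phi> y + \<phi> (s n - y)" using add[of y "s n - y"] s(1) yX csubspace_diff[OF sub] by simp
      moreover have "Re (\<phi> (s n - y)) \<le> K * norm (s n - y)"
        using bd[of "s n - y"] complex_Re_le_cmod[of "\<phi> (s n - y)"] s(1)[of n] yX csubspace_diff[OF sub] by fastforce
      ultimately show ?thesis by (simp add: J_def algebra_simps power2_eq_square)
    qed
    have "J y \<le> (m + inverse (real (Suc n))) + (norm y - norm (s n)) * (norm y + norm (s n)) + 2 * (K * norm (s n - y))" for n
      using ineq[of n] s(2)[of n] by linarith
    moreover have "(\<lambda>n. (m + inverse (real (Suc n))) + (norm y - norm (s n)) * (norm y + norm (s n)) + 2 * (K * norm (s n - y)))
        \<longlonglongrightarrow> (m + 0) + (norm y - norm y) * (norm y + norm y) + 2 * (K * norm (y - y))"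
      by (intro tendsto_intros y lim0)
    ultimately show ?thesis by (auto dest!: LIMSEQ_le_const[where a = "J y"])
  qed
  have re: "Re (\<phi> x) = Re (cinner x y)" if x: "x \<in> X" for x
  proof -
    have "0 + 2 * Re (complex_of_real t * (cinner x y - \<phi> x)) + (cmod (of_real t))\<^sup>2 * (norm x)\<^sup>2 \<ge> 0" for t
    proof -
      have "m \<le> J (y + t *\<^sub>R x)" using x yX by (intro m_le csubspace_add[OF sub] csubspace_scaleR[OF sub])
      also have "J (y + t *\<^sub>R x) = J y + 2 * t * (inner x y - Re (\<phi> x)) + t\<^sup>2 * (norm x)\<^sup>2"
        using x yX by (simp add: J_def norm_add_sq add scR csubspace_scaleR[OF sub] power_mult_distrib
            inner_commute algebra_simps)
      finally show ?thesis using Jy by (simp add: Re_cinner)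
    qed
    then have t: "2 * (t * (Re (cinner x y) - Re (\<phi> x))) + t\<^sup>2 * (norm x)\<^sup>2 \<ge> 0" for t :: real
      by simp
    \<comment> \<open>The first variation is available for real \<open>t\<close> only. Its
      coefficient is real, so for complex \<open>z\<close> just \<open>Re z\<close> enters the
      linear term, while the quadratic term can only grow.\<close>
    have "(cmod (of_real (Re (cinner x y) - Re (\<phi> x))))\<^sup>2 \<le> 0 * (norm x)\<^sup>2"
    proof (rule cross_term_le)
      fix z :: complex
      have "(Re z)\<^sup>2 \<le> (cmod z)\<^sup>2" by (simp add: cmod_power2)
      then have "(Re z)\<^sup>2 * (norm x)\<^sup>2 \<le> (cmod z)\<^sup>2 * (norm x)\<^sup>2" by (intro mult_right_mono) auto
      then show "0 \<le> 0 + 2 * Re (z * of_real (Re (cinner x y) - Re (\<phi> x))) + (cmod z)\<^sup>2 * (norm x)\<^sup>2"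
        using t[of "Re z"] by simp
    qed simp
    then show ?thesis by simp
  qed
  have "\<phi> x = cinner x y" if "x \<in> X" for x
    by (rule cinner_eqI[of X \<phi> "\<lambda>x. cinner x y"])
       (use re sc that in \<open>auto simp: cinner_scaleC_left csubspace_scaleC[OF sub]\<close>)
  then show ?thesis using yX that by blast
qed

lemma cinner_ext:
  assumes "x \<in> X" "y \<in> X" "csubspace X" "\<And>z. z \<in> X \<Longrightarrow> cinner z x = cinner z y"
  shows "x = y"
proof -
  have "cinner (x - y) (x - y) = 0"
    using assms(4)[OF csubspace_diff[OF assms(3,1,2)]] by (simp add: cinner.diff_right)
  then show ?thesis by (simp add: cinner_self)
qed

lemma cinner_ext':
  assumes "x \<in> X" "y \<in> X" "csubspace X" "\<And>z. z \<in> X \<Longrightarrow> cinner x z = cinner y z"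
  shows "x = y"
  by (rule cinner_ext[OF assms(1-3)]) (metis assms(4) cinner_commute)

lemma cmod_cinner_bound_left:
  "norm x \<le> c * r \<Longrightarrow> cmod (cinner x y) \<le> c * r * norm (y::'a::complex_inner)"
  by (meson cmod_cinner_le mult_right_mono norm_ge_zero order_trans)

text \<open>The projection is the Riesz vector of \<open>\<lambda>z. cinner z x\<close> on
  \<open>X\<close>; two candidates have the same inner products with \<open>X\<close>, hence
  coincide.\<close>

lemma oproj_exists:
  fixes X :: "'a::chilbert set"
  assumes X: "closed_csubspace X"
  shows "\<exists>!y. y \<in> X \<and> (\<forall>z\<in>X. cinner (x - y) z = 0)"
proof -
  obtain y where y: "y \<in> X" "\<And>z. z \<in> X \<Longrightarrow> cinner z x = cinner z y"
    by (rule riesz[OF X, of "\<lambda>z. cinner z x" "norm x"])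
       (auto simp: cinner_add_left cinner_scaleC_left mult.commute intro: cmod_cinner_le[THEN order_trans])
  have "cinner (x - y) z = 0" if "z \<in> X" for z
    using y(2)[OF that] by (metis cinner.diff_left cinner_commute right_minus_eq)
  moreover have "y' = y" if "y' \<in> X" "\<forall>z\<in>X. cinner (x - y') z = 0" for y'
  proof (rule cinner_ext'[OF that(1) y(1) closed_csubspaceD(1)[OF X]])
    show "cinner y' z = cinner y z" if "z \<in> X" for z
      using \<open>\<forall>z\<in>X. cinner (x - y') z = 0\<close> calculation that
      by (metis cinner.diff_left right_minus_eq)
  qed
  ultimately show ?thesis using y(1) by blast
qed

context
  fixes X :: "'a::chilbert set"
  assumes X: "closed_csubspace X"
begin

lemma oproj_mem: "oproj X x \<in> X" and oproj_orth: "z \<in> X \<Longrightarrow> cinner (x - oproj X x) z = 0"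
  using theI'[OF oproj_exists[OF X, of x]] unfolding oproj_def by auto

lemma oproj_eqI: "y \<in> X \<Longrightarrow> (\<And>z. z \<in> X \<Longrightarrow> cinner (x - y) z = 0) \<Longrightarrow> oproj X x = y"
  using oproj_exists[OF X, of x] oproj_mem oproj_orth by blast

lemma oproj_id: "x \<in> X \<Longrightarrow> oproj X x = x"
  by (rule oproj_eqI) (auto simp: cinner.zero_left)

lemma oproj_add: "oproj X (x + y) = oproj X x + oproj X y"
proof (rule oproj_eqI)
  show "oproj X x + oproj X y \<in> X" by (intro csubspace_add closed_csubspaceD X oproj_mem)
  show "cinner (x + y - (oproj X x + oproj X y)) z = 0" if "z \<in> X" for z
    using oproj_orth[OF that, of x] oproj_orth[OF that, of y]
    by (simp add: cinner.diff_left cinner.add_left)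
qed

lemma oproj_scaleC: "oproj X (a *\<^sub>C x) = a *\<^sub>C oproj X x"
proof (rule oproj_eqI)
  show "a *\<^sub>C oproj X x \<in> X" by (intro csubspace_scaleC closed_csubspaceD X oproj_mem)
  show "cinner (a *\<^sub>C x - a *\<^sub>C oproj X x) z = 0" if "z \<in> X" for z
    using oproj_orth[OF that, of x] by (simp add: cinner.diff_left cinner_scaleC_left)
qed

lemma norm_oproj_sq: "(norm x)\<^sup>2 = (norm (oproj X x))\<^sup>2 + (norm (x - oproj X x))\<^sup>2"
proof -
  have "inner (x - oproj X x) (oproj X x) = 0"
    using oproj_orth[OF oproj_mem, of x] by (metis Re_cinner zero_complex.simps(1))
  then show ?thesis
    using norm_add_sq[of "x - oproj X x" "oproj X x"] by simp
qed

lemma norm_oproj_le: "norm (oproj X x) \<le> norm x"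
  using norm_oproj_sq[of x] by (simp add: power2_le_imp_le)

lemma bdd_op_oproj: "csubspace V \<Longrightarrow> (\<lambda>x\<in>V. oproj X x) \<in> bdd_op V X"
  by (rule bdd_opI[where K = 1])
     (auto simp: oproj_mem oproj_add oproj_scaleC csubspace_add csubspace_scaleC norm_oproj_le)

end

text \<open>\<open>adj\<close> is a definite description, so an adjoint is computed by exhibiting
  one operator with the right pairing.\<close>

lemma adj_eqI:
  fixes X :: "'a::complex_inner set"
  assumes X: "csubspace X" and S: "S \<in> bdd_op W X"
    and eq: "\<And>x y. x \<in> X \<Longrightarrow> y \<in> W \<Longrightarrow> cinner (T x) y = cinner x (S y)"
  shows "adj X W T = S"
  unfolding adj_def
proof (rule the_equality)
  fix S' assume S': "S' \<in> bdd_op W X \<and> (\<forall>x\<in>X. \<forall>y\<in>W. cinner (T x) y = cinner x (S' y))"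
  have "S' y = S y" if "y \<in> W" for y
    by (rule cinner_ext[OF _ _ X]) (use S' S eq bdd_op_mem that in \<open>fastforce+\<close>)
  then show "S' = S" using S S' bdd_op_eqI by blast
qed (use S eq in auto)

lemma adj_exists:
  fixes X :: "'a::chilbert set"
  assumes X: "closed_csubspace X" and W: "csubspace W" and T: "T \<in> bdd_op X W"
  shows "\<exists>S\<in>bdd_op W X. \<forall>x\<in>X. \<forall>y\<in>W. cinner (T x) y = cinner x (S y)"
proof -
  obtain K where K: "K \<ge> 0" "\<And>x. x \<in> X \<Longrightarrow> norm (T x) \<le> K * norm x" using bdd_op_bound[OF T] by blast
  have "\<exists>s\<in>X. \<forall>x\<in>X. cinner (T x) y = cinner x s" for y
  proof -
    have "cmod (cinner (T x) y) \<le> K * norm y * norm x" if "x \<in> X" for x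
      using cmod_cinner_bound_left[OF K(2)[OF that], of y] by (simp add: mult_ac)
    then obtain s where "s \<in> X" "\<And>x. x \<in> X \<Longrightarrow> cinner (T x) y = cinner x s"
      by (rule riesz[OF X, of "\<lambda>x. cinner (T x) y" "K * norm y", rotated 2])
         (auto simp: bdd_op_add[OF T] bdd_op_scaleC[OF T] cinner_add_left cinner_scaleC_left)
    then show ?thesis by blast
  qed
  then obtain S where S: "\<And>y. S y \<in> X" "\<And>x y. x \<in> X \<Longrightarrow> cinner (T x) y = cinner x (S y)" by metis
  note sub = closed_csubspaceD(1)[OF X]
  have "(\<lambda>y\<in>W. S y) \<in> bdd_op W X"
  proof (rule bdd_opI[where K = K])
    fix y assume y: "y \<in> W"
    have "(norm (S y))\<^sup>2 = cmod (cinner (T (S y)) y)"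
      by (simp add: S cinner_self norm_power)
    also have "\<dots> \<le> K * norm (S y) * norm y" by (rule cmod_cinner_bound_left) (simp add: K S)
    finally have "norm (S y) * norm (S y) \<le> norm (S y) * (K * norm y)" by (simp add: power2_eq_square mult_ac)
    then have "norm (S y) \<le> K * norm y"
      by (cases "S y = 0") (auto simp: K)
    then show "norm ((\<lambda>y\<in>W. S y) y) \<le> K * norm y" using y by simp
  next
    fix x y assume xy: "x \<in> W" "y \<in> W"
    have "S (x + y) = S x + S y"
      by (rule cinner_ext[OF _ _ sub]) (auto simp: S csubspace_add[OF sub] cinner_add_right simp flip: S(2))
    then show "(\<lambda>y\<in>W. S y) (x + y) = (\<lambda>y\<in>W. S y) x + (\<lambda>y\<in>W. S y) y"
      using xy by (simp add: csubspace_add[OF W])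
  next
    fix a x assume x: "x \<in> W"
    have "S (a *\<^sub>C x) = a *\<^sub>C S x"
      by (rule cinner_ext[OF _ _ sub]) (auto simp: S csubspace_scaleC[OF sub] cinner_scaleC_right simp flip: S(2))
    then show "(\<lambda>y\<in>W. S y) (a *\<^sub>C x) = a *\<^sub>C (\<lambda>y\<in>W. S y) x"
      using x by (simp add: csubspace_scaleC[OF W])
  qed (auto simp: S)
  then show ?thesis using S by (intro bexI[of _ "\<lambda>y\<in>W. S y"]) auto
qed

context
  fixes X :: "'a::chilbert set" and W :: "'b::complex_inner set" and T
  assumes X: "closed_csubspace X" and W: "csubspace W" and T: "T \<in> bdd_op X W"
begin

lemma adj_bdd: "adj X W T \<in> bdd_op W X"
  and adj_cinner: "x \<in> X \<Longrightarrow> y \<in> W \<Longrightarrow> cinner (T x) y = cinner x (adj X W T y)"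
  using adj_exists[OF X W T] adj_eqI[OF closed_csubspaceD(1)[OF X]] by metis+

lemma adj_cinner': "x \<in> X \<Longrightarrow> y \<in> W \<Longrightarrow> cinner (adj X W T y) x = cinner y (T x)"
  using adj_cinner by (metis cinner_commute)

end

section \<open>Extension by density\<close>

text \<open>Domination makes \<open>A p\<close> a Lipschitz function of \<open>d p\<close>, which
  therefore extends to the closure of the range. It serves three times: for a functional and then
  for a choice of preimages in \<open>defect_factor\<close>, and for the construction of
  \<open>omega_H\<close>.\<close>

lemma dominated_factor:
  fixes A :: "'a::complex_inner \<Rightarrow> 'c::chilbert" and d :: "'a \<Rightarrow> 'b::complex_inner"
  assumes P: "csubspace P" and W: "closed W" and d: "d \<in> bdd_op P V"
    and mem: "\<And>p. p \<in> P \<Longrightarrow> A p \<in> W"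
    and add: "\<And>p q. p \<in> P \<Longrightarrow> q \<in> P \<Longrightarrow> A (p + q) = A p + A q"
    and sc: "\<And>a p. p \<in> P \<Longrightarrow> A (a *\<^sub>C p) = a *\<^sub>C A p"
    and bd: "\<And>p. p \<in> P \<Longrightarrow> norm (A p) \<le> K * norm (d p)" and K: "K \<ge> 0"
  obtains B where "B \<in> bdd_op (closure (d ` P)) W" "\<And>p. p \<in> P \<Longrightarrow> B (d p) = A p"
    "\<And>x. x \<in> closure (d ` P) \<Longrightarrow> norm (B x) \<le> K * norm x"
proof -
  let ?X = "closure (d ` P)"
  have Adiff: "A (p - q) = A p - A q" if "p \<in> P" "q \<in> P" for p q
    using add[of "p - q" q] csubspace_diff[OF P that] that by simp
  have ddiff: "norm (A p - A q) \<le> K * norm (d p - d q)" if "p \<in> P" "q \<in> P" for p q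
    using bd[OF csubspace_diff[OF P that]] that by (simp add: Adiff bdd_op_diff[OF d P])
  have "\<exists>s l. (\<forall>n. s n \<in> P) \<and> (\<lambda>n. d (s n)) \<longlonglongrightarrow> x \<and> (\<lambda>n. A (s n)) \<longlonglongrightarrow> l" if "x \<in> ?X" for x
  proof -
    obtain f where f: "\<forall>n. f n \<in> d ` P" "f \<longlonglongrightarrow> x" using \<open>x \<in> ?X\<close> unfolding closure_sequential by metis
    then have "\<forall>n. \<exists>p\<in>P. f n = d p" by blast
    then obtain s where s: "\<And>n. s n \<in> P" "\<And>n. f n = d (s n)" by metis
    have "Cauchy (\<lambda>n. A (s n))"
    proof (rule metric_CauchyI)
      fix e :: real assume "e > 0"
      moreover have "Cauchy f" using f(2) by (rule LIMSEQ_imp_Cauchy)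
      ultimately obtain M where M: "\<forall>m\<ge>M. \<forall>n\<ge>M. dist (f m) (f n) < e / (K + 1)"
        using K by (meson metric_CauchyD divide_pos_pos add_nonneg_pos zero_less_one)
      have "dist (A (s m)) (A (s n)) < e" if "m \<ge> M" "n \<ge> M" for m n
      proof -
        have "dist (A (s m)) (A (s n)) \<le> K * dist (f m) (f n)" by (simp add: dist_norm s ddiff)
        also have "\<dots> \<le> (K + 1) * dist (f m) (f n)" by (intro mult_right_mono) auto
        also have "\<dots> < e" using M that K by (simp add: field_simps)
        finally show ?thesis .
      qed
      then show "\<exists>M. \<forall>m\<ge>M. \<forall>n\<ge>M. dist (A (s m)) (A (s n)) < e" by blast
    qed
    then obtain l where "(\<lambda>n. A (s n)) \<longlonglongrightarrow> l" by (auto simp: Cauchy_convergent_iff convergent_def)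
    moreover have "f = (\<lambda>n. d (s n))" using s(2) by blast
    ultimately show ?thesis using s(1) f(2) by blast
  qed
  then obtain s l where s: "\<And>x n. x \<in> ?X \<Longrightarrow> s x n \<in> P" "\<And>x. x \<in> ?X \<Longrightarrow> (\<lambda>n. d (s x n)) \<longlonglongrightarrow> x"
     "\<And>x. x \<in> ?X \<Longrightarrow> (\<lambda>n. A (s x n)) \<longlonglongrightarrow> l x" by metis
  \<comment> \<open>Any approximating sequence computes \<open>l x\<close>; linearity then follows
    by adding or scaling the chosen sequences.\<close>
  have uniq: "l x = y" if x: "x \<in> ?X" and t: "\<And>n. t n \<in> P" "(\<lambda>n. d (t n)) \<longlonglongrightarrow> x" "(\<lambda>n. A (t n)) \<longlonglongrightarrow> y" for x t y
  proof -
    have "(\<lambda>n. K * norm (d (s x n) - d (t n))) \<longlonglongrightarrow> K * norm (x - x)"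
      by (intro tendsto_intros s t x)
    then have "(\<lambda>n. K * norm (d (s x n) - d (t n))) \<longlonglongrightarrow> 0" by simp
    then have "(\<lambda>n. A (s x n) - A (t n)) \<longlonglongrightarrow> 0"
      by (rule Lim_null_comparison[rotated]) (use ddiff s(1)[OF x] t(1) in auto)
    moreover have "(\<lambda>n. A (s x n) - A (t n)) \<longlonglongrightarrow> l x - y" by (intro tendsto_intros s t x)
    ultimately show ?thesis using LIMSEQ_unique by fastforce
  qed
  have Xs: "csubspace ?X" using csubspace_closure[OF csubspace_image[OF d P]] .
  have nrm: "norm (l x) \<le> K * norm x" if x: "x \<in> ?X" for x
    by (rule LIMSEQ_le[of "\<lambda>n. norm (A (s x n))" _ "\<lambda>n. K * norm (d (s x n))"])
       (auto intro!: tendsto_intros s x bd)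
  have "(\<lambda>x\<in>?X. l x) \<in> bdd_op ?X W"
  proof (rule bdd_opI[where K = K])
    show "(\<lambda>x\<in>?X. l x) x \<in> W" if "x \<in> ?X" for x
      using closed_sequentially[OF W, of "\<lambda>n. A (s x n)" "l x"] s mem that by auto
    show "norm ((\<lambda>x\<in>?X. l x) x) \<le> K * norm x" if "x \<in> ?X" for x using nrm that by simp
  next
    fix x y assume xy: "x \<in> ?X" "y \<in> ?X"
    have "l (x + y) = l x + l y"
    proof (rule uniq[of _ "\<lambda>n. s x n + s y n"])
      show "(\<lambda>n. d (s x n + s y n)) \<longlonglongrightarrow> x + y"
        using tendsto_add[OF s(2)[OF xy(1)] s(2)[OF xy(2)]] s(1) xy by (simp add: bdd_op_add[OF d])
      show "(\<lambda>n. A (s x n + s y n)) \<longlonglongrightarrow> l x + l y"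
        using tendsto_add[OF s(3)[OF xy(1)] s(3)[OF xy(2)]] s(1) xy by (simp add: add)
    qed (use xy s csubspace_add[OF P] csubspace_add[OF Xs] in auto)
    then show "(\<lambda>x\<in>?X. l x) (x + y) = (\<lambda>x\<in>?X. l x) x + (\<lambda>x\<in>?X. l x) y"
      using xy by (simp add: csubspace_add[OF Xs])
  next
    fix a x assume x: "x \<in> ?X"
    have "l (a *\<^sub>C x) = a *\<^sub>C l x"
    proof (rule uniq[of _ "\<lambda>n. a *\<^sub>C s x n"])
      show "(\<lambda>n. d (a *\<^sub>C s x n)) \<longlonglongrightarrow> a *\<^sub>C x"
        using scaleC.tendsto[OF tendsto_const s(2)[OF x]] s(1) x by (simp add: bdd_op_scaleC[OF d])
      show "(\<lambda>n. A (a *\<^sub>C s x n)) \<longlonglongrightarrow> a *\<^sub>C l x"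
        using scaleC.tendsto[OF tendsto_const s(3)[OF x]] s(1) x by (simp add: sc)
    qed (use x s csubspace_scaleC[OF P] csubspace_scaleC[OF Xs] in auto)
    then show "(\<lambda>x\<in>?X. l x) (a *\<^sub>C x) = a *\<^sub>C (\<lambda>x\<in>?X. l x) x"
      using x by (simp add: csubspace_scaleC[OF Xs])
  qed auto
  moreover have "(\<lambda>x\<in>?X. l x) (d p) = A p" if "p \<in> P" for p
    using uniq[of "d p" "\<lambda>_. p" "A p"] that closure_subset[of "d ` P"] by auto
  ultimately show ?thesis using nrm that by auto
qed

lemma bdd_op_eq_on_closure:
  assumes B: "B \<in> bdd_op (closure X) W" and B': "B' \<in> bdd_op (closure X) W'" and X: "csubspace X"
    and eq: "\<And>x. x \<in> X \<Longrightarrow> B x = B' x" and x: "x \<in> closure X"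
  shows "B x = B' x"
proof -
  obtain f where f: "\<forall>n. f n \<in> X" "f \<longlonglongrightarrow> x" using x unfolding closure_sequential by blast
  have f': "f n \<in> closure X" for n using f closure_subset by blast
  have "(\<lambda>n. B (f n)) \<longlonglongrightarrow> B x" "(\<lambda>n. B' (f n)) \<longlonglongrightarrow> B' x"
    by (intro bdd_op_tendsto[OF B] bdd_op_tendsto[OF B'] csubspace_closure X f f' x)+
  then show ?thesis using eq f(1) LIMSEQ_unique by auto
qed

lemma cinner_closure_0:
  assumes "\<And>z. z \<in> X \<Longrightarrow> cinner x z = 0" "z \<in> closure X"
  shows "cinner x z = 0"
proof -
  obtain f where f: "\<forall>n. f n \<in> X" "f \<longlonglongrightarrow> z" using assms(2) unfolding closure_sequential by blast
  have "(\<lambda>n. cinner x (f n)) \<longlonglongrightarrow> cinner x z" by (intro cinner.tendsto tendsto_const f)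
  then show ?thesis using assms(1) f(1) by (simp add: LIMSEQ_const_iff)
qed

section \<open>Square roots of non-negative operators\<close>

text \<open>\<open>nonneg_op\<close> asks only for a non-negative quadratic form. Symmetry comes by
  polarization, from the forms at \<open>x + y\<close> and \<open>x + \<i> *\<^sub>C y\<close> being
  real.\<close>

lemma nonneg_op_sym:
  assumes "nonneg_op X S" "csubspace X" "x \<in> X" "y \<in> X"
  shows "cinner (S x) y = cinner x (S y)"
proof -
  have S: "S \<in> bdd_op X X" and re: "\<And>x. x \<in> X \<Longrightarrow> cinner (S x) x \<in> \<real>"
    using assms(1) by (auto simp: nonneg_op_def nonneg_Reals_subset_Reals[THEN subsetD])
  have sw: "cnj (cinner (S x) x) = cinner (S x) x" if "x \<in> X" for x
    using re[OF that] by (simp add: Reals_cnj_iff)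
  define p where "p = cinner (S x) y"
  define q where "q = cinner (S y) x"
  have 1: "cinner (S (x + y)) (x + y) = cinner (S x) x + cinner (S y) y + p + q"
    using assms by (simp add: bdd_op_add[OF S] cinner.add_left cinner.add_right p_def q_def)
  have "x + \<i> *\<^sub>C y \<in> X" using assms by (intro csubspace_add csubspace_scaleC)
  have 2: "cinner (S (x + \<i> *\<^sub>C y)) (x + \<i> *\<^sub>C y) = cinner (S x) x + cinner (S y) y - \<i> * p + \<i> * q"
    using assms by (simp add: bdd_op_add[OF S] bdd_op_scaleC[OF S] csubspace_scaleC cinner.add_left cinner.add_right
       cinner_scaleC_left cinner_scaleC_right p_def q_def algebra_simps) 
  have "cnj p + cnj q = p + q"
    using sw[of "x + y"] sw[OF assms(3)] sw[OF assms(4)] assms by (simp add: 1 csubspace_add)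
  moreover have "\<i> * cnj p - \<i> * cnj q = - \<i> * p + \<i> * q"
    using sw[OF \<open>x + \<i> *\<^sub>C y \<in> X\<close>] sw[OF assms(3)] sw[OF assms(4)] by (simp add: 2)
  then have "cnj p - cnj q = q - p"
    by (metis (no_types, lifting) complex_i_not_zero mult_cancel_left mult_minus_left right_diff_distrib uminus_add_conv_diff)
  ultimately have "p = cnj q" by (simp add: complex_eq_iff)
  then show ?thesis by (metis p_def q_def cinner_commute)
qed

text \<open>The form at \<open>cnj t *\<^sub>C y + x\<close> is the quadratic of
  \<open>cross_term_le\<close> with cross term \<open>cinner (S x) y\<close>.\<close>

lemma nonneg_op_cauchy_schwarz:
  assumes S: "nonneg_op X S" and X: "csubspace X" and "x \<in> X" "y \<in> X"
  shows "(cmod (cinner (S x) y))\<^sup>2 \<le> Re (cinner (S x) x) * Re (cinner (S y) y)"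
proof (rule cross_term_le)
  have b: "S \<in> bdd_op X X" and nn: "\<And>x. x \<in> X \<Longrightarrow> 0 \<le> Re (cinner (S x) x)"
    using S by (auto simp: nonneg_op_def complex_nonneg_Reals_iff)
  show "0 \<le> Re (cinner (S y) y)" by (rule nn) fact
  fix t :: complex
  have "t *\<^sub>C x + y \<in> X" using assms by (simp add: csubspace_add csubspace_scaleC)
  then have ty: "cnj t *\<^sub>C y + x \<in> X" using assms by (simp add: csubspace_add csubspace_scaleC)
  have "cinner (S y) x = cnj (cinner (S x) y)"
    by (metis nonneg_op_sym[OF S X \<open>x \<in> X\<close> \<open>y \<in> X\<close>] cinner_commute)
  then have "cinner (S (cnj t *\<^sub>C y + x)) (cnj t *\<^sub>C y + x) =
     cinner (S x) x + (t * cinner (S x) y + cnj (t * cinner (S x) y)) + cnj t * t * cinner (S y) y"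
    using assms by (simp add: bdd_op_add[OF b] bdd_op_scaleC[OF b] csubspace_scaleC
        cinner.add_left cinner.add_right cinner_scaleC_left cinner_scaleC_right algebra_simps)
  moreover have "cnj t * t = of_real ((cmod t)\<^sup>2)" by (metis complex_norm_square mult.commute)
  ultimately show "0 \<le> Re (cinner (S x) x) + 2 * Re (t * cinner (S x) y) + (cmod t)\<^sup>2 * Re (cinner (S y) y)"
    using nn[OF ty] by simp
qed

lemma nonneg_op_eq_0:
  assumes S: "nonneg_op X S" and X: "csubspace X" and "y \<in> X" "Re (cinner (S y) y) = 0"
  shows "S y = 0"
proof -
  have "S y \<in> X" using S \<open>y \<in> X\<close> by (auto simp: nonneg_op_def bdd_op_mem)
  then have "cinner (S y) (S y) = 0"
    using nonneg_op_cauchy_schwarz[OF S X \<open>y \<in> X\<close>, of "S y"] assms(4) by simp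
  then show ?thesis by (simp add: cinner_self)
qed

text \<open>The iteration \<open>Y\<^sub>n\<^sub>+\<^sub>1 = (B + Y\<^sub>n\<^sup>2) / 2\<close> is dominated in norm by the scalar one with \<open>B = 1\<close>, hence converges;
  its limit \<open>Y\<close> satisfies \<open>(I - Y)\<^sup>2 = I - B\<close>. Uniqueness of the square root needs that \<open>Y\<close> lies in the
  bicommutant of \<open>B\<close>.\<close>

definition bicomm :: "'a::complex_inner set \<Rightarrow> ('a \<Rightarrow> 'a) \<Rightarrow> real \<Rightarrow> ('a \<Rightarrow> 'a) \<Rightarrow> bool"
  where "bicomm X B c T \<longleftrightarrow> T \<in> bdd_op X X \<and> (\<forall>x\<in>X. norm (T x) \<le> c * norm x) \<and>
    (\<forall>x\<in>X. \<forall>y\<in>X. cinner (T x) y = cinner x (T y)) \<and>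
    (\<forall>S\<in>bdd_op X X. (\<forall>x\<in>X. S (B x) = B (S x)) \<longrightarrow> (\<forall>x\<in>X. S (T x) = T (S x)))"

fun sqrt_iter :: "'a::complex_inner set \<Rightarrow> ('a \<Rightarrow> 'a) \<Rightarrow> nat \<Rightarrow> 'a \<Rightarrow> 'a"
  where "sqrt_iter X B 0 = (\<lambda>x\<in>X. 0)"
  | "sqrt_iter X B (Suc n) = (\<lambda>x\<in>X. (1/2) *\<^sub>R (B x + sqrt_iter X B n (sqrt_iter X B n x)))"

fun sqrt_bound :: "nat \<Rightarrow> real"
  where "sqrt_bound 0 = 0"
  | "sqrt_bound (Suc n) = (1 + (sqrt_bound n)\<^sup>2) / 2"

lemma sqrt_bound_01: "0 \<le> sqrt_bound n \<and> sqrt_bound n \<le> 1"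
  by (induction n) (auto simp: power_le_one)

lemma sqrt_bound_mono: "sqrt_bound n \<le> sqrt_bound (Suc n)"
proof -
  have "0 \<le> (1 - sqrt_bound n)\<^sup>2" by simp
  then show ?thesis by (simp add: power2_diff)
qed

context
  fixes X :: "'a::chilbert set" and B
  assumes X: "closed_csubspace X" and B: "B \<in> bdd_op X X"
    and Bc: "\<And>x. x \<in> X \<Longrightarrow> norm (B x) \<le> norm x"
    and Bs: "\<And>x y. x \<in> X \<Longrightarrow> y \<in> X \<Longrightarrow> cinner (B x) y = cinner x (B y)"
begin

lemma bicomm_sub: "csubspace X" by (rule closed_csubspaceD[OF X])

lemma bicomm_B: "bicomm X B 1 B" using B Bc Bs by (auto simp: bicomm_def)

lemma bicomm_0: "bicomm X B 0 (\<lambda>x\<in>X. 0)"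
  unfolding bicomm_def
  using bdd_op_zero[OF bicomm_sub bicomm_sub] by (auto simp: cinner.zero_left cinner.zero_right bdd_op_0[OF _ bicomm_sub] bdd_op_mem)

lemma bicomm_add: "bicomm X B c T \<Longrightarrow> bicomm X B d S \<Longrightarrow> bicomm X B (c + d) (\<lambda>x\<in>X. T x + S x)"
  unfolding bicomm_def
  by (auto simp: cinner.add_left cinner.add_right bdd_op_mem distrib_right bdd_op_add
      intro: bdd_op_plus[OF _ _ bicomm_sub bicomm_sub] norm_triangle_mono)

lemma bicomm_scale: "bicomm X B c T \<Longrightarrow> r \<ge> 0 \<Longrightarrow> bicomm X B (r * c) (\<lambda>x\<in>X. r *\<^sub>R T x)"
  unfolding bicomm_def scaleC_of_real[symmetric]
  by (auto simp: cinner_scaleC_left cinner_scaleC_right bdd_op_mem bdd_op_scaleC norm_scaleC mult.assoc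
      intro: bdd_op_cmult[OF _ bicomm_sub bicomm_sub] mult_left_mono)

text \<open>\<open>B\<close> commutes with itself, so \<open>T\<close> commutes with
  \<open>B\<close>; hence \<open>T\<close> is among the operators with which \<open>S\<close>
  commutes.\<close>

lemma bicomm_commute: "bicomm X B c T \<Longrightarrow> bicomm X B d S \<Longrightarrow> x \<in> X \<Longrightarrow> T (S x) = S (T x)"
proof -
  assume T: "bicomm X B c T" and S: "bicomm X B d S" and x: "x \<in> X"
  have "\<forall>x\<in>X. T (B x) = B (T x)" using T B unfolding bicomm_def by metis
  then show ?thesis using S T x unfolding bicomm_def by blast
qed

lemma bicomm_comp:
  assumes T: "bicomm X B c T" and S: "bicomm X B d S" and c: "c \<ge> 0"
  shows "bicomm X B (c * d) (\<lambda>x\<in>X. T (S x))"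
proof -
  have b: "T \<in> bdd_op X X" "S \<in> bdd_op X X" using T S by (auto simp: bicomm_def)
  have "norm (T (S x)) \<le> c * d * norm x" if "x \<in> X" for x
  proof -
    have "norm (T (S x)) \<le> c * norm (S x)" using T bdd_op_mem[OF b(2) that] by (auto simp: bicomm_def)
    also have "\<dots> \<le> c * (d * norm x)" using S c that by (intro mult_left_mono) (auto simp: bicomm_def)
    finally show ?thesis by (simp add: mult.assoc)
  qed
  moreover have "cinner (T (S x)) y = cinner x (T (S y))" if "x \<in> X" "y \<in> X" for x y
    using T S b that bicomm_commute[OF T S that(2)] unfolding bicomm_def
    by (metis bdd_op_mem)
  ultimately show ?thesis
    using T S bdd_op_compose[OF b(2,1) bicomm_sub] unfolding bicomm_def
    by (auto simp: bdd_op_mem)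
qed

lemma sqrt_iter_bicomm: "bicomm X B (sqrt_bound n) (sqrt_iter X B n)"
proof (induction n)
  case 0
  show ?case unfolding sqrt_iter.simps sqrt_bound.simps by (rule bicomm_0)
next
  case (Suc n)
  have "bicomm X B (1/2 * (1 + sqrt_bound n * sqrt_bound n))
     (\<lambda>x\<in>X. (1/2) *\<^sub>R (\<lambda>x\<in>X. B x + (\<lambda>x\<in>X. sqrt_iter X B n (sqrt_iter X B n x)) x) x)"
    using sqrt_bound_01[of n]
    by (intro bicomm_scale bicomm_add bicomm_B bicomm_comp Suc) auto
  moreover have "(\<lambda>x\<in>X. (1/2) *\<^sub>R (\<lambda>x\<in>X. B x + (\<lambda>x\<in>X. sqrt_iter X B n (sqrt_iter X B n x)) x) x) = sqrt_iter X B (Suc n)"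
    by (auto simp: fun_eq_iff)
  moreover have "1/2 * (1 + sqrt_bound n * sqrt_bound n) = sqrt_bound (Suc n)"
    by (simp add: power2_eq_square)
  ultimately show ?case by metis
qed

lemma sqrt_iter_mem: "x \<in> X \<Longrightarrow> sqrt_iter X B n x \<in> X"
  using sqrt_iter_bicomm[of n] by (auto simp: bicomm_def bdd_op_mem)

text \<open>Since the iterates commute, the next difference is half the product of the sum and the
  difference of consecutive iterates. The scalar iteration obeys the same identity, so the norm
  constants match exactly and later telescope.\<close>

lemma sqrt_iter_diff_bicomm:
  "bicomm X B (sqrt_bound (Suc n) - sqrt_bound n) (\<lambda>x\<in>X. sqrt_iter X B (Suc n) x - sqrt_iter X B n x)"
proof (induction n)
  case 0
  have "bicomm X B (1/2 * 1) (\<lambda>x\<in>X. (1/2) *\<^sub>R B x)" by (rule bicomm_scale[OF bicomm_B]) simp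
  moreover have "(\<lambda>x\<in>X. sqrt_iter X B (Suc 0) x - sqrt_iter X B 0 x) = (\<lambda>x\<in>X. (1/2) *\<^sub>R B x)"
    using csubspace_0[OF bicomm_sub] by (auto simp: fun_eq_iff)
  ultimately have "bicomm X B (1/2 * 1) (\<lambda>x\<in>X. sqrt_iter X B (Suc 0) x - sqrt_iter X B 0 x)" by metis
  then show ?case by (simp del: sqrt_iter.simps restrict_apply)
next
  case (Suc n)
  let ?Y = "sqrt_iter X B" and ?b = sqrt_bound
  have "bicomm X B (1/2 * ((?b (Suc n) + ?b n) * (?b (Suc n) - ?b n)))
     (\<lambda>x\<in>X. (1/2) *\<^sub>R (\<lambda>x\<in>X. (\<lambda>x\<in>X. ?Y (Suc n) x + ?Y n x) ((\<lambda>x\<in>X. ?Y (Suc n) x - ?Y n x) x)) x)"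
    using sqrt_bound_01[of n] sqrt_bound_01[of "Suc n"]
    by (intro bicomm_scale bicomm_comp bicomm_add sqrt_iter_bicomm Suc) auto
  moreover have "1/2 * ((?b (Suc n) + ?b n) * (?b (Suc n) - ?b n)) = ?b (Suc (Suc n)) - ?b (Suc n)"
    unfolding sqrt_bound.simps(2)[of "Suc n"] sqrt_bound.simps(2)[of n]
    by (simp add: power2_eq_square field_simps)
  moreover have "(\<lambda>x\<in>X. (1/2) *\<^sub>R (\<lambda>x\<in>X. (\<lambda>x\<in>X. ?Y (Suc n) x + ?Y n x) ((\<lambda>x\<in>X. ?Y (Suc n) x - ?Y n x) x)) x)
     = (\<lambda>x\<in>X. ?Y (Suc (Suc n)) x - ?Y (Suc n) x)"
  proof (rule restrict_ext)
    fix x assume x: "x \<in> X"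
    define P where "P = ?Y (Suc n)"
    have P: "P \<in> bdd_op X X" and Y: "?Y n \<in> bdd_op X X"
      using sqrt_iter_bicomm unfolding bicomm_def P_def by blast+
    have mem: "P x \<in> X" "?Y n x \<in> X" "P x - ?Y n x \<in> X"
      using x P Y by (auto simp: bdd_op_mem intro!: csubspace_diff[OF bicomm_sub])
    have com: "P (?Y n x) = ?Y n (P x)"
      unfolding P_def by (rule bicomm_commute[OF sqrt_iter_bicomm sqrt_iter_bicomm x])
    have "?Y (Suc (Suc n)) x = (1/2) *\<^sub>R (B x + P (P x))" "?Y (Suc n) x = (1/2) *\<^sub>R (B x + ?Y n (?Y n x))"
      using x by (simp_all add: P_def del: sqrt_iter.simps(2) add: sqrt_iter.simps(2)[of X B "Suc n"])
         (simp add: x)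
    then show "(1/2) *\<^sub>R (\<lambda>x\<in>X. (\<lambda>x\<in>X. ?Y (Suc n) x + ?Y n x) ((\<lambda>x\<in>X. ?Y (Suc n) x - ?Y n x) x)) x
     = ?Y (Suc (Suc n)) x - ?Y (Suc n) x"
      using x mem com unfolding P_def[symmetric]
      by (simp add: bdd_op_diff[OF P bicomm_sub] bdd_op_diff[OF Y bicomm_sub] algebra_simps)
  qed
  ultimately show ?case by metis
qed

lemma sqrt_iter_diff: "m \<le> n \<Longrightarrow> x \<in> X \<Longrightarrow>
   norm (sqrt_iter X B n x - sqrt_iter X B m x) \<le> (sqrt_bound n - sqrt_bound m) * norm x"
proof (induction rule: dec_induct)
  case (step n)
  have "norm (sqrt_iter X B (Suc n) x - sqrt_iter X B n x) \<le> (sqrt_bound (Suc n) - sqrt_bound n) * norm x"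
    using sqrt_iter_diff_bicomm[of n] step.prems by (simp add: bicomm_def)
  with step have "norm ((sqrt_iter X B (Suc n) x - sqrt_iter X B n x) + (sqrt_iter X B n x - sqrt_iter X B m x))
     \<le> (sqrt_bound (Suc n) - sqrt_bound n) * norm x + (sqrt_bound n - sqrt_bound m) * norm x"
    by (intro norm_triangle_mono) auto
  then show ?case by (simp add: algebra_simps)
qed simp

lemma sqrt_iter_conv:
  assumes x: "x \<in> X"
  shows "convergent (\<lambda>n. sqrt_iter X B n x)"
proof -
  have "incseq sqrt_bound" using sqrt_bound_mono by (rule incseq_SucI)
  moreover from this have "convergent sqrt_bound"
    using sqrt_bound_01 by (metis incseq_convergent convergentI)
  then have C: "Cauchy sqrt_bound" by (rule convergent_Cauchy)
  have "Cauchy (\<lambda>n. sqrt_iter X B n x)"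
  proof (rule CauchyI')
    fix e :: real assume "e > 0"
    then have "0 < e / (norm x + 1)" by (simp add: add_nonneg_pos)
    then obtain M where M: "\<forall>m\<ge>M. \<forall>n\<ge>M. dist (sqrt_bound m) (sqrt_bound n) < e / (norm x + 1)"
      using metric_CauchyD[OF C] by blast
    have "dist (sqrt_iter X B m x) (sqrt_iter X B n x) < e" if "m \<ge> M" "n > m" for m n
    proof -
      have d: "norm (sqrt_iter X B n x - sqrt_iter X B m x) \<le> (sqrt_bound n - sqrt_bound m) * norm x"
        using sqrt_iter_diff[OF less_imp_le x, of m n] that by simp
      have bb: "0 \<le> sqrt_bound n - sqrt_bound m" "sqrt_bound n - sqrt_bound m < e / (norm x + 1)"
        using M[rule_format, of n m] that incseqD[OF \<open>incseq sqrt_bound\<close>, of m n]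
        by (auto simp: dist_norm)
      have "(sqrt_bound n - sqrt_bound m) * norm x \<le> (sqrt_bound n - sqrt_bound m) * (norm x + 1)"
        using bb by (intro mult_left_mono) auto
      also have "\<dots> < e" using bb(2) by (simp add: pos_less_divide_eq add_nonneg_pos)
      finally show ?thesis using d by (simp add: dist_norm norm_minus_commute)
    qed
    then show "\<exists>M. \<forall>m\<ge>M. \<forall>n>m. dist (sqrt_iter X B m x) (sqrt_iter X B n x) < e" by blast
  qed
  then show ?thesis by (simp add: Cauchy_convergent_iff)
qed

lemma sqrt_limit_exists: "\<exists>Y. bicomm X B 1 Y \<and> (\<forall>x\<in>X. Y x = (1/2) *\<^sub>R (B x + Y (Y x)))"
proof -
  let ?Y = "sqrt_iter X B"
  obtain L where L: "\<And>x. x \<in> X \<Longrightarrow> (\<lambda>n. ?Y n x) \<longlonglongrightarrow> L x"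
    using sqrt_iter_conv unfolding convergent_def by metis
  have Yb: "?Y n \<in> bdd_op X X" for n using sqrt_iter_bicomm unfolding bicomm_def by blast
  have Yn: "norm (?Y n x) \<le> norm x" if "x \<in> X" for n x
  proof -
    have "norm (?Y n x) \<le> sqrt_bound n * norm x" using that sqrt_iter_bicomm unfolding bicomm_def by blast
    also have "\<dots> \<le> 1 * norm x" using sqrt_bound_01 by (intro mult_right_mono) auto
    finally show ?thesis by simp
  qed
  have LX: "L x \<in> X" if "x \<in> X" for x
    using closed_sequentially[OF closed_csubspaceD(2)[OF X], of "\<lambda>n. ?Y n x" "L x"] L that sqrt_iter_mem by blast
  have Ln: "norm (L x) \<le> norm x" if "x \<in> X" for x
    by (rule LIMSEQ_le_const2[OF tendsto_norm[OF L[OF that]]]) (use Yn that in auto)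
  have Lb: "(\<lambda>x\<in>X. L x) \<in> bdd_op X X"
  proof (rule bdd_opI[where K = 1])
    fix x y assume xy: "x \<in> X" "y \<in> X"
    have "(\<lambda>n. ?Y n (x + y)) \<longlonglongrightarrow> L x + L y"
      using tendsto_add[OF L[OF xy(1)] L[OF xy(2)]] xy by (simp add: bdd_op_add[OF Yb])
    then show "(\<lambda>x\<in>X. L x) (x + y) = (\<lambda>x\<in>X. L x) x + (\<lambda>x\<in>X. L x) y"
      using L[of "x + y"] xy csubspace_add[OF bicomm_sub] by (auto intro: LIMSEQ_unique)
  next
    fix a x assume x: "x \<in> X"
    have "(\<lambda>n. ?Y n (a *\<^sub>C x)) \<longlonglongrightarrow> a *\<^sub>C L x"
      using scaleC.tendsto[OF tendsto_const L[OF x]] x by (simp add: bdd_op_scaleC[OF Yb])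
    then show "(\<lambda>x\<in>X. L x) (a *\<^sub>C x) = a *\<^sub>C (\<lambda>x\<in>X. L x) x"
      using L[of "a *\<^sub>C x"] x csubspace_scaleC[OF bicomm_sub] by (auto intro: LIMSEQ_unique)
  qed (use LX Ln in auto)
  have bi: "bicomm X B 1 (\<lambda>x\<in>X. L x)"
    unfolding bicomm_def
  proof (intro conjI ballI impI Lb)
    fix x y assume xy: "x \<in> X" "y \<in> X"
    have "(\<lambda>n. cinner (?Y n x) y) \<longlonglongrightarrow> cinner (L x) y" "(\<lambda>n. cinner x (?Y n y)) \<longlonglongrightarrow> cinner x (L y)"
      by (intro cinner.tendsto tendsto_const L xy)+
    moreover have "cinner (?Y n x) y = cinner x (?Y n y)" for n
      using sqrt_iter_bicomm xy unfolding bicomm_def by blast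
    ultimately show "cinner ((\<lambda>x\<in>X. L x) x) y = cinner x ((\<lambda>x\<in>X. L x) y)"
      using xy LIMSEQ_unique by auto
  next
    fix S x assume S: "S \<in> bdd_op X X" "\<forall>x\<in>X. S (B x) = B (S x)" and x: "x \<in> X"
    have "(\<lambda>n. S (?Y n x)) \<longlonglongrightarrow> S (L x)"
      by (intro bdd_op_tendsto[OF S(1) bicomm_sub] L LX sqrt_iter_mem x)
    moreover have "(\<lambda>n. ?Y n (S x)) \<longlonglongrightarrow> L (S x)" by (intro L bdd_op_mem[OF S(1)] x)
    moreover have "S (?Y n x) = ?Y n (S x)" for n
      using sqrt_iter_bicomm[of n] S x unfolding bicomm_def by blast
    ultimately show "S ((\<lambda>x\<in>X. L x) x) = (\<lambda>x\<in>X. L x) (S x)"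
      using x bdd_op_mem[OF S(1)] LIMSEQ_unique by auto
  qed (use Ln in auto)
  have "L x = (1/2) *\<^sub>R (B x + L (L x))" if x: "x \<in> X" for x
  proof -
    have "(\<lambda>n. norm (?Y n x - L x)) \<longlonglongrightarrow> norm (L x - L x)" by (intro tendsto_intros L x)
    then have lim: "(\<lambda>n. norm (?Y n x - L x)) \<longlonglongrightarrow> 0" by simp
    \<comment> \<open>Only pointwise convergence is known; the common bound 1 of the iterates lets
      the inner argument \<open>?Y n x\<close> be replaced by \<open>L x\<close>.\<close>
    have le: "norm (?Y n (?Y n x) - ?Y n (L x)) \<le> norm (?Y n x - L x)" for n
      using Yn[of "?Y n x - L x" n] x LX sqrt_iter_mem csubspace_diff[OF bicomm_sub]
      by (simp add: bdd_op_diff[OF Yb bicomm_sub])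
    have "(\<lambda>n. ?Y n (?Y n x) - ?Y n (L x)) \<longlonglongrightarrow> 0"
      by (rule Lim_null_comparison[OF always_eventually[OF allI[OF le]] lim])
    then have "(\<lambda>n. ?Y n (?Y n x) - ?Y n (L x) + ?Y n (L x)) \<longlonglongrightarrow> 0 + L (L x)"
      by (intro tendsto_add L LX x)
    then have "(\<lambda>n. (1/2) *\<^sub>R (B x + ?Y n (?Y n x))) \<longlonglongrightarrow> (1/2) *\<^sub>R (B x + L (L x))"
      by (intro tendsto_intros) simp
    then have "(\<lambda>n. ?Y (Suc n) x) \<longlonglongrightarrow> (1/2) *\<^sub>R (B x + L (L x))" using x by simp
    moreover have "(\<lambda>n. ?Y (Suc n) x) \<longlonglongrightarrow> L x" using L[OF x] by (rule LIMSEQ_Suc)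
    ultimately show ?thesis using LIMSEQ_unique by blast
  qed
  then show ?thesis using bi LX by (intro exI[of _ "\<lambda>x\<in>X. L x"]) auto
qed

text \<open>By the fixed point equation Q = I - Y has square I - 2Y + Y^2 = I - B, and it is
  non-negative because \<open>Y\<close> is a symmetric contraction. A competing root
  \<open>S\<close> commutes with S^2 = I - B, hence with \<open>B\<close>, hence with
  \<open>Y\<close> and \<open>Q\<close>.\<close>

lemma op_sqrt_props:
  defines "R \<equiv> op_sqrt X (\<lambda>x\<in>X. x - B x)"
  shows "nonneg_op X R" "x \<in> X \<Longrightarrow> R (R x) = x - B x"
proof -
  obtain Y where Y: "bicomm X B 1 Y" and eq: "\<And>x. x \<in> X \<Longrightarrow> Y x = (1/2) *\<^sub>R (B x + Y (Y x))"
    using sqrt_limit_exists by blast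
  have Yb: "Y \<in> bdd_op X X" using Y by (simp add: bicomm_def)
  define Q where "Q = (\<lambda>x\<in>X. (\<lambda>x\<in>X. x) x - Y x)"
  have Qb: "Q \<in> bdd_op X X" unfolding Q_def by (intro bdd_op_minus bdd_op_id bicomm_sub Yb order_refl)
  have Qx: "Q x = x - Y x" if "x \<in> X" for x using that by (simp add: Q_def)
  have QQ: "Q (Q x) = x - B x" if x: "x \<in> X" for x
  proof -
    have "Y x = (1/2) *\<^sub>R (B x + Y (Y x))" by (rule eq[OF x])
    then have "Y x + Y x = B x + Y (Y x)" by (metis scaleR_half_double scaleR_right_distrib)
    then show ?thesis
      using x bdd_op_mem[OF Yb x] csubspace_diff[OF bicomm_sub] by (simp add: Qx bdd_op_diff[OF Yb bicomm_sub] algebra_simps)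
  qed
  have Qnn: "nonneg_op X Q"
    unfolding nonneg_op_def
  proof (intro conjI ballI Qb)
    fix x assume x: "x \<in> X"
    have "cinner (Y x) x = cnj (cinner (Y x) x)"
      using Y x unfolding bicomm_def by (metis cinner_commute)
    then have "Im (cinner (Y x) x) = 0" by (metis Reals_cnj_iff complex_is_Real_iff)
    moreover have "Re (cinner (Y x) x) \<le> norm x * norm x"
    proof -
      have "Re (cinner (Y x) x) \<le> norm (Y x) * norm x" using complex_Re_le_cmod cmod_cinner_le order_trans by blast
      also have "\<dots> \<le> (1 * norm x) * norm x" using Y x by (intro mult_right_mono) (auto simp: bicomm_def)
      finally show ?thesis by simp
    qed
    ultimately show "cinner (Q x) x \<in> \<real>\<^sub>\<ge>\<^sub>0"
      by (simp add: Qx x cinner.diff_left cinner_self complex_nonneg_Reals_iff power2_eq_square)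
  qed
  have uniq: "S = Q" if S: "nonneg_op X S" and SS: "compose X S S = (\<lambda>x\<in>X. x - B x)" for S
  proof -
    have Sb: "S \<in> bdd_op X X" using S by (simp add: nonneg_op_def)
    have SS': "S (S x) = x - B x" if "x \<in> X" for x
      using fun_cong[OF SS, of x] that by (simp add: compose_def)
    have "S (B x) = B (S x)" if x: "x \<in> X" for x
    proof -
      have "S (x - B x) = S x - B (S x)"
        using SS'[OF x] SS'[OF bdd_op_mem[OF Sb x]] by metis
      then show ?thesis using x bdd_op_mem[OF B x] by (simp add: bdd_op_diff[OF Sb bicomm_sub])
    qed
    then have SY: "S (Y x) = Y (S x)" if "x \<in> X" for x using that Y Sb unfolding bicomm_def by blast
    have SQ: "S (Q x) = Q (S x)" if "x \<in> X" for x
      using that SY bdd_op_mem[OF Sb that] bdd_op_mem[OF Yb that]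
      by (simp add: Qx bdd_op_diff[OF Sb bicomm_sub])
    have "S x = Q x" if x: "x \<in> X" for x
    proof -
      define y where "y = S x - Q x"
      have m: "S x \<in> X" "Q x \<in> X" using x Sb Qb by (auto simp: bdd_op_mem)
      then have y: "y \<in> X" unfolding y_def by (intro csubspace_diff[OF bicomm_sub])
      \<comment> \<open>For commuting roots (S + Q)(S - Q) = S^2 - Q^2 = 0. Both quadratic forms are
        non-negative with sum 0 at \<open>y\<close>, so each vanishes there.\<close>
      have "S y + Q y = 0"
        using m x SQ[OF x] SS'[OF x] QQ[OF x] by (simp add: y_def bdd_op_diff[OF Sb bicomm_sub] bdd_op_diff[OF Qb bicomm_sub])
      then have "Re (cinner (S y) y) + Re (cinner (Q y) y) = 0"
        by (metis cinner.add_left cinner.zero_left plus_complex.simps(1) zero_complex.simps(1))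
      moreover have "Re (cinner (S y) y) \<ge> 0" "Re (cinner (Q y) y) \<ge> 0"
        using S Qnn y by (auto simp: nonneg_op_def complex_nonneg_Reals_iff)
      ultimately have "S y = 0" "Q y = 0"
        using nonneg_op_eq_0[OF S bicomm_sub y] nonneg_op_eq_0[OF Qnn bicomm_sub y] by linarith+
      then have "cinner y y = 0"
        using nonneg_op_sym[OF S bicomm_sub x y] nonneg_op_sym[OF Qnn bicomm_sub x y]
        by (subst (1) y_def) (simp add: cinner.diff_left cinner.zero_right)
      then show ?thesis by (simp add: cinner_self y_def)
    qed
    then show ?thesis using bdd_op_eqI[OF Sb Qb] by blast
  qed
  have "R = Q"
    unfolding R_def op_sqrt_def
  proof (rule the_equality)
    show "nonneg_op X Q \<and> compose X Q Q = (\<lambda>x\<in>X. x - B x)"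
      using Qnn QQ by (auto simp: compose_def)
  qed (use uniq in blast)
  then show "nonneg_op X R" "x \<in> X \<Longrightarrow> R (R x) = x - B x" using Qnn QQ by auto
qed

end

section \<open>Upper triangular matrices\<close>

lemma UM_bdd: "M \<in> UM U Y \<Longrightarrow> M j k \<in> bdd_op (U k) (Y j)"
  by (auto simp: UM_def opmats_def)

lemma UM_low: "M \<in> UM U Y \<Longrightarrow> k < j \<Longrightarrow> u \<in> U k \<Longrightarrow> M j k u = 0"
  by (auto simp: UM_def)

lemma UM_mem: "M \<in> UM U Y \<Longrightarrow> u \<in> U k \<Longrightarrow> M j k u \<in> Y j"
  using UM_bdd bdd_op_mem by blast

lemma UMI:
  "(\<And>j k. M j k \<in> bdd_op (U k) (Y j)) \<Longrightarrow> (\<And>j k u. k < j \<Longrightarrow> u \<in> U k \<Longrightarrow> M j k u = 0) \<Longrightarrow> M \<in> UM U Y"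
  by (auto simp: UM_def opmats_def)

lemma UM_eqI:
  assumes A: "A \<in> UM U Y" and B: "B \<in> UM U Y'" and eq: "\<And>j k u. j \<le> k \<Longrightarrow> u \<in> U k \<Longrightarrow> A j k u = B j k u"
  shows "A = B"
proof (intro ext[of A B] ext[of "A _" "B _"])
  fix j k
  show "A j k = B j k"
  proof (rule bdd_op_eqI[OF UM_bdd[OF A] UM_bdd[OF B]])
    show "A j k u = B j k u" if "u \<in> U k" for u
      using eq[OF _ that] UM_low[OF A _ that] UM_low[OF B _ that] by (cases "j \<le> k") auto
  qed
qed

section \<open>Families of subspaces and the action of matrices on truncated vectors\<close>

definition csubspaces :: "(int \<Rightarrow> 'a::complex_inner set) \<Rightarrow> bool"
  where "csubspaces U \<longleftrightarrow> (\<forall>k. csubspace (U k))"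

definition closed_csubspaces :: "(int \<Rightarrow> 'a::complex_inner set) \<Rightarrow> bool"
  where "closed_csubspaces U \<longleftrightarrow> (\<forall>k. closed_csubspace (U k))"

lemma csubspacesD: "csubspaces U \<Longrightarrow> csubspace (U k)"
  by (simp add: csubspaces_def)

lemma closed_csubspacesD: "closed_csubspaces U \<Longrightarrow> closed_csubspace (U k)"
  by (simp add: closed_csubspaces_def)

lemma closed_csubspaces_sub: "closed_csubspaces U \<Longrightarrow> csubspaces U"
  by (simp add: closed_csubspaces_def csubspaces_def closed_csubspace_def)

text \<open>The action of an upper triangular matrix on the vector \<open>u\<close> cut off above
  \<open>b\<close>. Row \<open>j\<close> reads only \<open>u\<close> on \<open>{j..b}\<close>, so
  the sum is finite whatever \<open>u\<close> does outside.\<close>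

definition mat_act :: "('u, 'y::comm_monoid_add) opmat \<Rightarrow> int \<Rightarrow> (int \<Rightarrow> 'u) \<Rightarrow> int \<Rightarrow> 'y"
  where "mat_act M b u j = (\<Sum>k\<in>{j..b}. M j k (u k))"

lemma mat_mul_eq_act: "u \<in> U k \<Longrightarrow> mat_mul U A B j k u = mat_act A k (\<lambda>i. B i k u) j"
  by (simp add: mat_mul_def mat_act_def)

lemma mat_act_cong: "(\<And>k. k \<in> {j..b} \<Longrightarrow> u k = v k) \<Longrightarrow> mat_act M b u j = mat_act M b v j"
  by (simp add: mat_act_def)

definition unipotent :: "(int \<Rightarrow> 'u set) \<Rightarrow> ('u, 'u) opmat \<Rightarrow> bool"
  where "unipotent U M \<longleftrightarrow> (\<forall>k. \<forall>u\<in>U k. M k k u = u)"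

lemma unipotentD: "unipotent U M \<Longrightarrow> u \<in> U k \<Longrightarrow> M k k u = u"
  by (simp add: unipotent_def)

context
  fixes U :: "int \<Rightarrow> 'u::complex_inner set"
  assumes U: "csubspaces U"
begin

lemma mat_act_mem:
  assumes "M \<in> UM U Y" "csubspaces Y" "\<And>k. u k \<in> U k"
  shows "mat_act M b u j \<in> Y j"
  unfolding mat_act_def using assms UM_mem csubspacesD by (intro csubspace_sum) blast+

text \<open>Makes the lower summation bound independent of the row, so that sums over a window can
  be interchanged.\<close>

lemma mat_act_wider:
  assumes M: "M \<in> UM U Y" and u: "\<And>k. u k \<in> U k" and "a \<le> j"
  shows "mat_act M b u j = (\<Sum>k\<in>{a..b}. M j k (u k))"
  unfolding mat_act_def
  by (rule sum.mono_neutral_left) (use assms in \<open>auto intro!: UM_low[OF M]\<close>)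

lemma mat_act_extend:
  assumes M: "M \<in> UM U Y" and u: "\<And>k. u k \<in> U k" "\<And>k. b < k \<Longrightarrow> u k = 0" and "b \<le> b'"
  shows "mat_act M b u j = mat_act M b' u j"
  unfolding mat_act_def
  by (rule sum.mono_neutral_left) (use assms in \<open>auto intro!: bdd_op_0[OF UM_bdd[OF M] csubspacesD[OF U]]\<close>)

lemma mat_act_single:
  assumes M: "M \<in> UM U Y" and u: "u \<in> U k" and "k \<le> b"
  shows "mat_act M b (\<lambda>i. if i = k then u else 0) j = M j k u"
proof -
  have "mat_act M b (\<lambda>i. if i = k then u else 0) j = (\<Sum>i\<in>{min j k..b}. M j i (if i = k then u else 0))"
    using u csubspace_0[OF csubspacesD[OF U]] by (intro mat_act_wider[OF M]) auto
  also have "\<dots> = (\<Sum>i\<in>{min j k..b}. if i = k then M j k u else 0)"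
    by (intro sum.cong) (auto simp: bdd_op_0[OF UM_bdd[OF M] csubspacesD[OF U]])
  also have "\<dots> = M j k u" using \<open>k \<le> b\<close> by simp
  finally show ?thesis .
qed

lemma mat_act_diff_arg:
  assumes M: "M \<in> UM U Y" and u: "\<And>k. u k \<in> U k" "\<And>k. v k \<in> U k"
  shows "mat_act M b (\<lambda>k. u k - v k) j = mat_act M b u j - mat_act M b v j"
  using u by (simp add: mat_act_def bdd_op_diff[OF UM_bdd[OF M] csubspacesD[OF U]] sum_subtractf)

lemma mat_act_add_arg:
  assumes M: "M \<in> UM U Y" and u: "\<And>k. u k \<in> U k" "\<And>k. v k \<in> U k"
  shows "mat_act M b (\<lambda>k. u k + v k) j = mat_act M b u j + mat_act M b v j"
  using u by (simp add: mat_act_def bdd_op_add[OF UM_bdd[OF M]] sum.distrib)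

lemma mat_act_scaleC_arg:
  assumes M: "M \<in> UM U Y" and u: "\<And>k. u k \<in> U k"
  shows "mat_act M b (\<lambda>k. a *\<^sub>C u k) j = a *\<^sub>C mat_act M b u j"
  using u by (simp add: mat_act_def bdd_op_scaleC[OF UM_bdd[OF M]] scaleC.sum_right)

lemma mat_act_sub:
  fixes A B :: "('u, 'y::ab_group_add) opmat"
  shows "(\<And>k. u k \<in> U k) \<Longrightarrow> mat_act (mat_sub U A B) b u j = mat_act A b u j - mat_act B b u (j::int)"
  by (simp add: mat_act_def mat_sub_def sum_subtractf)

lemma mat_act_id: "(\<And>k. u k \<in> U k) \<Longrightarrow> mat_act (mat_id U) b u j = (if j \<le> b then u j else 0)"
proof -
  assume u: "\<And>k. u k \<in> U k"
  have "mat_act (mat_id U) b u j = (\<Sum>k\<in>{j..b}. if k = j then u j else 0)"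
    unfolding mat_act_def mat_id_def diag_mat_def by (intro sum.cong) (use u in auto)
  then show ?thesis by simp
qed

lemma mat_mul_apply: "u \<in> U k \<Longrightarrow> mat_mul U A B j k u = (\<Sum>i\<in>{j..k}. A j i (B i k u))"
  by (simp add: mat_mul_def)

lemma mat_mul_UM:
  assumes A: "A \<in> UM V Y" and B: "B \<in> UM U V" and Y: "csubspaces Y"
  shows "mat_mul U A B \<in> UM U Y"
proof (rule UMI)
  fix j k
  have "(\<lambda>u\<in>U k. \<Sum>i\<in>{j..k}. (\<lambda>u\<in>U k. A j i (B i k u)) u) \<in> bdd_op (U k) (Y j)"
    by (intro bdd_op_setsum bdd_op_compose[OF UM_bdd[OF B] UM_bdd[OF A]] csubspacesD U Y)
  then show "mat_mul U A B j k \<in> bdd_op (U k) (Y j)"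
    by (simp add: mat_mul_def cong: restrict_cong)
qed (simp add: mat_mul_def)

lemma mat_add_UM:
  assumes A: "A \<in> UM U Y" and B: "B \<in> UM U Y" and Y: "csubspaces Y"
  shows "mat_add U A B \<in> UM U Y"
  by (rule UMI)
     (auto simp: mat_add_def UM_low[OF A] UM_low[OF B] simp del: restrict_apply
       intro!: bdd_op_plus UM_bdd[OF A] UM_bdd[OF B] csubspacesD U Y, simp add: UM_low[OF A] UM_low[OF B])

lemma mat_sub_UM:
  assumes A: "A \<in> UM U Y" and B: "B \<in> UM U Y" and Y: "csubspaces Y"
  shows "mat_sub U A B \<in> UM U Y"
  by (rule UMI)
     (auto simp: mat_sub_def UM_low[OF A] UM_low[OF B] simp del: restrict_apply
       intro!: bdd_op_minus UM_bdd[OF A] UM_bdd[OF B] csubspacesD U Y, simp add: UM_low[OF A] UM_low[OF B])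

lemma diag_mat_UM:
  assumes d: "\<And>k. (\<lambda>u\<in>U k. d k u) \<in> bdd_op (U k) (Y k)" and Y: "csubspaces Y"
  shows "diag_mat U d \<in> UM U Y"
  by (rule UMI) (use bdd_op_zero[OF csubspacesD[OF Y] csubspacesD[OF U]] d in \<open>auto simp: diag_mat_def simp del: restrict_apply\<close>, simp)

lemma mat_id_UM: "mat_id U \<in> UM U U"
  unfolding mat_id_def by (intro diag_mat_UM bdd_op_id csubspacesD U order_refl)

lemma mat_id_apply: "u \<in> U k \<Longrightarrow> mat_id U j k u = (if j = k then u else 0)"
  by (simp add: mat_id_def diag_mat_def)

end

text \<open>Both index ranges are enlarged to the square \<open>{j..b}\<close>, where the additional
  entries vanish by triangularity; then the sums can be swapped. Associativity and the use of
  inverses on windows rest on this.\<close>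

lemma mat_act_mul:
  assumes A: "A \<in> UM V Y" and B: "B \<in> UM U V" and U: "csubspaces U" and V: "csubspaces V"
    and u: "\<And>k. u k \<in> U k"
  shows "mat_act (mat_mul U A B) b u j = mat_act A b (mat_act B b u) j"
proof -
  have "mat_act (mat_mul U A B) b u j = (\<Sum>k\<in>{j..b}. \<Sum>i\<in>{j..b}. A j i (B i k (u k)))"
    unfolding mat_act_def mat_mul_apply[OF U u]
    by (intro sum.cong sum.mono_neutral_left)
       (auto simp: UM_low[OF B _ u] bdd_op_0[OF UM_bdd[OF A] csubspacesD[OF V]])
  also have "\<dots> = (\<Sum>i\<in>{j..b}. \<Sum>k\<in>{j..b}. A j i (B i k (u k)))"
    by (rule sum.swap)
  also have "\<dots> = (\<Sum>i\<in>{j..b}. A j i (\<Sum>k\<in>{j..b}. B i k (u k)))"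
    by (simp add: bdd_op_sum[OF UM_bdd[OF A] csubspacesD[OF V]] UM_mem[OF B u])
  also have "\<dots> = mat_act A b (mat_act B b u) j"
    unfolding mat_act_def[of A]
    by (intro sum.cong refl) (simp add: mat_act_wider[OF U B u, of j])
  finally show ?thesis .
qed

lemma mat_mul_assoc:
  assumes A: "A \<in> UM V Y" and B: "B \<in> UM W V" and C: "C \<in> UM U W"
    and W: "csubspaces W" and V: "csubspaces V"
  shows "mat_mul U (mat_mul W A B) C = mat_mul U A (mat_mul U B C)"
proof (intro ext[of "mat_mul U (mat_mul W A B) C"] ext[of "mat_mul U (mat_mul W A B) C _"] ext)
  fix j k u
  show "mat_mul U (mat_mul W A B) C j k u = mat_mul U A (mat_mul U B C) j k u"
  proof (cases "u \<in> U k")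
    case True
    then show ?thesis
      by (simp add: mat_mul_eq_act mat_act_mul[OF A B W V] UM_mem[OF C])
  qed (simp add: mat_mul_def)
qed

lemma mat_mul_id_right:
  assumes A: "A \<in> UM U Y" and U: "csubspaces U" and Y: "csubspaces Y"
  shows "mat_mul U A (mat_id U) = A"
proof (rule UM_eqI[OF mat_mul_UM[OF U A mat_id_UM[OF U] Y] A])
  fix j k u assume "j \<le> k" "u \<in> U k"
  then show "mat_mul U A (mat_id U) j k u = A j k u"
    using mat_act_single[OF U A, of u k k j] by (simp add: mat_mul_eq_act mat_id_apply[OF U])
qed

lemma mat_mul_id_left:
  assumes A: "A \<in> UM U Y" and U: "csubspaces U" and Y: "csubspaces Y"
  shows "mat_mul U (mat_id Y) A = A"
proof (rule UM_eqI[OF mat_mul_UM[OF U mat_id_UM[OF Y] A Y] A])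
  fix j k u assume "j \<le> k" "u \<in> U k"
  then show "mat_mul U (mat_id Y) A j k u = A j k u"
    by (simp add: mat_mul_eq_act mat_act_id[OF Y] UM_mem[OF A])
qed

section \<open>Inverses of unipotent upper triangular matrices\<close>

context
  fixes U :: "int \<Rightarrow> 'u::complex_inner set"
  assumes U: "csubspaces U"
begin

text \<open>The partial Neumann sums \<open>I + S + \<dots> + S\<^sup>n\<close> with \<open>S = I - M\<close> strictly upper triangular:
  the \<open>(j, k)\<close> entry is stationary from \<open>n = k - j\<close> on.\<close>

fun neumann :: "('u, 'u) opmat \<Rightarrow> nat \<Rightarrow> ('u, 'u) opmat"
  where "neumann M 0 = mat_id U"
  | "neumann M (Suc n) = mat_add U (mat_id U) (mat_mul U (mat_sub U (mat_id U) M) (neumann M n))"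

lemma neumann_UM: "M \<in> UM U U \<Longrightarrow> neumann M n \<in> UM U U"
  by (induction n) (auto intro!: mat_id_UM[OF U] mat_add_UM[OF U] mat_sub_UM[OF U] mat_mul_UM[OF U] U)

lemma neumann_Suc:
  "u \<in> U k \<Longrightarrow> neumann M (Suc n) j k u =
     mat_id U j k u + (\<Sum>i\<in>{j..k}. mat_sub U (mat_id U) M j i (neumann M n i k u))"
  by (simp add: mat_add_def mat_mul_def)

text \<open>For \<open>i = j\<close> the strictly upper triangular I - M contributes nothing; for
  \<open>i > j\<close> the entry \<open>(i, k)\<close> is stationary one step earlier.\<close>

lemma neumann_stationary:
  assumes M: "M \<in> UM U U" and uni: "unipotent U M"
  shows "u \<in> U k \<Longrightarrow> k \<le> j + int n \<Longrightarrow> neumann M (Suc n) j k u = neumann M n j k u"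
proof (induction n arbitrary: j)
  case 0
  have "(\<Sum>i\<in>{j..k}. mat_sub U (mat_id U) M j i (neumann M 0 i k u)) = 0"
  proof (rule sum.neutral, rule ballI)
    fix i assume "i \<in> {j..k}"
    then have "i = j" using 0 by simp
    then show "mat_sub U (mat_id U) M j i (neumann M 0 i k u) = 0"
      using UM_mem[OF mat_id_UM[OF U] \<open>u \<in> U k\<close>] by (simp add: mat_sub_def mat_id_apply[OF U] unipotentD[OF uni])
  qed
  then show ?case by (simp only: neumann_Suc[OF 0(1)]) simp
next
  case (Suc n)
  have "mat_sub U (mat_id U) M j i (neumann M (Suc n) i k u) = mat_sub U (mat_id U) M j i (neumann M n i k u)"
    if "i \<in> {j..k}" for i
  proof (cases "i = j")
    case True
    then show ?thesis
      using UM_mem[OF neumann_UM[OF M] \<open>u \<in> U k\<close>]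
      by (simp add: mat_sub_def mat_id_apply[OF U] unipotentD[OF uni] del: neumann.simps)
  next
    case False
    then have "k \<le> i + int n" using that Suc.prems(2) by auto
    then show ?thesis using Suc.IH[of i] Suc.prems by presburger
  qed
  then show ?case
    by (simp only: neumann_Suc[OF Suc.prems(1)] cong: sum.cong)
qed

lemma unipotent_right_inverse:
  assumes M: "M \<in> UM U U" and uni: "unipotent U M"
  shows "\<exists>G\<in>UM U U. unipotent U G \<and> mat_mul U M G = mat_id U"
proof -
  \<comment> \<open>Each entry is taken at a stage from which it is stationary; for
    \<open>k < j\<close> the default \<open>nat (k - j) = 0\<close> picks a zero entry of the
    identity.\<close>
  define G where "G j k = neumann M (nat (k - j)) j k" for j k
  have G: "G \<in> UM U U"
    unfolding G_def by (rule UMI) (use neumann_UM[OF M] UM_bdd UM_low in blast)+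
  have stat: "neumann M n j k u = G j k u" if "u \<in> U k" "k \<le> j + int n" for j k u n
  proof -
    have "nat (k - j) \<le> n" using that by simp
    then show ?thesis
    proof (induction n rule: dec_induct)
      case (step n)
      then show ?case using neumann_stationary[OF M uni that(1), of j n] by simp
    qed (simp add: G_def)
  qed
  have "mat_mul U M G = mat_id U"
  proof (rule UM_eqI[OF mat_mul_UM[OF U M G U] mat_id_UM[OF U]])
    fix j k u assume jk: "j \<le> k" and u: "u \<in> U k"
    let ?n = "nat (k - j)"
    \<comment> \<open>One step beyond stationarity the recursion reads G = I + (I - M) G, which is M
      G = I.\<close>
    have "G j k u = neumann M (Suc ?n) j k u" using stat[OF u, of j "Suc ?n"] jk by simp
    also have "\<dots> = mat_id U j k u + (\<Sum>i\<in>{j..k}. mat_sub U (mat_id U) M j i (G i k u))"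
      using stat[OF u] jk by (simp only: neumann_Suc[OF u]) simp
    also have "(\<Sum>i\<in>{j..k}. mat_sub U (mat_id U) M j i (G i k u)) = mat_act (mat_sub U (mat_id U) M) k (\<lambda>i. G i k u) j"
      by (simp add: mat_act_def)
    also have "\<dots> = G j k u - mat_act M k (\<lambda>i. G i k u) j"
      using jk UM_mem[OF G u] by (simp add: mat_act_sub[OF U] mat_act_id[OF U])
    finally show "mat_mul U M G j k u = mat_id U j k u"
      using u by (simp add: mat_mul_eq_act)
  qed
  moreover have "unipotent U G" unfolding unipotent_def G_def by (simp add: mat_id_apply[OF U])
  ultimately show ?thesis using G by blast
qed

lemma unipotent_inverse:
  assumes M: "M \<in> UM U U" and uni: "unipotent U M"
  shows "\<exists>G\<in>UM U U. unipotent U G \<and> mat_mul U M G = mat_id U \<and> mat_mul U G M = mat_id U"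
proof -
  obtain G where G: "G \<in> UM U U" "unipotent U G" "mat_mul U M G = mat_id U"
    using unipotent_right_inverse[OF assms] by blast
  \<comment> \<open>\<open>G\<close> is unipotent as well, so it has a right inverse, and
    associativity identifies this with \<open>M\<close>.\<close>
  obtain M' where M': "M' \<in> UM U U" "mat_mul U G M' = mat_id U"
    using unipotent_right_inverse[OF G(1,2)] by blast
  have "M' = mat_mul U (mat_mul U M G) M'" by (simp add: G mat_mul_id_left[OF M'(1) U U])
  also have "\<dots> = M" by (simp add: mat_mul_assoc[OF M G(1) M'(1) U U] M' mat_mul_id_right[OF M U U])
  finally show ?thesis using G M' by blast
qed

lemma mat_inv_eqI:
  assumes M: "M \<in> UM U U" and G: "G \<in> UM U U" "mat_mul U M G = mat_id U" "mat_mul U G M = mat_id U"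
  shows "mat_inv U M = G"
  unfolding mat_inv_def
proof (rule the_equality)
  fix G' assume G': "G' \<in> UM U U \<and> mat_mul U M G' = mat_id U \<and> mat_mul U G' M = mat_id U"
  have "G' = mat_mul U (mat_mul U G M) G'" using G' mat_mul_id_left[OF _ U U, of G'] by (simp add: G)
  also have "\<dots> = G" using G' mat_mul_assoc[OF G(1) M _ U U, of G'] by (simp add: mat_mul_id_right[OF G(1) U U])
  finally show "G' = G" .
qed (use G in auto)

lemma
  assumes "M \<in> UM U U" "unipotent U M"
  shows mat_inv_UM: "mat_inv U M \<in> UM U U" and mat_inv_unipotent: "unipotent U (mat_inv U M)"
    and mat_inv_right: "mat_mul U M (mat_inv U M) = mat_id U"
    and mat_inv_left: "mat_mul U (mat_inv U M) M = mat_id U"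
  using unipotent_inverse[OF assms] mat_inv_eqI[OF assms(1)] by metis+

lemma mat_inv_inv: "M \<in> UM U U \<Longrightarrow> unipotent U M \<Longrightarrow> mat_inv U (mat_inv U M) = M"
  by (intro mat_inv_eqI mat_inv_UM mat_inv_left mat_inv_right)

lemma mat_act_inv:
  assumes M: "M \<in> UM U U" "unipotent U M" and u: "\<And>k. u k \<in> U k" and "j \<le> b"
  shows "mat_act M b (mat_act (mat_inv U M) b u) j = u j"
    and "mat_act (mat_inv U M) b (mat_act M b u) j = u j"
  using mat_act_mul[OF M(1) mat_inv_UM[OF M] U U u, of b j] mat_act_mul[OF mat_inv_UM[OF M] M(1) U U u, of b j]
    \<open>j \<le> b\<close> by (simp_all add: mat_inv_left[OF M] mat_inv_right[OF M] mat_act_id[OF U u])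

end

section \<open>Bounded operators induced by matrices\<close>

lemma ell2_nth_simps [simp]:
  "ell2_nth (u + v) k = ell2_nth u k + ell2_nth v k" "ell2_nth (u - v) k = ell2_nth u k - ell2_nth v k"
  "ell2_nth 0 k = 0" "ell2_nth (a *\<^sub>C u) k = a *\<^sub>C ell2_nth u k"
  "ell2_nth (r *\<^sub>R u) k = r *\<^sub>R ell2_nth u k"
  by (simp_all add: plus_ell2.rep_eq minus_ell2.rep_eq zero_ell2.rep_eq scaleC_ell2.rep_eq scaleR_ell2.rep_eq)

lemma ell2_nth_sum: "ell2_nth (sum f I) k = (\<Sum>i\<in>I. ell2_nth (f i) k)"
  by (induction I rule: infinite_finite_induct) auto

lemma ell2_eqI: "(\<And>k. ell2_nth u k = ell2_nth v k) \<Longrightarrow> u = v"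
  by (simp add: ell2_nth_inject[symmetric] fun_eq_iff)

lemma bounded_linear_ell2_nth: "bounded_linear (\<lambda>u. ell2_nth u k)"
  by (rule bounded_linear_intro[of _ 1]) (auto simp: norm_ell2_nth_le)

lemmas tendsto_ell2_nth = bounded_linear.tendsto[OF bounded_linear_ell2_nth]

lemma csubspace_hsum: "csubspaces U \<Longrightarrow> csubspace (hsum U)"
  unfolding complex_vector.subspace_def[where S = "hsum U"]
  by (auto simp: hsum_def csubspacesD csubspace_0 csubspace_add csubspace_scaleC)

lemma ell2_nth_single [simp]: "ell2_nth (single k x) i = (if i = k then x else 0)"
proof -
  have "(\<lambda>i. (norm (if i = k then x else 0))\<^sup>2) summable_on {k}" by (rule summable_on_finite) simp
  then have "(\<lambda>i. (norm (if i = k then x else 0))\<^sup>2) summable_on UNIV"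
    by (rule summable_on_cong_neutral[THEN iffD1, rotated -1]) auto
  then show ?thesis by (simp add: single_def Abs_ell2_inverse)
qed

lemma single_mem: "x \<in> U k \<Longrightarrow> csubspaces U \<Longrightarrow> single k x \<in> hsum U"
  by (auto simp: hsum_def csubspacesD csubspace_0)

section \<open>Truncations and symmetric sections\<close>

definition ell2_trunc :: "int \<Rightarrow> int \<Rightarrow> (int \<Rightarrow> 'a::complex_inner) \<Rightarrow> 'a ell2"
  where "ell2_trunc a b u = (\<Sum>k\<in>{a..b}. single k (u k))"

lemma ell2_nth_trunc: "ell2_nth (ell2_trunc a b u) i = (if i \<in> {a..b} then u i else 0)"
  by (simp add: ell2_trunc_def ell2_nth_sum)

lemma ell2_trunc_mem: "(\<And>k. u k \<in> U k) \<Longrightarrow> csubspaces U \<Longrightarrow> ell2_trunc a b u \<in> hsum U"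
  by (auto simp: hsum_def csubspacesD csubspace_0 ell2_nth_trunc)

lemma norm_ell2_trunc: "(norm (ell2_trunc a b u))\<^sup>2 = (\<Sum>k\<in>{a..b}. (norm (u k))\<^sup>2)"
proof -
  have "(norm (ell2_trunc a b u))\<^sup>2 = (\<Sum>\<^sub>\<infinity>k\<in>{a..b}. (norm (u k))\<^sup>2)"
    unfolding norm_ell2_sq by (rule infsum_cong_neutral) (auto simp: ell2_nth_trunc)
  then show ?thesis by simp
qed

lemma sq_summable_of_sections:
  fixes f :: "int \<Rightarrow> real"
  assumes nn: "\<And>j. f j \<ge> 0" and bd: "\<And>m::nat. (\<Sum>j\<in>{- int m..int m}. f j) \<le> c"
  shows "f summable_on UNIV" "(\<Sum>\<^sub>\<infinity>j. f j) \<le> c"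
proof -
  have fin: "sum f A \<le> c" if "finite A" for A
  proof -
    \<comment> \<open>A crude bound for all absolute values in \<open>A\<close> that makes sense
      also for empty \<open>A\<close>.\<close>
    define m where "m = (\<Sum>x\<in>A. \<bar>x\<bar>)"
    have m: "\<bar>x\<bar> \<le> m" if "x \<in> A" for x
      unfolding m_def using \<open>finite A\<close> that by (intro member_le_sum) auto
    have "A \<subseteq> {- int (nat m)..int (nat m)}" using m by fastforce
    then have "sum f A \<le> (\<Sum>j\<in>{- int (nat m)..int (nat m)}. f j)"
      by (intro sum_mono2) (auto simp: nn)
    then show ?thesis using bd order_trans by blast
  qed
  show "f summable_on UNIV"
    using fin nn by (intro nonneg_bdd_above_summable_on) (auto intro!: bdd_aboveI[of _ c])
  then show "(\<Sum>\<^sub>\<infinity>j. f j) \<le> c" using fin by (intro infsum_le_finite_sums) auto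
qed

lemma sections_tendsto:
  fixes f :: "int \<Rightarrow> real"
  assumes "f summable_on UNIV"
  shows "(\<lambda>n::nat. \<Sum>j\<in>{- int n..int n}. f j) \<longlonglongrightarrow> (\<Sum>\<^sub>\<infinity>j. f j)"
proof -
  have "filterlim (\<lambda>n::nat. {- int n..int n}) (finite_subsets_at_top UNIV) sequentially"
    unfolding filterlim_finite_subsets_at_top
  proof (intro allI impI)
    fix A :: "int set" assume "finite A \<and> A \<subseteq> UNIV"
    define m where "m = (\<Sum>x\<in>A. \<bar>x\<bar>)"
    have m: "\<bar>x\<bar> \<le> m" if "x \<in> A" for x
      unfolding m_def using \<open>finite A \<and> A \<subseteq> UNIV\<close> that by (intro member_le_sum) auto
    have "\<forall>n\<ge>nat m. finite {- int n..int n} \<and> A \<subseteq> {- int n..int n} \<and> {- int n..int n} \<subseteq> UNIV"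
      using m by fastforce
    then show "\<forall>\<^sub>F n in sequentially. finite {- int n..int n} \<and> A \<subseteq> {- int n..int n} \<and> {- int n..int n} \<subseteq> UNIV"
      unfolding eventually_sequentially by blast
  qed
  moreover have "(sum f \<longlongrightarrow> (\<Sum>\<^sub>\<infinity>j. f j)) (finite_subsets_at_top UNIV)"
    using has_sum_infsum[OF assms] by (simp add: has_sum_def)
  ultimately show ?thesis by (rule filterlim_compose[rotated])
qed

text \<open>By Pythagoras the squared distance is the squared norm minus a section of its
  series.\<close>

lemma ell2_trunc_tendsto: "(\<lambda>n. ell2_trunc (- int n) (int n) (ell2_nth u)) \<longlonglongrightarrow> u"
proof -
  have eq: "(norm (ell2_trunc (- int n) (int n) (ell2_nth u) - u))\<^sup>2
     = (norm u)\<^sup>2 - (\<Sum>k\<in>{- int n..int n}. (norm (ell2_nth u k))\<^sup>2)" for n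
  proof -
    let ?v = "ell2_trunc (- int n) (int n) (ell2_nth u)"
    have "inner (ell2_nth ?v k) (ell2_nth (u - ?v) k) = 0" for k by (simp add: ell2_nth_trunc)
    then have "inner ?v (u - ?v) = 0" by (simp add: inner_ell2_def)
    then have "(norm u)\<^sup>2 = (norm ?v)\<^sup>2 + (norm (u - ?v))\<^sup>2"
      using norm_add_sq[of ?v "u - ?v"] by simp
    then show ?thesis by (simp add: norm_ell2_trunc norm_minus_commute)
  qed
  have "(\<lambda>n. sqrt ((norm u)\<^sup>2 - (\<Sum>k\<in>{- int n..int n}. (norm (ell2_nth u k))\<^sup>2))) \<longlonglongrightarrow> sqrt ((norm u)\<^sup>2 - (norm u)\<^sup>2)"
    unfolding norm_ell2_sq by (intro tendsto_intros sections_tendsto ell2_summable)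
  then have "(\<lambda>n. norm (ell2_trunc (- int n) (int n) (ell2_nth u) - u)) \<longlonglongrightarrow> 0"
    by (simp flip: eq)
  then show ?thesis by (simp add: LIM_zero_iff tendsto_norm_zero_iff)
qed

lemma tendsto_eq_of_finally:
  fixes f :: "nat \<Rightarrow> 'a::t2_space"
  assumes "f \<longlonglongrightarrow> l" "\<And>n. n \<ge> N \<Longrightarrow> f n = c"
  shows "l = c"
proof -
  have "f \<longlonglongrightarrow> c" using assms(2) by (intro tendsto_eventually) (auto simp: eventually_sequentially)
  then show ?thesis using assms(1) LIMSEQ_unique by blast
qed

context
  fixes U :: "int \<Rightarrow> 'u::chilbert set" and Y :: "int \<Rightarrow> 'y::chilbert set" and M :: "('u, 'y) opmat"
  assumes U: "closed_csubspaces U" and Y: "closed_csubspaces Y" and M: "M \<in> UM U Y"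
begin

lemma UM_dom_sub: "csubspaces U" and UM_cod_sub: "csubspaces Y"
  using U Y closed_csubspaces_sub by blast+

text \<open>The truncated vector has no components below \<open>a\<close>, while
  \<open>mat_act\<close> reads all of \<open>{j..b}\<close>; the two agree from row \<open>a\<close>
  on.\<close>

lemma induces_trunc:
  assumes T: "induces U Y M T" and u: "\<And>k. u k \<in> U k" and "a \<le> j"
  shows "ell2_nth (T (ell2_trunc a b u)) j = mat_act M b u j"
proof -
  have Tb: "T \<in> bdd_op (hsum U) (hsum Y)" using T by (simp add: induces_def)
  have "ell2_nth (T (ell2_trunc a b u)) j = (\<Sum>k\<in>{a..b}. M j k (u k))"
    unfolding ell2_trunc_def
    by (subst bdd_op_sum[OF Tb csubspace_hsum[OF UM_dom_sub]])
       (use T u in \<open>auto simp: ell2_nth_sum induces_def single_mem UM_dom_sub\<close>)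
  then show ?thesis using mat_act_wider[OF UM_dom_sub M u \<open>a \<le> j\<close>] by simp
qed

text \<open>Shows that the entries determine the operator, and transports estimates on windows to it
  by passage to the limit.\<close>

lemma induces_tendsto:
  assumes T: "induces U Y M T" and u: "u \<in> hsum U"
  shows "(\<lambda>n. mat_act M (int n) (ell2_nth u) j) \<longlonglongrightarrow> ell2_nth (T u) j"
proof -
  have Tb: "T \<in> bdd_op (hsum U) (hsum Y)" using T by (simp add: induces_def)
  have uk: "ell2_nth u k \<in> U k" for k using u by (simp add: hsum_def)
  have "(\<lambda>n. ell2_nth (T (ell2_trunc (- int n) (int n) (ell2_nth u))) j) \<longlonglongrightarrow> ell2_nth (T u) j"
    by (intro tendsto_ell2_nth bdd_op_tendsto[OF Tb csubspace_hsum[OF UM_dom_sub]] ell2_trunc_tendsto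
         ell2_trunc_mem uk UM_dom_sub u)
  then show ?thesis
  proof (rule Lim_transform_eventually)
    have "\<forall>n\<ge>nat \<bar>j\<bar>. ell2_nth (T (ell2_trunc (- int n) (int n) (ell2_nth u))) j = mat_act M (int n) (ell2_nth u) j"
      using induces_trunc[OF T uk] by auto
    then show "\<forall>\<^sub>F n in sequentially. ell2_nth (T (ell2_trunc (- int n) (int n) (ell2_nth u))) j = mat_act M (int n) (ell2_nth u) j"
      unfolding eventually_sequentially by blast
  qed
qed

lemma induces_unique:
  assumes "induces U Y M T" "induces U Y M T'"
  shows "T = T'"
proof (rule bdd_op_eqI)
  show "T \<in> bdd_op (hsum U) (hsum Y)" "T' \<in> bdd_op (hsum U) (hsum Y)" using assms by (simp_all add: induces_def)
  show "T u = T' u" if "u \<in> hsum U" for u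
    by (rule ell2_eqI) (use assms that induces_tendsto LIMSEQ_unique in blast)
qed

lemma induced_op_eq: "induces U Y M T \<Longrightarrow> induced_op U Y M = T"
  unfolding induced_op_def using induces_unique by blast

text \<open>The image is built row by row as a limit of finite sums: the bound applied to tails of
  \<open>u\<close> makes each row Cauchy, and applied to \<open>u\<close> itself it makes the limits
  square summable.\<close>

lemma induces_of_window_bound:
  assumes c: "c \<ge> 0"
    and bd: "\<And>a b u. (\<And>k. u k \<in> U k) \<Longrightarrow>
      (\<Sum>j\<in>{a..b}. (norm (mat_act M b u j))\<^sup>2) \<le> c\<^sup>2 * (\<Sum>k\<in>{a..b}. (norm (u k))\<^sup>2)"
  shows "\<exists>T. induces U Y M T \<and> (\<forall>u\<in>hsum U. norm (T u) \<le> c * norm u)"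
proof -
  have "\<exists>l. (\<lambda>n. mat_act M (int n) (ell2_nth u) j) \<longlonglongrightarrow> l" if u: "u \<in> hsum U" for u j
  proof -
    have uk: "ell2_nth u k \<in> U k" for k using u by (simp add: hsum_def)
    define s where "s n = (\<Sum>k\<in>{j..int n}. (norm (ell2_nth u k))\<^sup>2)" for n :: nat
    have "incseq s" unfolding s_def by (intro incseq_SucI sum_mono2) auto
    moreover have "s n \<le> (norm u)\<^sup>2" for n unfolding s_def by (rule ell2_finite_le) simp
    ultimately have "convergent s" by (metis incseq_convergent convergentI)
    then have C: "Cauchy s" by (rule convergent_Cauchy)
    \<comment> \<open>The bound on the window \<open>{j..int n}\<close> is applied to the part of
      \<open>u\<close> above \<open>m\<close>, and of its rows only \<open>j\<close> is
      kept.\<close>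
    have diff: "(norm (mat_act M (int n) (ell2_nth u) j - mat_act M (int m) (ell2_nth u) j))\<^sup>2 \<le> c\<^sup>2 * (s n - s m)"
      if "m \<le> n" "j \<le> int m" for m n
    proof -
      define v where "v k = (if k \<le> int m then ell2_nth u k else 0)" for k
      have v: "v k \<in> U k" for k by (simp add: v_def uk csubspace_0[OF csubspacesD[OF UM_dom_sub]])
      have w: "ell2_nth u k - v k \<in> U k" for k using uk v csubspace_diff[OF csubspacesD[OF UM_dom_sub]] by blast
      have "mat_act M (int m) (ell2_nth u) j = mat_act M (int m) v j"
        by (rule mat_act_cong) (simp add: v_def)
      also have "\<dots> = mat_act M (int n) v j"
        by (rule mat_act_extend[OF UM_dom_sub M v]) (use that in \<open>auto simp: v_def\<close>)
      finally have eq: "mat_act M (int n) (ell2_nth u) j - mat_act M (int m) (ell2_nth u) j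
          = mat_act M (int n) (\<lambda>k. ell2_nth u k - v k) j"
        by (simp add: mat_act_diff_arg[OF UM_dom_sub M uk v])
      have "(norm (mat_act M (int n) (\<lambda>k. ell2_nth u k - v k) j))\<^sup>2
          \<le> (\<Sum>j\<in>{j..int n}. (norm (mat_act M (int n) (\<lambda>k. ell2_nth u k - v k) j))\<^sup>2)"
        using that by (intro member_le_sum) auto
      also have "\<dots> \<le> c\<^sup>2 * (\<Sum>k\<in>{j..int n}. (norm (ell2_nth u k - v k))\<^sup>2)" by (rule bd[OF w])
      also have "(\<Sum>k\<in>{j..int n}. (norm (ell2_nth u k - v k))\<^sup>2) = (\<Sum>k\<in>{j..int n} - {j..int m}. (norm (ell2_nth u k))\<^sup>2)"
        by (rule sum.mono_neutral_cong_right) (auto simp: v_def)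
      also have "\<dots> = s n - s m"
        unfolding s_def by (rule sum_diff) (use that in auto)
      finally show ?thesis by (simp add: eq)
    qed
    have "Cauchy (\<lambda>n. mat_act M (int n) (ell2_nth u) j)"
    proof (rule CauchyI')
      fix e :: real assume "e > 0"
      then have "0 < e\<^sup>2 / (c\<^sup>2 + 1)" by (simp add: add_nonneg_pos)
      then obtain N where N: "\<forall>m\<ge>N. \<forall>n\<ge>N. dist (s m) (s n) < e\<^sup>2 / (c\<^sup>2 + 1)"
        using metric_CauchyD[OF C] by blast
      have "dist (mat_act M (int m) (ell2_nth u) j) (mat_act M (int n) (ell2_nth u) j) < e"
        if "m \<ge> max N (nat \<bar>j\<bar>)" "n > m" for m n
      proof -
        have sm: "0 \<le> s n - s m" "s n - s m < e\<^sup>2 / (c\<^sup>2 + 1)"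
          using N[rule_format, of n m] that incseqD[OF \<open>incseq s\<close>, of m n] by (simp_all add: dist_real_def)
        have "(dist (mat_act M (int m) (ell2_nth u) j) (mat_act M (int n) (ell2_nth u) j))\<^sup>2 \<le> c\<^sup>2 * (s n - s m)"
          unfolding dist_norm by (subst norm_minus_commute) (use diff[of m n] that in auto)
        also have "\<dots> \<le> (c\<^sup>2 + 1) * (s n - s m)" using sm by (intro mult_right_mono) auto
        also have "\<dots> < e\<^sup>2" using sm(2) by (simp add: pos_less_divide_eq add_nonneg_pos mult.commute)
        finally show ?thesis using \<open>e > 0\<close> by (simp add: power_less_imp_less_base)
      qed
      then show "\<exists>N. \<forall>m\<ge>N. \<forall>n>m. dist (mat_act M (int m) (ell2_nth u) j) (mat_act M (int n) (ell2_nth u) j) < e"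
        by blast
    qed
    then show ?thesis by (auto simp: Cauchy_convergent_iff convergent_def)
  qed
  then obtain L where L: "\<And>u j. u \<in> hsum U \<Longrightarrow> (\<lambda>n. mat_act M (int n) (ell2_nth u) j) \<longlonglongrightarrow> L u j" by metis
  have sec: "(\<Sum>j\<in>{- int m..int m}. (norm (L u j))\<^sup>2) \<le> c\<^sup>2 * (norm u)\<^sup>2" if u: "u \<in> hsum U" for u m
  proof (rule LIMSEQ_le_const2)
    have uk: "ell2_nth u k \<in> U k" for k using u by (simp add: hsum_def)
    show "(\<lambda>n. \<Sum>j\<in>{- int m..int m}. (norm (mat_act M (int n) (ell2_nth u) j))\<^sup>2) \<longlonglongrightarrow> (\<Sum>j\<in>{- int m..int m}. (norm (L u j))\<^sup>2)"
      by (intro tendsto_intros L u)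
    have "(\<Sum>j\<in>{- int m..int m}. (norm (mat_act M (int n) (ell2_nth u) j))\<^sup>2) \<le> c\<^sup>2 * (norm u)\<^sup>2" if "n \<ge> m" for n
    proof -
      \<comment> \<open>In the window bound rows and columns end at the same index, so the rows are
        first extended up to \<open>int n\<close>.\<close>
      have "(\<Sum>j\<in>{- int m..int m}. (norm (mat_act M (int n) (ell2_nth u) j))\<^sup>2)
         \<le> (\<Sum>j\<in>{- int m..int n}. (norm (mat_act M (int n) (ell2_nth u) j))\<^sup>2)"
        using that by (intro sum_mono2) auto
      also have "\<dots> \<le> c\<^sup>2 * (\<Sum>k\<in>{- int m..int n}. (norm (ell2_nth u k))\<^sup>2)" by (rule bd[OF uk])
      also have "\<dots> \<le> c\<^sup>2 * (norm u)\<^sup>2" by (intro mult_left_mono ell2_finite_le) auto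
      finally show ?thesis .
    qed
    then show "\<exists>N. \<forall>n\<ge>N. (\<Sum>j\<in>{- int m..int m}. (norm (mat_act M (int n) (ell2_nth u) j))\<^sup>2) \<le> c\<^sup>2 * (norm u)\<^sup>2"
      by blast
  qed
  define T where "T = (\<lambda>u\<in>hsum U. Abs_ell2 (L u))"
  have summ: "(\<lambda>j. (norm (L u j))\<^sup>2) summable_on UNIV" if "u \<in> hsum U" for u
    by (rule sq_summable_of_sections(1)[OF _ sec[OF that]]) simp
  have Tn: "ell2_nth (T u) j = L u j" if "u \<in> hsum U" for u j
    using summ[OF that] that by (simp add: T_def Abs_ell2_inverse)
  have nT: "norm (T u) \<le> c * norm u" if "u \<in> hsum U" for u
  proof -
    have "(norm (T u))\<^sup>2 \<le> (c * norm u)\<^sup>2"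
      unfolding norm_ell2_sq Tn[OF that] power_mult_distrib
      using sq_summable_of_sections(2)[OF _ sec[OF that]] by (simp add: norm_ell2_sq)
    then show ?thesis by (rule power2_le_imp_le) (use c in simp)
  qed
  have hU: "csubspace (hsum U)" by (rule csubspace_hsum[OF UM_dom_sub])
  have hs: "ell2_nth u k \<in> U k" if "u \<in> hsum U" for u k using that by (simp add: hsum_def)
  have "T \<in> bdd_op (hsum U) (hsum Y)"
  proof (rule bdd_opI[where K = c])
    show "T \<in> extensional (hsum U)" by (simp add: T_def)
    show "T u \<in> hsum Y" if "u \<in> hsum U" for u
      unfolding hsum_def mem_Collect_eq Tn[OF that]
      by (intro allI closed_sequentially[OF closed_csubspaceD(2)[OF closed_csubspacesD[OF Y]] _ L[OF that]]
          mat_act_mem[OF UM_dom_sub M UM_cod_sub] hs[OF that])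
  next
    fix u v assume uv: "u \<in> hsum U" "v \<in> hsum U"
    show "T (u + v) = T u + T v"
    proof (rule ell2_eqI)
      fix j
      have "(\<lambda>n. mat_act M (int n) (ell2_nth (u + v)) j) \<longlonglongrightarrow> L u j + L v j"
        using tendsto_add[OF L[OF uv(1)] L[OF uv(2)], of j j]
        by (simp add: plus_ell2.rep_eq mat_act_add_arg[OF UM_dom_sub M hs[OF uv(1)] hs[OF uv(2)]] del: ell2_nth_simps)
      then show "ell2_nth (T (u + v)) j = ell2_nth (T u + T v) j"
        using LIMSEQ_unique[OF L[OF csubspace_add[OF hU uv]]] by (simp add: Tn uv csubspace_add[OF hU])
    qed
  next
    fix a u assume u: "u \<in> hsum U"
    show "T (a *\<^sub>C u) = a *\<^sub>C T u"
    proof (rule ell2_eqI)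
      fix j
      have "(\<lambda>n. mat_act M (int n) (ell2_nth (a *\<^sub>C u)) j) \<longlonglongrightarrow> a *\<^sub>C L u j"
        using scaleC.tendsto[OF tendsto_const L[OF u], of a j]
        by (simp add: scaleC_ell2.rep_eq mat_act_scaleC_arg[OF UM_dom_sub M hs[OF u]] del: ell2_nth_simps)
      then show "ell2_nth (T (a *\<^sub>C u)) j = ell2_nth (a *\<^sub>C T u) j"
        using LIMSEQ_unique[OF L[OF csubspace_scaleC[OF hU u]]] by (simp add: Tn u csubspace_scaleC[OF hU])
    qed
  qed (rule nT)
  moreover have "ell2_nth (T (single k u)) j = M j k u" if u: "u \<in> U k" for j k u
  proof -
    have m: "single k u \<in> hsum U" by (rule single_mem[OF u UM_dom_sub])
    have "ell2_nth (single k u) = (\<lambda>i. if i = k then u else 0)" by (rule ext) simp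
    then have "mat_act M (int n) (ell2_nth (single k u)) j = M j k u" if "n \<ge> nat k" for n
      using mat_act_single[OF UM_dom_sub M u, of "int n" j] that by simp
    then show ?thesis by (simp add: Tn[OF m] tendsto_eq_of_finally[OF L[OF m], of "nat k"])
  qed
  ultimately have "induces U Y M T" by (simp add: induces_def)
  then show ?thesis using nT by blast
qed

end

lemma cinner_single: "cinner u (single k x) = cinner (ell2_nth u k) x"
proof -
  have "cinner u (single k x) = (\<Sum>\<^sub>\<infinity>i\<in>{k}. cinner (ell2_nth u i) (ell2_nth (single k x) i))"
    unfolding cinner_ell2_def by (rule infsum_cong_neutral) (auto simp: cinner.zero_right)
  then show ?thesis by simp
qed

lemma norm_single: "norm (single k x) = norm x"
proof -
  have "inner (single k x) (single k x) = inner x x"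
    using cinner_single[of "single k x" k x] by (simp flip: Re_cinner)
  then show ?thesis by (simp add: norm_eq_sqrt_inner)
qed

text \<open>Twice the real part of the upper triangle of a Gram matrix covers the whole matrix, with
  the diagonal counted once too often. This is the relation between N + N* and H*H on quadratic
  forms.\<close>

lemma norm_sq_sum_triangle:
  fixes p :: "int \<Rightarrow> 'a::real_inner"
  shows "(\<Sum>j\<in>{a..b}. \<Sum>k\<in>{j..b}. 2 * inner (p k) (p j)) = (norm (\<Sum>k\<in>{a..b}. p k))\<^sup>2 + (\<Sum>j\<in>{a..b}. (norm (p j))\<^sup>2)"
proof (cases "a \<le> b + 1")
  case True
  then show ?thesis
  proof (induction a rule: int_le_induct)
    case (step i)
    have iv: "{i - 1..b} = insert (i - 1) {i..b}" using step.hyps by auto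
    have "(\<Sum>k\<in>{i - 1..b}. 2 * inner (p k) (p (i - 1))) = 2 * (norm (p (i - 1)))\<^sup>2 + 2 * inner (p (i - 1)) (\<Sum>k\<in>{i..b}. p k)"
      by (simp add: iv power2_norm_eq_inner inner_sum_right sum_distrib_left inner_commute)
    then show ?case
      using step.IH by (simp add: iv norm_add_sq)
  qed simp
qed simp

lemma inner_eq_Re: "inner x y = Re (cinner x y)"
  by (simp add: Re_cinner)

section \<open>Multiplication by diagonal matrices\<close>

lemma mat_mul_diag_left:
  assumes "u \<in> U k" "\<And>i. A i k u \<in> V i"
  shows "mat_mul U (diag_mat V e) A j k u = (if j \<le> k then e j (A j k u) else 0)"
proof -
  have "mat_mul U (diag_mat V e) A j k u = (\<Sum>i\<in>{j..k}. diag_mat V e j i (A i k u))"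
    using assms(1) by (simp add: mat_mul_def)
  also have "\<dots> = (\<Sum>i\<in>{j..k}. if i = j then e j (A j k u) else 0)"
    using assms by (intro sum.cong) (auto simp: diag_mat_def)
  finally show ?thesis by simp
qed

lemma mat_mul_diag_right:
  assumes "u \<in> U k" and A: "A \<in> UM V Y" and V: "csubspaces V"
  shows "mat_mul U A (diag_mat U e) j k u = (if j \<le> k then A j k (e k u) else 0)"
proof -
  have "mat_mul U A (diag_mat U e) j k u = (\<Sum>i\<in>{j..k}. A j i (diag_mat U e i k u))"
    using assms(1) by (simp add: mat_mul_def)
  also have "\<dots> = (\<Sum>i\<in>{j..k}. if i = k then A j k (e k u) else 0)"
    using assms by (intro sum.cong) (auto simp: diag_mat_def bdd_op_0[OF UM_bdd[OF A] csubspacesD[OF V]])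
  finally show ?thesis by simp
qed

text \<open>Contractivity on windows. Components below \<open>a\<close> do not reach the rows that
  are counted, so \<open>u\<close> needs no bounded support; a smaller \<open>a\<close> recovers the
  rows left out.\<close>

definition contractive :: "(int \<Rightarrow> 'u::complex_inner set) \<Rightarrow> ('u, 'y::complex_inner) opmat \<Rightarrow> bool"
  where "contractive U M \<longleftrightarrow> (\<forall>a b u. (\<forall>k. u k \<in> U k) \<longrightarrow>
     (\<Sum>j\<in>{a..b}. (norm (mat_act M b u j))\<^sup>2) \<le> (\<Sum>k\<in>{a..b}. (norm (u k))\<^sup>2))"

lemma contractiveD:
  "contractive U M \<Longrightarrow> (\<And>k. u k \<in> U k) \<Longrightarrow>
     (\<Sum>j\<in>{a..b}. (norm (mat_act M b u j))\<^sup>2) \<le> (\<Sum>k\<in>{a..b}. (norm (u k))\<^sup>2)"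
  by (simp add: contractive_def)

text \<open>Besides being the counterpart of \<open>single\<close> on windows, it is used as a
  function of the row, so that conditions by cases on \<open>j\<close> become identities of
  columns.\<close>

definition unit_column :: "int \<Rightarrow> 'a::zero \<Rightarrow> int \<Rightarrow> 'a"
  where "unit_column k x i = (if i = k then x else 0)"

lemma unit_column_mem: "csubspaces U \<Longrightarrow> x \<in> U k \<Longrightarrow> unit_column k x i \<in> U i"
  by (auto simp: unit_column_def csubspacesD csubspace_0)

lemma mat_act_unit_column:
  assumes "csubspaces U" "M \<in> UM U Y" "u \<in> U k" "k \<le> b"
  shows "mat_act M b (unit_column k u) j = M j k u"
  using mat_act_single[OF assms] by (simp add: unit_column_def[abs_def])

text \<open>Truncated vectors turn the operator bound into bounds for finite sums, and
  \<open>induces_of_window_bound\<close> with constant 1 leads back. Membership in the ball is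
  handled through \<open>contractive\<close> from here on.\<close>

lemma UMinf_ball_iff:
  fixes U :: "int \<Rightarrow> 'u::chilbert set" and Y :: "int \<Rightarrow> 'y::chilbert set"
  assumes U: "closed_csubspaces U" and Y: "closed_csubspaces Y"
  shows "M \<in> UMinf_ball U Y \<longleftrightarrow> M \<in> UM U Y \<and> contractive U M"
proof (intro iffI conjI)
  assume M: "M \<in> UMinf_ball U Y"
  then show MU: "M \<in> UM U Y" by (simp add: UMinf_ball_def)
  obtain T where T: "T \<in> contraction_op (hsum U) (hsum Y)" "induces U Y M T"
    using M by (auto simp: UMinf_ball_def)
  show "contractive U M"
    unfolding contractive_def
  proof (intro allI impI)
    fix a b u assume "\<forall>k. u k \<in> U k"
    then have u: "u k \<in> U k" for k by blast
    have mem: "ell2_trunc a b u \<in> hsum U" by (rule ell2_trunc_mem[OF u closed_csubspaces_sub[OF U]])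
    have "(\<Sum>j\<in>{a..b}. (norm (mat_act M b u j))\<^sup>2) = (\<Sum>j\<in>{a..b}. (norm (ell2_nth (T (ell2_trunc a b u)) j))\<^sup>2)"
      by (intro sum.cong refl) (simp add: induces_trunc[OF U Y MU T(2) u])
    also have "\<dots> \<le> (norm (T (ell2_trunc a b u)))\<^sup>2" by (rule ell2_finite_le) simp
    also have "\<dots> \<le> (norm (ell2_trunc a b u))\<^sup>2" using T(1) mem by (intro power_mono) (auto simp: contraction_op_def)
    finally show "(\<Sum>j\<in>{a..b}. (norm (mat_act M b u j))\<^sup>2) \<le> (\<Sum>k\<in>{a..b}. (norm (u k))\<^sup>2)"
      by (simp add: norm_ell2_trunc)
  qed
next
  assume M: "M \<in> UM U Y \<and> contractive U M"
  obtain T where "induces U Y M T" "\<And>u. u \<in> hsum U \<Longrightarrow> norm (T u) \<le> 1 * norm u"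
    using induces_of_window_bound[OF U Y conjunct1[OF M], of 1] contractiveD[OF conjunct2[OF M]] by auto
  then have "T \<in> contraction_op (hsum U) (hsum Y)" "induces U Y M T"
    by (auto simp: contraction_op_def induces_def)
  then show "M \<in> UMinf_ball U Y" using M by (auto simp: UMinf_ball_def)
qed

text \<open>Both sides say that \<open>M\<close> maps \<open>unit_column k x\<close> to a difference
  of two unit columns, read before and after applying the inverse. This one equivalence carries the
  interpolation conditions between I - C and \<open>G\<close> and between \<open>F\<close> and I -
  Z2.\<close>

lemma inverse_column_iff:
  assumes U: "csubspaces U" and M: "M \<in> UM U U" "unipotent U M" and x: "x \<in> U k" and x': "x' \<in> U (k - 1)"
  shows "(\<forall>j. M j k x = unit_column k x j - unit_column (k - 1) x' j) \<longleftrightarrow>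
     (\<forall>j. mat_inv U M j k x = unit_column k x j + mat_inv U M j (k - 1) x')"
proof -
  let ?N = "mat_inv U M" and ?s = "\<lambda>i. unit_column k x i - unit_column (k - 1) x' i"
  note N = mat_inv_UM[OF U M]
  have s: "?s i \<in> U i" for i using x x' U by (intro csubspace_diff unit_column_mem csubspacesD)
  have Ns: "mat_act ?N k ?s j = ?N j k x - ?N j (k - 1) x'" for j
    using mat_act_diff_arg[OF U N, of "unit_column k x" "unit_column (k - 1) x'" k j] x x'
    by (simp add: mat_act_unit_column[OF U N] unit_column_mem U)
  have Mx: "mat_act M k (unit_column k x) j = M j k x" for j by (rule mat_act_unit_column[OF U M(1) x]) simp
  show ?thesis
  proof
    assume L: "\<forall>j. M j k x = ?s j"
    show "\<forall>j. ?N j k x = unit_column k x j + ?N j (k - 1) x'"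
    proof
      fix j
      show "?N j k x = unit_column k x j + ?N j (k - 1) x'"
      proof (cases "j \<le> k")
        case True
        have "mat_act ?N k (mat_act M k (unit_column k x)) j = unit_column k x j"
          by (rule mat_act_inv(2)[OF U M unit_column_mem[OF U x] True])
        moreover have "mat_act M k (unit_column k x) = ?s" using L Mx by auto
        ultimately show ?thesis using Ns[of j] by (simp add: algebra_simps)
      next
        case False
        then show ?thesis using x x' by (simp add: UM_low[OF N] unit_column_def)
      qed
    qed
  next
    assume R: "\<forall>j. ?N j k x = unit_column k x j + ?N j (k - 1) x'"
    show "\<forall>j. M j k x = ?s j"
    proof
      fix j
      show "M j k x = ?s j"
      proof (cases "j \<le> k")
        case True
        have "mat_act M k (mat_act ?N k ?s) j = ?s j"
          by (rule mat_act_inv(1)[OF U M s True])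
        moreover have "mat_act ?N k ?s = unit_column k x" using R Ns by auto
        ultimately show ?thesis using Mx[of j] by simp
      next
        case False
        then show ?thesis using x by (simp add: UM_low[OF M(1)] unit_column_def)
      qed
    qed
  qed
qed

section \<open>Columns of \<open>H\<close> and their defect operators\<close>

locale column_contraction =
  fixes U :: "int \<Rightarrow> 'u::chilbert set" and Y :: "int \<Rightarrow> 'y::chilbert set" and H :: "('u, 'y) opmat"
  assumes U: "closed_csubspaces U" and Y: "closed_csubspaces Y" and H: "H \<in> UM2_ball U Y"
begin

abbreviation "h \<equiv> mat_col U H"
abbreviation "d \<equiv> defect U Y H"
abbreviation "D \<equiv> defect_space U Y H"
abbreviation "gr \<equiv> gram U Y H"

lemma Us: "csubspaces U" and Ys: "csubspaces Y" by (rule closed_csubspaces_sub, rule U Y)+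

lemmas Uk = csubspacesD[OF Us]
lemma H_UM: "H \<in> UM U Y" using H by (simp add: UM2_ball_def)

lemma h_summable:
  assumes u: "u \<in> U k"
  shows "(\<lambda>j. (norm (H j k u))\<^sup>2) summable_on UNIV" "(\<Sum>\<^sub>\<infinity>j. (norm (H j k u))\<^sup>2) \<le> (norm u)\<^sup>2"
proof -
  have s: "(\<lambda>j. (norm (H j k u))\<^sup>2) summable_on {..k}" "(\<Sum>\<^sub>\<infinity>j\<in>{..k}. (norm (H j k u))\<^sup>2) \<le> (norm u)\<^sup>2"
    using H u by (auto simp: UM2_ball_def)
  show "(\<lambda>j. (norm (H j k u))\<^sup>2) summable_on UNIV"
    using s(1) by (rule summable_on_cong_neutral[THEN iffD1, rotated -1]) (auto simp: UM_low[OF H_UM _ u])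
  have "(\<Sum>\<^sub>\<infinity>j. (norm (H j k u))\<^sup>2) = (\<Sum>\<^sub>\<infinity>j\<in>{..k}. (norm (H j k u))\<^sup>2)"
    by (rule infsum_cong_neutral) (auto simp: UM_low[OF H_UM _ u])
  then show "(\<Sum>\<^sub>\<infinity>j. (norm (H j k u))\<^sup>2) \<le> (norm u)\<^sup>2" using s(2) by simp
qed

lemma h_nth: "u \<in> U k \<Longrightarrow> ell2_nth (h k u) j = H j k u"
  using h_summable(1) by (simp add: mat_col_def Abs_ell2_inverse)

lemma norm_h_le: "u \<in> U k \<Longrightarrow> norm (h k u) \<le> norm u"
  by (rule power2_le_imp_le) (use h_summable(2) in \<open>simp_all add: norm_ell2_sq h_nth\<close>)

lemma h_bdd: "h k \<in> bdd_op (U k) (hsum Y)"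
proof (rule bdd_opI[where K = 1])
  show "h k u \<in> hsum Y" if "u \<in> U k" for u
    using that by (simp add: hsum_def h_nth UM_mem[OF H_UM])
  show "h k (u + v) = h k u + h k v" if "u \<in> U k" "v \<in> U k" for u v
    by (rule ell2_eqI) (use that in \<open>simp add: h_nth csubspace_add[OF Uk] bdd_op_add[OF UM_bdd[OF H_UM]]\<close>)
  show "h k (a *\<^sub>C u) = a *\<^sub>C h k u" if "u \<in> U k" for a u
    by (rule ell2_eqI) (use that in \<open>simp add: h_nth csubspace_scaleC[OF Uk] bdd_op_scaleC[OF UM_bdd[OF H_UM]]\<close>)
  show "norm (h k u) \<le> 1 * norm u" if "u \<in> U k" for u using norm_h_le[OF that] by simp
qed (simp add: mat_col_def)

lemma hY: "csubspace (hsum Y)" by (rule csubspace_hsum[OF Ys])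

lemmas h_adj = adj_bdd[OF closed_csubspacesD[OF U] hY h_bdd]
lemmas h_adj_cinner' = adj_cinner'[OF closed_csubspacesD[OF U] hY h_bdd]

lemma gram_apply: "u \<in> U k \<Longrightarrow> gr j k u = adj (U j) (hsum Y) (h j) (h k u)"
  by (simp add: gram_def compose_def)

lemma gram_bdd: "gr j k \<in> bdd_op (U k) (U j)"
  using bdd_op_compose[OF h_bdd h_adj Uk] by (simp add: gram_def compose_def)

lemma gram_cinner: "u \<in> U k \<Longrightarrow> v \<in> U j \<Longrightarrow> cinner (gr j k u) v = cinner (h k u) (h j v)"
  by (simp add: gram_apply h_adj_cinner' bdd_op_mem[OF h_bdd])

lemma gram_cinner': "u \<in> U k \<Longrightarrow> v \<in> U j \<Longrightarrow> cinner v (gr j k u) = cinner (h j v) (h k u)"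
  by (metis gram_cinner cinner_commute)

lemma gram_contraction:
  assumes u: "u \<in> U k"
  shows "norm (gr k k u) \<le> norm u"
proof -
  have g: "gr k k u \<in> U k" using bdd_op_mem[OF gram_bdd u] .
  have "(norm (gr k k u))\<^sup>2 = cmod (cinner (gr k k u) (gr k k u))" by (simp add: cinner_self norm_power)
  also have "\<dots> = cmod (cinner (h k u) (h k (gr k k u)))" by (simp add: gram_cinner u g)
  also have "\<dots> \<le> norm (h k u) * norm (h k (gr k k u))" by (rule cmod_cinner_le)
  also have "\<dots> \<le> norm u * norm (gr k k u)" by (intro mult_mono norm_h_le u g) auto
  finally have "norm (gr k k u) * norm (gr k k u) \<le> norm u * norm (gr k k u)" by (simp add: power2_eq_square)
  then show ?thesis by (cases "gr k k u = 0") auto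
qed

lemma gram_sym: "u \<in> U k \<Longrightarrow> v \<in> U k \<Longrightarrow> cinner (gr k k u) v = cinner u (gr k k v)"
  by (simp add: gram_cinner gram_cinner')

text \<open>The column is contractive, so \<open>gr k k\<close> is a symmetric contraction, as
  \<open>op_sqrt_props\<close> requires of its \<open>B\<close>.\<close>

lemma d_props: "nonneg_op (U k) (d k) \<and> (\<forall>u\<in>U k. d k (d k u) = u - gr k k u)"
proof -
  note props = op_sqrt_props[where X = "U k" and B = "gr k k",
      OF closed_csubspacesD[OF U] gram_bdd gram_contraction gram_sym]
  have "d k = op_sqrt (U k) (\<lambda>u\<in>U k. u - gr k k u)" by (simp only: defect_def)
  then show ?thesis using props by metis
qed

lemma d_nonneg: "nonneg_op (U k) (d k)" and d_d: "u \<in> U k \<Longrightarrow> d k (d k u) = u - gr k k u"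
  using d_props by blast+

lemma d_bdd: "d k \<in> bdd_op (U k) (U k)" using d_nonneg by (simp add: nonneg_op_def)

lemma d_mem: "u \<in> U k \<Longrightarrow> d k u \<in> U k" using bdd_op_mem[OF d_bdd] .

lemma d_sym: "u \<in> U k \<Longrightarrow> v \<in> U k \<Longrightarrow> cinner (d k u) v = cinner u (d k v)"
  by (rule nonneg_op_sym[OF d_nonneg Uk])

lemma norm_d_sq: "u \<in> U k \<Longrightarrow> (norm (d k u))\<^sup>2 = (norm u)\<^sup>2 - (norm (h k u))\<^sup>2"
proof -
  assume u: "u \<in> U k"
  have "complex_of_real ((norm (d k u))\<^sup>2) = cinner (d k u) (d k u)"
    by (simp only: cinner_self)
  also have "\<dots> = cinner u (d k (d k u))" by (rule d_sym[OF u d_mem[OF u]])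
  also have "\<dots> = of_real ((norm u)\<^sup>2 - (norm (h k u))\<^sup>2)"
    by (simp add: d_d u cinner.diff_right gram_cinner' cinner_self)
  finally show ?thesis using of_real_eq_iff by blast
qed

lemma D_closed: "closed_csubspaces D"
  unfolding closed_csubspaces_def defect_space_def
  using closed_csubspace_closure_image[OF d_bdd Uk] by blast

lemma Ds: "csubspaces D" by (rule closed_csubspaces_sub[OF D_closed])

lemmas Dk = csubspacesD[OF Ds]

lemma D_sub: "D k \<subseteq> U k"
  unfolding defect_space_def
  by (rule closure_minimal) (use d_mem closed_csubspaceD[OF closed_csubspacesD[OF U]] in auto)

lemma D_in_U: "x \<in> D k \<Longrightarrow> x \<in> U k" using D_sub by blast

lemma d_in_D: "u \<in> U k \<Longrightarrow> d k u \<in> D k"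
  unfolding defect_space_def by (rule closure_subset[THEN subsetD]) simp

lemma d_orth:
  assumes x: "x \<in> U k" "d k x = 0" and y: "y \<in> D k"
  shows "cinner x y = 0"
proof (rule cinner_closure_0[OF _ y[unfolded defect_space_def]])
  show "cinner x z = 0" if "z \<in> d k ` U k" for z
    using that x d_sym by (metis imageE cinner.zero_left)
qed

lemma d_eq_0: "x \<in> D k \<Longrightarrow> d k x = 0 \<Longrightarrow> x = 0"
  using d_orth[of x k x] D_in_U by (simp add: cinner_self)

text \<open>A symmetric operator is injective on the closure of its range. Equalities in
  \<open>D\<close> are therefore tested after applying \<open>d\<close>, which makes factors through
  \<open>d\<close> unique and linear.\<close>

lemma d_inj: "x \<in> D k \<Longrightarrow> y \<in> D k \<Longrightarrow> d k x = d k y \<Longrightarrow> x = y"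
  using d_eq_0[of "x - y" k] csubspace_diff[OF Dk] by (simp add: bdd_op_diff[OF d_bdd Uk] D_in_U)

text \<open>What the projection removes is orthogonal to the range of \<open>d k\<close>, hence
  killed by \<open>d k\<close>.\<close>

lemma d_oproj: "u \<in> U k \<Longrightarrow> d k (oproj (D k) u) = d k u"
proof -
  assume u: "u \<in> U k"
  note P = closed_csubspacesD[OF D_closed, of k]
  have pu: "oproj (D k) u \<in> U k" using oproj_mem[OF P] D_in_U by blast
  have "d k u - d k (oproj (D k) u) = 0"
  proof (rule cinner_ext'[OF _ csubspace_0[OF Uk] Uk])
    show "d k u - d k (oproj (D k) u) \<in> U k" by (intro csubspace_diff[OF Uk] d_mem u pu)
    show "cinner (d k u - d k (oproj (D k) u)) z = cinner 0 z" if z: "z \<in> U k" for z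
    proof -
      have "cinner (d k u - d k (oproj (D k) u)) z = cinner (u - oproj (D k) u) (d k z)"
        by (simp add: cinner.diff_left d_sym u pu z)
      then show ?thesis using oproj_orth[OF P d_in_D[OF z]] by (simp add: cinner.zero_left)
    qed
  qed
  then show ?thesis by simp
qed

lemma d_bdd_D: "d k \<in> bdd_op (U k) (D k)"
  using d_bdd d_in_D unfolding bdd_op_def by (auto simp: PiE_def)

section \<open>The matrices \<open>F\<close>\<close>

text \<open>The product in \<open>F_mat\<close> multiplied out: \<open>d k\<close> already maps into
  \<open>D k\<close>, so the projection disappears, and its adjoint is a mere inclusion.\<close>

definition F_of :: "('u, 'u) opmat \<Rightarrow> ('u, 'u) opmat"
  where "F_of G = (\<lambda>j k. \<lambda>u\<in>U k. if j \<le> k then gr j k u + d j (G j k (d k u)) else 0)"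

lemma F_of_apply: "u \<in> U k \<Longrightarrow> j \<le> k \<Longrightarrow> F_of G j k u = gr j k u + d j (G j k (d k u))"
  by (simp add: F_of_def)

lemma F_of_UM:
  assumes G: "G \<in> UM D D"
  shows "F_of G \<in> UM U U"
proof (rule UMI)
  fix j k
  have "(\<lambda>u\<in>U k. (\<lambda>x\<in>D j. d j x) ((\<lambda>u\<in>U k. G j k (d k u)) u)) \<in> bdd_op (U k) (U j)"
    by (rule bdd_op_compose[OF bdd_op_compose[OF d_bdd_D UM_bdd[OF G] Uk] bdd_op_restrict[OF d_bdd Dk D_sub] Uk])
  moreover have "(\<lambda>u\<in>U k. (\<lambda>x\<in>D j. d j x) ((\<lambda>u\<in>U k. G j k (d k u)) u)) = (\<lambda>u\<in>U k. d j (G j k (d k u)))"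
    using UM_mem[OF G d_in_D] by (auto simp: fun_eq_iff)
  ultimately have 1: "(\<lambda>u\<in>U k. d j (G j k (d k u))) \<in> bdd_op (U k) (U j)" by metis
  show "F_of G j k \<in> bdd_op (U k) (U j)"
  proof (cases "j \<le> k")
    case True
    then have "F_of G j k = (\<lambda>u\<in>U k. gr j k u + (\<lambda>u\<in>U k. d j (G j k (d k u))) u)"
      by (auto simp: F_of_def fun_eq_iff)
    then show ?thesis using bdd_op_plus[OF gram_bdd 1 Uk Uk] by metis
  next
    case False
    then have "F_of G j k = (\<lambda>u\<in>U k. 0)" by (auto simp: F_of_def fun_eq_iff)
    then show ?thesis using bdd_op_zero[OF Uk Uk] by metis
  qed
qed (simp add: F_of_def)

lemma F_of_unipotent: "unipotent D G \<Longrightarrow> unipotent U (F_of G)"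
  unfolding unipotent_def by (simp add: F_of_apply d_in_D d_d)

text \<open>On the left \<open>d j\<close> is injective on \<open>D j\<close>, on the right the
  range of \<open>d k\<close> is dense in \<open>D k\<close>.\<close>

lemma F_of_inj:
  assumes G: "G \<in> UM D D" "G' \<in> UM D D" and eq: "F_of G = F_of G'"
  shows "G = G'"
proof (rule UM_eqI[OF G])
  fix j k x assume jk: "j \<le> k" and x: "x \<in> D k"
  show "G j k x = G' j k x"
  proof (rule bdd_op_eq_on_closure[of "G j k" "d k ` U k" "D j" "G' j k" "D j"])
    show "G j k \<in> bdd_op (closure (d k ` U k)) (D j)" "G' j k \<in> bdd_op (closure (d k ` U k)) (D j)"
      using UM_bdd[OF G(1)] UM_bdd[OF G(2)] by (simp_all add: defect_space_def)
    show "csubspace (d k ` U k)" by (rule csubspace_image[OF d_bdd Uk])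
    show "x \<in> closure (d k ` U k)" using x by (simp add: defect_space_def)
    fix y assume "y \<in> d k ` U k"
    then obtain u where u: "u \<in> U k" "y = d k u" by blast
    have "d j (G j k (d k u)) = d j (G' j k (d k u))"
      using fun_cong[OF fun_cong[OF fun_cong[OF eq, of j], of k], of u] u(1) jk by (simp add: F_of_apply)
    then show "G j k y = G' j k y"
      using d_inj UM_mem[OF G(1) d_in_D[OF u(1)]] UM_mem[OF G(2) d_in_D[OF u(1)]] u(2) by blast
  qed
qed

text \<open>The adjoint of the projection is the embedding of \<open>D k\<close> into
  \<open>U k\<close>, which as a function is the identity on \<open>D k\<close>; so
  \<open>mat_id D\<close> serves as a matrix from \<open>D\<close> to \<open>U\<close>.\<close>

lemma PiH_adj: "mat_adj U D (PiH U Y H) = mat_id D"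
proof -
  have "mat_adj U D (PiH U Y H) j k = mat_id D j k" for j k
    unfolding mat_adj_def
  proof (rule adj_eqI[OF Uk])
    show "mat_id D j k \<in> bdd_op (D k) (U j)"
      using bdd_op_id[OF Dk D_sub] bdd_op_zero[OF Uk Dk] by (auto simp: mat_id_def diag_mat_def simp del: restrict_apply)
    show "cinner (PiH U Y H k j x) y = cinner x (mat_id D j k y)" if "x \<in> U j" "y \<in> D k" for x y
    proof (cases "j = k")
      case True
      have "cinner (x - oproj (D k) x) y = 0"
        using oproj_orth[OF closed_csubspacesD[OF D_closed] that(2)] .
      then show ?thesis using that True by (simp add: PiH_def diag_mat_def mat_id_def cinner.diff_left)
    next
      case False
      then show ?thesis using that by (simp add: PiH_def diag_mat_def mat_id_def cinner.zero_left cinner.zero_right)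
    qed
  qed
  then show ?thesis by (intro ext[of "mat_adj U D (PiH U Y H)"] ext[of "mat_adj U D (PiH U Y H) _"])
qed

lemma PiH_mem: "u \<in> U k \<Longrightarrow> PiH U Y H i k u \<in> D i"
  using oproj_mem[OF closed_csubspacesD[OF D_closed]] csubspace_0[OF Dk]
  by (simp add: PiH_def diag_mat_def)

lemma Nabla_PiH: "mat_mul U (Nabla U Y H) (PiH U Y H) = diag_mat U d"
proof (intro ext)
  fix j k u
  show "mat_mul U (Nabla U Y H) (PiH U Y H) j k u = diag_mat U d j k u"
  proof (cases "u \<in> U k")
    case True
    have "mat_mul U (Nabla U Y H) (PiH U Y H) j k u = (if j \<le> k then d j (PiH U Y H j k u) else 0)"
      unfolding Nabla_def by (rule mat_mul_diag_left) (use True PiH_mem[OF True] in auto)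
    with True show ?thesis
      by (simp add: PiH_def diag_mat_def d_oproj bdd_op_0[OF d_bdd Uk])
  qed (simp add: mat_mul_def diag_mat_def)
qed

lemma F_mat_eq:
  assumes G: "mat_inv D (mat_sub D (mat_id D) C) \<in> UM D D"
  shows "F_mat U Y H C = F_of (mat_inv D (mat_sub D (mat_id D) C))"
proof -
  define G' where "G' = mat_inv D (mat_sub D (mat_id D) C)"
  let ?A = "mat_mul U G' (diag_mat U d)" and ?B = "mat_mul U (Nabla U Y H) (mat_mul U G' (diag_mat U d))"
  have A: "?A j k u = (if j \<le> k then G' j k (d k u) else 0)" if "u \<in> U k" for j k u
    by (rule mat_mul_diag_right[where V = D and Y = D]) (use G that Ds in \<open>simp_all add: G'_def\<close>)
  have Am: "?A j k u \<in> D j" if "u \<in> U k" for j k u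
    using UM_mem[OF G d_in_D[OF that]] csubspace_0[OF Dk] unfolding A[OF that] unfolding G'_def by simp
  have B: "?B j k u = (if j \<le> k then d j (?A j k u) else 0)" if "u \<in> U k" for j k u
    unfolding Nabla_def by (rule mat_mul_diag_left) (use that Am in auto)
  have Bm: "?B j k u \<in> D j" if "u \<in> U k" for j k u
    using d_in_D[OF D_in_U[OF Am[OF that]]] csubspace_0[OF Dk] by (simp add: B[OF that])
  have E: "mat_mul U (mat_id D) ?B j k u = (if j \<le> k then ?B j k u else 0)" if "u \<in> U k" for j k u
    unfolding mat_id_def by (rule mat_mul_diag_left) (use that Bm in auto)
  have "F_mat U Y H C j k u = F_of G' j k u" for j k u
  proof (cases "u \<in> U k")
    case True
    then show ?thesis
      by (simp add: F_mat_def Let_def PiH_adj Nabla_PiH G'_def[symmetric] mat_add_def upper_gram_def E B A F_of_def)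
  qed (simp add: F_mat_def Let_def mat_add_def F_of_def)
  then show ?thesis by (intro ext) (simp add: G'_def)
qed

text \<open>F + F* \<ge> H*H + I as quadratic forms: \<open>mat_act\<close> runs over the upper
  triangle only, and the factor 2 supplies F*. The left side is the full norm in the direct sum,
  including rows below \<open>a\<close>, because H*H is formed from whole columns.\<close>

definition F_positive :: "('u, 'u) opmat \<Rightarrow> bool"
  where "F_positive F \<longleftrightarrow> (\<forall>a b u. (\<forall>k. u k \<in> U k) \<longrightarrow>
    (norm (\<Sum>k\<in>{a..b}. h k (u k)))\<^sup>2 \<le> (\<Sum>j\<in>{a..b}. 2 * inner (mat_act F b u j) (u j) - (norm (u j))\<^sup>2))"

lemma mat_act_F_of:
  assumes G: "G \<in> UM D D" and u: "\<And>k. u k \<in> U k"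
  shows "mat_act (F_of G) b u j = (\<Sum>k\<in>{j..b}. gr j k (u k)) + d j (mat_act G b (\<lambda>k. d k (u k)) j)"
proof -
  have m: "G j k (d k (u k)) \<in> U j" for k using UM_mem[OF G d_in_D[OF u]] D_in_U by blast
  show ?thesis
    by (simp add: mat_act_def F_of_apply u sum.distrib bdd_op_sum[OF d_bdd Uk] m)
qed

text \<open>The two defects of positivity, of \<open>F + F\<^sup>* - H\<^sup>*H - I\<close> and of \<open>G + G\<^sup>* - I\<close>, agree.\<close>

lemma F_of_identity:
  assumes G: "G \<in> UM D D" and u: "\<And>k. u k \<in> U k"
  shows "(\<Sum>j\<in>{a..b}. 2 * inner (mat_act (F_of G) b u j) (u j) - (norm (u j))\<^sup>2)
    = (norm (\<Sum>k\<in>{a..b}. h k (u k)))\<^sup>2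
      + (\<Sum>j\<in>{a..b}. 2 * inner (mat_act G b (\<lambda>k. d k (u k)) j) (d j (u j)) - (norm (d j (u j)))\<^sup>2)"
proof -
  let ?x = "mat_act G b (\<lambda>k. d k (u k))"
  have x: "?x j \<in> U j" for j by (rule D_in_U, rule mat_act_mem[OF Ds G Ds]) (rule d_in_D[OF u])
  have dx: "inner (d j (?x j)) (u j) = inner (?x j) (d j (u j))" for j
    by (simp add: inner_eq_Re d_sym x u)
  \<comment> \<open>\<open>norm_d_sq\<close> splits off the norm of \<open>h j (u j)\<close> from
    that of \<open>u j\<close>; it cancels the diagonal that \<open>norm_sq_sum_triangle\<close>
    counts once too often.\<close>
  have "2 * inner (mat_act (F_of G) b u j) (u j) - (norm (u j))\<^sup>2
     = (\<Sum>k\<in>{j..b}. 2 * inner (h k (u k)) (h j (u j))) - (norm (h j (u j)))\<^sup>2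
       + (2 * inner (?x j) (d j (u j)) - (norm (d j (u j)))\<^sup>2)" for j
  proof -
    have "inner (\<Sum>k\<in>{j..b}. gr j k (u k)) (u j) = (\<Sum>k\<in>{j..b}. inner (h k (u k)) (h j (u j)))"
      by (simp add: inner_sum_left) (simp add: inner_eq_Re gram_cinner u)
    then show ?thesis
      by (simp add: mat_act_F_of[OF G u] inner_add_left dx norm_d_sq u sum_distrib_left)
  qed
  then show ?thesis
    using norm_sq_sum_triangle[of "\<lambda>k. h k (u k)" b a] by (simp add: sum.distrib sum_subtractf)
qed

end

section \<open>Contractions and accretive matrices\<close>

lemma mat_act_tendsto:
  assumes U: "csubspaces U" and M: "M \<in> UM U Y" and v: "\<And>n k. v n k \<in> U k" "\<And>k. w k \<in> U k"
    and lim: "\<And>k. (\<lambda>n. v n k) \<longlonglongrightarrow> w k"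
  shows "(\<lambda>n. mat_act M b (v n) j) \<longlonglongrightarrow> mat_act M b w j"
  unfolding mat_act_def
  by (intro tendsto_sum bdd_op_tendsto[OF UM_bdd[OF M] csubspacesD[OF U]] lim v)

lemma mat_sub_id_sub_id:
  assumes U: "csubspaces U" and M: "M \<in> UM U U"
  shows "mat_sub U (mat_id U) (mat_sub U (mat_id U) M) = M"
proof (rule UM_eqI[OF _ M])
  show "mat_sub U (mat_id U) (mat_sub U (mat_id U) M) \<in> UM U U"
    by (intro mat_sub_UM U mat_id_UM M)
qed (simp add: mat_sub_def)

text \<open>The condition G + G* \<ge> I on windows, that is, 2G - I is accretive in the usual
  sense.\<close>

definition accretive :: "(int \<Rightarrow> 'u::complex_inner set) \<Rightarrow> ('u, 'u) opmat \<Rightarrow> bool"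
  where "accretive U G \<longleftrightarrow> (\<forall>a b y. (\<forall>k. y k \<in> U k) \<longrightarrow>
     0 \<le> (\<Sum>j\<in>{a..b}. 2 * inner (mat_act G b y j) (y j) - (norm (y j))\<^sup>2))"

text \<open>Cayley transform: \<open>2 Re \<langle>x, y\<rangle> - \<parallel>y\<parallel>\<^sup>2 = \<parallel>x\<parallel>\<^sup>2 - \<parallel>x - y\<parallel>\<^sup>2\<close> for \<open>y = (I - C) x\<close>.\<close>

lemma contractive_iff_accretive:
  assumes U: "csubspaces U" and C: "C \<in> UM U U" and str: "\<And>k x. x \<in> U k \<Longrightarrow> C k k x = 0"
  shows "contractive U C \<longleftrightarrow> accretive U (mat_inv U (mat_sub U (mat_id U) C))"
proof -
  let ?K = "mat_sub U (mat_id U) C"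
  have K: "?K \<in> UM U U" "unipotent U ?K"
    by (intro mat_sub_UM U mat_id_UM C) (simp add: unipotent_def mat_sub_def mat_id_apply[OF U] str)
  have id: "2 * inner x y - (norm y)\<^sup>2 = (norm x)\<^sup>2 - (norm (x - y))\<^sup>2" for x y :: 'a
    by (simp add: norm_diff_sq)
  have actK: "mat_act ?K b x j = x j - mat_act C b x j" if "\<And>k. x k \<in> U k" "j \<le> b" for b x j
    using that by (simp add: mat_act_sub[OF U] mat_act_id[OF U])
  show ?thesis
  proof
    assume con: "contractive U C"
    show "accretive U (mat_inv U ?K)"
      unfolding accretive_def
    proof (intro allI impI)
      fix a b y assume "\<forall>k. y k \<in> U k"
      then have y: "\<And>k. y k \<in> U k" by blast
      let ?x = "mat_act (mat_inv U ?K) b y"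
      have x: "?x k \<in> U k" for k by (rule mat_act_mem[OF U mat_inv_UM[OF U K] U y])
      have Cx: "mat_act C b ?x j = ?x j - y j" if "j \<in> {a..b}" for j
        using actK[OF x, of j b] mat_act_inv(1)[OF U K y, of j b] that by (simp add: algebra_simps)
      have "0 \<le> (\<Sum>j\<in>{a..b}. (norm (?x j))\<^sup>2) - (\<Sum>j\<in>{a..b}. (norm (mat_act C b ?x j))\<^sup>2)"
        using contractiveD[OF con x] by simp
      then show "0 \<le> (\<Sum>j\<in>{a..b}. 2 * inner (?x j) (y j) - (norm (y j))\<^sup>2)"
        by (simp add: id sum_subtractf Cx)
    qed
  next
    assume acc: "accretive U (mat_inv U ?K)"
    show "contractive U C"
      unfolding contractive_def
    proof (intro allI impI)
      fix a b x assume "\<forall>k. x k \<in> U k"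
      then have x: "\<And>k. x k \<in> U k" by blast
      let ?y = "mat_act ?K b x"
      have y: "?y k \<in> U k" for k by (rule mat_act_mem[OF U K(1) U x])
      have Gy: "mat_act (mat_inv U ?K) b ?y j = x j" if "j \<in> {a..b}" for j
        using mat_act_inv(2)[OF U K x, of j b] that by simp
      have "0 \<le> (\<Sum>j\<in>{a..b}. 2 * inner (mat_act (mat_inv U ?K) b ?y j) (?y j) - (norm (?y j))\<^sup>2)"
        using acc y unfolding accretive_def by blast
      also have "\<dots> = (\<Sum>j\<in>{a..b}. (norm (x j))\<^sup>2 - (norm (mat_act C b x j))\<^sup>2)"
        by (intro sum.cong refl) (simp only: Gy id, simp add: actK x)
      finally show "(\<Sum>j\<in>{a..b}. (norm (mat_act C b x j))\<^sup>2) \<le> (\<Sum>k\<in>{a..b}. (norm (x k))\<^sup>2)"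
        by (simp add: sum_subtractf)
    qed
  qed
qed

text \<open>Contractivity of the column with entries \<open>M\<close> and \<open>M'\<close>, stated
  without forming the sum of their target spaces.\<close>

definition contractive_pair ::
    "(int \<Rightarrow> 'u::complex_inner set) \<Rightarrow> ('u, 'y::complex_inner) opmat \<Rightarrow> ('u, 'w::complex_inner) opmat \<Rightarrow> bool"
  where "contractive_pair U M M' \<longleftrightarrow> (\<forall>a b u. (\<forall>k. u k \<in> U k) \<longrightarrow>
     (\<Sum>j\<in>{a..b}. (norm (mat_act M b u j))\<^sup>2 + (norm (mat_act M' b u j))\<^sup>2) \<le> (\<Sum>k\<in>{a..b}. (norm (u k))\<^sup>2))"

text \<open>Each member alone satisfies a window bound with constant 1, so both induce operators;
  the joint inequality then passes to the limit, first in the columns and then in the rows.\<close>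

lemma contractive_pair_iff:
  fixes U :: "int \<Rightarrow> 'u::chilbert set" and Y :: "int \<Rightarrow> 'y::chilbert set" and W :: "int \<Rightarrow> 'w::chilbert set"
  assumes U: "closed_csubspaces U" and Y: "closed_csubspaces Y" and W: "closed_csubspaces W"
    and M: "M \<in> UM U Y" and M': "M' \<in> UM U W"
  shows "contractive_pair U M M' \<longleftrightarrow> M \<in> UMinf U Y \<and> M' \<in> UMinf U W \<and>
     (\<forall>u\<in>hsum U. (norm (induced_op U Y M u))\<^sup>2 + (norm (induced_op U W M' u))\<^sup>2 \<le> (norm u)\<^sup>2)"
proof
  assume pair: "contractive_pair U M M'"
  have bd: "(\<Sum>j\<in>{a..b}. (norm (mat_act M b u j))\<^sup>2 + (norm (mat_act M' b u j))\<^sup>2) \<le> (\<Sum>k\<in>{a..b}. (norm (u k))\<^sup>2)"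
    if "\<And>k. u k \<in> U k" for a b u
    using pair that by (simp add: contractive_pair_def)
  have bd1: "(\<Sum>j\<in>{a..b}. (norm (mat_act M b u j))\<^sup>2) \<le> 1\<^sup>2 * (\<Sum>k\<in>{a..b}. (norm (u k))\<^sup>2)"
    and bd2: "(\<Sum>j\<in>{a..b}. (norm (mat_act M' b u j))\<^sup>2) \<le> 1\<^sup>2 * (\<Sum>k\<in>{a..b}. (norm (u k))\<^sup>2)"
    if "\<And>k. u k \<in> U k" for a b u
    using bd[OF that, of b a] sum_nonneg[of "{a..b}" "\<lambda>j. (norm (mat_act M b u j))\<^sup>2"]
      sum_nonneg[of "{a..b}" "\<lambda>j. (norm (mat_act M' b u j))\<^sup>2"] by (simp_all add: sum.distrib)
  obtain T where T: "induces U Y M T" using induces_of_window_bound[OF U Y M _ bd1] by auto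
  obtain T' where T': "induces U W M' T'" using induces_of_window_bound[OF U W M' _ bd2] by auto
  have "(norm (T u))\<^sup>2 + (norm (T' u))\<^sup>2 \<le> (norm u)\<^sup>2" if u: "u \<in> hsum U" for u
  proof -
    have uk: "\<And>k. ell2_nth u k \<in> U k" using u by (simp add: hsum_def)
    have sec: "(\<Sum>j\<in>{- int m..int m}. (norm (ell2_nth (T u) j))\<^sup>2 + (norm (ell2_nth (T' u) j))\<^sup>2) \<le> (norm u)\<^sup>2" for m
    proof (rule LIMSEQ_le_const2)
      show "(\<lambda>n. \<Sum>j\<in>{- int m..int m}. (norm (mat_act M (int n) (ell2_nth u) j))\<^sup>2 + (norm (mat_act M' (int n) (ell2_nth u) j))\<^sup>2)
         \<longlonglongrightarrow> (\<Sum>j\<in>{- int m..int m}. (norm (ell2_nth (T u) j))\<^sup>2 + (norm (ell2_nth (T' u) j))\<^sup>2)"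
        by (intro tendsto_intros induces_tendsto[OF U Y M T] induces_tendsto[OF U W M' T'] u)
      have "(\<Sum>j\<in>{- int m..int m}. (norm (mat_act M (int n) (ell2_nth u) j))\<^sup>2 + (norm (mat_act M' (int n) (ell2_nth u) j))\<^sup>2)
         \<le> (norm u)\<^sup>2" if "n \<ge> m" for n
      proof -
        have "(\<Sum>j\<in>{- int m..int m}. (norm (mat_act M (int n) (ell2_nth u) j))\<^sup>2 + (norm (mat_act M' (int n) (ell2_nth u) j))\<^sup>2)
           \<le> (\<Sum>j\<in>{- int m..int n}. (norm (mat_act M (int n) (ell2_nth u) j))\<^sup>2 + (norm (mat_act M' (int n) (ell2_nth u) j))\<^sup>2)"
          using that by (intro sum_mono2) auto
        also have "\<dots> \<le> (\<Sum>k\<in>{- int m..int n}. (norm (ell2_nth u k))\<^sup>2)" by (rule bd[OF uk])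
        also have "\<dots> \<le> (norm u)\<^sup>2" by (intro ell2_finite_le) auto
        finally show ?thesis .
      qed
      then show "\<exists>N. \<forall>n\<ge>N. (\<Sum>j\<in>{- int m..int m}. (norm (mat_act M (int n) (ell2_nth u) j))\<^sup>2 +
          (norm (mat_act M' (int n) (ell2_nth u) j))\<^sup>2) \<le> (norm u)\<^sup>2"
        by blast
    qed
    have "(norm (T u))\<^sup>2 + (norm (T' u))\<^sup>2 = (\<Sum>\<^sub>\<infinity>j. (norm (ell2_nth (T u) j))\<^sup>2 + (norm (ell2_nth (T' u) j))\<^sup>2)"
      unfolding norm_ell2_sq by (rule infsum_add[symmetric]) (rule ell2_summable)+
    also have "\<dots> \<le> (norm u)\<^sup>2" by (rule sq_summable_of_sections(2)[OF _ sec]) simp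
    finally show ?thesis .
  qed
  then show "M \<in> UMinf U Y \<and> M' \<in> UMinf U W \<and>
     (\<forall>u\<in>hsum U. (norm (induced_op U Y M u))\<^sup>2 + (norm (induced_op U W M' u))\<^sup>2 \<le> (norm u)\<^sup>2)"
    using T T' M M' induced_op_eq[OF U Y M T] induced_op_eq[OF U W M' T'] by (auto simp: UMinf_def)
next
  assume R: "M \<in> UMinf U Y \<and> M' \<in> UMinf U W \<and>
     (\<forall>u\<in>hsum U. (norm (induced_op U Y M u))\<^sup>2 + (norm (induced_op U W M' u))\<^sup>2 \<le> (norm u)\<^sup>2)"
  then obtain T T' where T: "induces U Y M T" and T': "induces U W M' T'" by (auto simp: UMinf_def)
  show "contractive_pair U M M'"
    unfolding contractive_pair_def
  proof (intro allI impI)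
    fix a b u assume "\<forall>k. u k \<in> U k"
    then have u: "\<And>k. u k \<in> U k" by blast
    let ?v = "ell2_trunc a b u"
    have mem: "?v \<in> hsum U" by (rule ell2_trunc_mem[OF u closed_csubspaces_sub[OF U]])
    have "(\<Sum>j\<in>{a..b}. (norm (mat_act M b u j))\<^sup>2 + (norm (mat_act M' b u j))\<^sup>2)
       = (\<Sum>j\<in>{a..b}. (norm (ell2_nth (T ?v) j))\<^sup>2) + (\<Sum>j\<in>{a..b}. (norm (ell2_nth (T' ?v) j))\<^sup>2)"
      by (simp add: sum.distrib induces_trunc[OF U Y M T u] induces_trunc[OF U W M' T' u])
    also have "\<dots> \<le> (norm (T ?v))\<^sup>2 + (norm (T' ?v))\<^sup>2" by (intro add_mono ell2_finite_le) auto
    also have "\<dots> \<le> (norm ?v)\<^sup>2"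
      using R mem induced_op_eq[OF U Y M T] induced_op_eq[OF U W M' T'] by simp
    finally show "(\<Sum>j\<in>{a..b}. (norm (mat_act M b u j))\<^sup>2 + (norm (mat_act M' b u j))\<^sup>2) \<le> (\<Sum>k\<in>{a..b}. (norm (u k))\<^sup>2)"
      by (simp add: norm_ell2_trunc)
  qed
qed

context column_contraction
begin

section \<open>Positivity of \<open>F + F\<^sup>* - H\<^sup>*H - I\<close>\<close>

lemma F_positiveD:
  assumes "F_positive F" "\<And>k. u k \<in> U k"
  shows "(norm (\<Sum>k\<in>{a..b}. h k (u k)))\<^sup>2 \<le> (\<Sum>j\<in>{a..b}. 2 * inner (mat_act F b u j) (u j) - (norm (u j))\<^sup>2)"
  using assms by (simp add: F_positive_def)

text \<open>\<open>F_of_identity\<close> settles vectors with components \<open>d k (u k)\<close>. A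
  window has finitely many components and each \<open>D k\<close> is the closure of such vectors, so
  continuity gives the rest.\<close>

lemma F_positive_iff:
  assumes G: "G \<in> UM D D"
  shows "F_positive (F_of G) \<longleftrightarrow> accretive D G"
proof
  assume acc: "accretive D G"
  show "F_positive (F_of G)"
    unfolding F_positive_def
  proof (intro allI impI)
    fix a b u assume "\<forall>k. u k \<in> U k"
    then have u: "\<And>k. u k \<in> U k" by blast
    have "0 \<le> (\<Sum>j\<in>{a..b}. 2 * inner (mat_act G b (\<lambda>k. d k (u k)) j) (d j (u j)) - (norm (d j (u j)))\<^sup>2)"
      using acc[unfolded accretive_def, rule_format, of "\<lambda>k. d k (u k)" b a] d_in_D[OF u] by simp
    then show "(norm (\<Sum>k\<in>{a..b}. h k (u k)))\<^sup>2 \<le> (\<Sum>j\<in>{a..b}. 2 * inner (mat_act (F_of G) b u j) (u j) - (norm (u j))\<^sup>2)"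
      by (simp add: F_of_identity[OF G u])
  qed
next
  assume pos: "F_positive (F_of G)"
  show "accretive D G"
    unfolding accretive_def
  proof (intro allI impI)
    fix a b y assume y: "\<forall>k. y k \<in> D k"
    have "\<exists>s. (\<forall>n. s n \<in> U k) \<and> (\<lambda>n. d k (s n)) \<longlonglongrightarrow> y k" for k
    proof -
      obtain f where f: "\<forall>n. f n \<in> d k ` U k" "f \<longlonglongrightarrow> y k"
        using y[rule_format, of k] unfolding defect_space_def closure_sequential by metis
      then have "\<forall>n. \<exists>u\<in>U k. f n = d k u" by blast
      then obtain s where s: "\<And>n. s n \<in> U k" "\<And>n. f n = d k (s n)" by metis
      then have "f = (\<lambda>n. d k (s n))" by blast
      then show ?thesis using f s by blast
    qed
    then obtain s where s: "\<And>k n. s k n \<in> U k" "\<And>k. (\<lambda>n. d k (s k n)) \<longlonglongrightarrow> y k" by metis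
    have "(\<lambda>n. mat_act G b (\<lambda>k. d k (s k n)) j) \<longlonglongrightarrow> mat_act G b y j" for j
      by (rule mat_act_tendsto[OF Ds G]) (use s y in \<open>auto intro: d_in_D\<close>)
    then have lim: "(\<lambda>n. \<Sum>j\<in>{a..b}. 2 * inner (mat_act G b (\<lambda>k. d k (s k n)) j) (d j (s j n)) - (norm (d j (s j n)))\<^sup>2)
       \<longlonglongrightarrow> (\<Sum>j\<in>{a..b}. 2 * inner (mat_act G b y j) (y j) - (norm (y j))\<^sup>2)"
      by (intro tendsto_intros s)
    have "0 \<le> (\<Sum>j\<in>{a..b}. 2 * inner (mat_act G b (\<lambda>k. d k (s k n)) j) (d j (s j n)) - (norm (d j (s j n)))\<^sup>2)" for n
      using F_positiveD[OF pos, of "\<lambda>k. s k n" a b] F_of_identity[OF G, of "\<lambda>k. s k n" b a] s(1) by simp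
    then show "0 \<le> (\<Sum>j\<in>{a..b}. 2 * inner (mat_act G b y j) (y j) - (norm (y j))\<^sup>2)"
      by (intro LIMSEQ_le_const[OF lim]) auto
  qed
qed

text \<open>A two-sided factorization in the manner of Douglas. For fixed \<open>p\<close> the
  functional is bounded in terms of \<open>d j q\<close>, so Riesz on \<open>D j\<close> yields a
  preimage of \<open>e p\<close> under \<open>d j\<close>; its norm is at most that of
  \<open>d k p\<close>, so it depends boundedly on \<open>d k p\<close> in turn.\<close>

lemma defect_factor:
  assumes e: "e \<in> bdd_op (U k) (U j)"
    and bd: "\<And>p q. p \<in> U k \<Longrightarrow> q \<in> U j \<Longrightarrow> cmod (cinner (e p) q) \<le> norm (d k p) * norm (d j q)"
  shows "\<exists>g\<in>bdd_op (D k) (D j). \<forall>p\<in>U k. e p = d j (g (d k p))"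
proof -
  have ep: "e p \<in> U j" if "p \<in> U k" for p using bdd_op_mem[OF e that] .
  have "\<exists>x\<in>D j. e p = d j x \<and> norm x \<le> norm (d k p)" if p: "p \<in> U k" for p
  proof -
    obtain \<phi> where \<phi>: "\<phi> \<in> bdd_op (closure (d j ` U j)) (UNIV :: complex set)"
        "\<And>q. q \<in> U j \<Longrightarrow> \<phi> (d j q) = cinner q (e p)"
        "\<And>x. x \<in> closure (d j ` U j) \<Longrightarrow> norm (\<phi> x) \<le> norm (d k p) * norm x"
    proof (rule dominated_factor[OF Uk closed_UNIV d_bdd, of j "\<lambda>q. cinner q (e p)" "norm (d k p)"])
      show "norm (cinner q (e p)) \<le> norm (d k p) * norm (d j q)" if "q \<in> U j" for q
        using bd[OF p that] by (metis cinner_commute complex_mod_cnj)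
    qed (auto simp: cinner_add_left cinner_scaleC_left scaleC_complex_def)
    note Dj = closed_csubspacesD[OF D_closed, of j]
    have \<phi>': "\<phi> \<in> bdd_op (D j) UNIV" using \<phi>(1) by (simp add: defect_space_def)
    obtain x where x: "x \<in> D j" "\<And>z. z \<in> D j \<Longrightarrow> \<phi> z = cinner z x"
      by (rule riesz[OF Dj, of \<phi> "norm (d k p)"])
         (use \<phi>(3) in \<open>auto simp: bdd_op_add[OF \<phi>'] bdd_op_scaleC[OF \<phi>'] scaleC_complex_def defect_space_def\<close>)
    have "d j x = e p"
    proof (rule cinner_ext[OF d_mem[OF D_in_U[OF x(1)]] ep[OF p] Uk])
      fix q assume q: "q \<in> U j"
      have "cinner q (d j x) = cinner (d j q) x" using d_sym[OF q D_in_U[OF x(1)]] by simp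
      also have "\<dots> = cinner q (e p)" using x(2)[OF d_in_D[OF q]] \<phi>(2)[OF q] by simp
      finally show "cinner q (d j x) = cinner q (e p)" .
    qed
    moreover have "norm x \<le> norm (d k p)"
    proof -
      have "norm (\<phi> x) \<le> norm (d k p) * norm x" using \<phi>(3) x(1) by (simp add: defect_space_def)
      then have "norm x * norm x \<le> norm (d k p) * norm x"
        by (simp add: x cinner_self norm_mult power2_eq_square)
      then show ?thesis by (cases "x = 0") auto
    qed
    ultimately show ?thesis using x(1) by metis
  qed
  \<comment> \<open>\<open>A\<close> is a mere choice of preimages; it is linear because
    \<open>d j\<close> is injective on \<open>D j\<close>.\<close>
  then obtain A where A: "\<And>p. p \<in> U k \<Longrightarrow> A p \<in> D j" "\<And>p. p \<in> U k \<Longrightarrow> e p = d j (A p)"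
    "\<And>p. p \<in> U k \<Longrightarrow> norm (A p) \<le> norm (d k p)" by metis
  obtain g where g: "g \<in> bdd_op (closure (d k ` U k)) (D j)" "\<And>p. p \<in> U k \<Longrightarrow> g (d k p) = A p"
  proof (rule dominated_factor[OF Uk closed_csubspaceD(2)[OF closed_csubspacesD[OF D_closed]] d_bdd, of k A j 1])
    show "A (p + q) = A p + A q" if pq: "p \<in> U k" "q \<in> U k" for p q
    proof (rule d_inj)
      show "d j (A (p + q)) = d j (A p + A q)"
        using pq A(1,2) csubspace_add[OF Uk pq] by (simp add: bdd_op_add[OF d_bdd] bdd_op_add[OF e] D_in_U flip: A(2))
    qed (use pq A(1) csubspace_add[OF Uk] csubspace_add[OF Dk] in auto)
    show "A (a *\<^sub>C p) = a *\<^sub>C A p" if p: "p \<in> U k" for a p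
    proof (rule d_inj)
      show "d j (A (a *\<^sub>C p)) = d j (a *\<^sub>C A p)"
        using p A(1,2) csubspace_scaleC[OF Uk p] by (simp add: bdd_op_scaleC[OF d_bdd] bdd_op_scaleC[OF e] D_in_U flip: A(2))
    qed (use p A(1) csubspace_scaleC[OF Uk] csubspace_scaleC[OF Dk] in auto)
  qed (use A in auto)
  then show ?thesis using A(2) by (intro bexI[of _ g]) (auto simp: defect_space_def)
qed

text \<open>The scalar \<open>t\<close> in front of \<open>p\<close> turns positivity on two
  components into the quadratic of \<open>cross_term_le\<close>; \<open>norm_d_sq\<close> identifies
  the outer coefficients.\<close>

lemma F_positive_2x2:
  assumes F: "F \<in> UM U U" "unipotent U F" and pos: "F_positive F" and jk: "j < k"
    and p: "p \<in> U k" and q: "q \<in> U j"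
  shows "cmod (cinner (F j k p - gr j k p) q) \<le> norm (d k p) * norm (d j q)"
proof -
  have "(cmod (cinner (F j k p - gr j k p) q))\<^sup>2 \<le> (norm (d j q))\<^sup>2 * (norm (d k p))\<^sup>2"
  proof (rule cross_term_le)
    fix t :: complex
    have tp: "t *\<^sub>C p \<in> U k" using p by (rule csubspace_scaleC[OF Uk])
    let ?u = "\<lambda>i. unit_column j q i + unit_column k (t *\<^sub>C p) i"
    have u: "?u i \<in> U i" for i
      by (intro csubspace_add[OF Uk] unit_column_mem[OF Us] q tp)
    have uj: "?u j = q" "?u k = t *\<^sub>C p" and u0: "?u i = 0" if "i \<noteq> j" "i \<noteq> k" for i
      using jk that by (auto simp: unit_column_def)
    have uj: "?u j = q" "?u k = t *\<^sub>C p" using jk by (auto simp: unit_column_def)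
    have act: "mat_act F k ?u i = F i j q + F i k (t *\<^sub>C p)" for i
      using jk by (simp add: mat_act_add_arg[OF Us F(1) unit_column_mem[OF Us q] unit_column_mem[OF Us tp]]
        mat_act_unit_column[OF Us F(1)] q tp)
    have sub: "{j, k} \<subseteq> {j..k}" using jk by auto
    have "(\<Sum>i\<in>{j..k}. h i (?u i)) = (\<Sum>i\<in>{j, k}. h i (?u i))"
      by (rule sum.mono_neutral_right) (use sub u0 bdd_op_0[OF h_bdd Uk] in auto)
    also have "\<dots> = h j q + t *\<^sub>C h k p"
      using jk by (simp add: uj bdd_op_scaleC[OF h_bdd p])
    finally have lhs: "(\<Sum>i\<in>{j..k}. h i (?u i)) = h j q + t *\<^sub>C h k p" .
    have "(\<Sum>i\<in>{j..k}. 2 * inner (mat_act F k ?u i) (?u i) - (norm (?u i))\<^sup>2)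
       = (\<Sum>i\<in>{j, k}. 2 * inner (mat_act F k ?u i) (?u i) - (norm (?u i))\<^sup>2)"
      by (rule sum.mono_neutral_right) (use sub u0 in auto)
    also have "\<dots> = 2 * inner (q + t *\<^sub>C F j k p) q - (norm q)\<^sup>2 + (norm (t *\<^sub>C p))\<^sup>2"
      using jk by (simp add: act uj unipotentD[OF F(2)] UM_low[OF F(1)] q p tp bdd_op_scaleC[OF UM_bdd[OF F(1)] p]
        power2_norm_eq_inner del: scaleC_scaleC)
    finally have rhs: "(\<Sum>i\<in>{j..k}. 2 * inner (mat_act F k ?u i) (?u i) - (norm (?u i))\<^sup>2)
        = 2 * inner (q + t *\<^sub>C F j k p) q - (norm q)\<^sup>2 + (norm (t *\<^sub>C p))\<^sup>2" .
    have "(norm (h j q + t *\<^sub>C h k p))\<^sup>2 \<le> 2 * inner (q + t *\<^sub>C F j k p) q - (norm q)\<^sup>2 + (norm (t *\<^sub>C p))\<^sup>2"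
      using F_positiveD[OF pos u, where a = j and b = k] unfolding lhs rhs .
    moreover have "inner (h j q) (t *\<^sub>C h k p) = Re (t * cinner (gr j k p) q)"
      by (subst inner_commute) (simp add: inner_eq_Re cinner_scaleC_left gram_cinner p q)
    moreover have "inner (q + t *\<^sub>C F j k p) q = (norm q)\<^sup>2 + Re (t * cinner (F j k p) q)"
      by (simp add: inner_add_left power2_norm_eq_inner) (simp add: inner_eq_Re cinner_scaleC_left)
    ultimately show "0 \<le> (norm (d j q))\<^sup>2 + 2 * Re (t * cinner (F j k p - gr j k p) q) + (cmod t)\<^sup>2 * (norm (d k p))\<^sup>2"
      by (simp add: norm_add_sq norm_scaleC power_mult_distrib norm_d_sq p q cinner.diff_left algebra_simps)
  qed simp
  then have "(cmod (cinner (F j k p - gr j k p) q))\<^sup>2 \<le> (norm (d k p) * norm (d j q))\<^sup>2"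
    by (simp add: power_mult_distrib mult.commute)
  then show ?thesis by (rule power2_le_imp_le) simp
qed

text \<open>Only the entries above the diagonal need factoring. On the diagonal \<open>G\<close> is
  the identity, since I - H_k*H_k is already the square of the defect operator.\<close>

lemma F_factor:
  assumes F: "F \<in> UM U U" "unipotent U F" and pos: "F_positive F"
  shows "\<exists>G\<in>UM D D. unipotent D G \<and> F = F_of G"
proof -
  have "\<exists>g\<in>bdd_op (D k) (D j). \<forall>p\<in>U k. F j k p - gr j k p = d j (g (d k p))" if jk: "j < k" for j k
  proof -
    have e: "(\<lambda>p\<in>U k. F j k p - gr j k p) \<in> bdd_op (U k) (U j)"
      by (intro bdd_op_minus UM_bdd[OF F(1)] gram_bdd Uk)
    show ?thesis
      using defect_factor[OF e] F_positive_2x2[OF F pos jk] by simp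
  qed
  then obtain g where g: "\<And>j k. j < k \<Longrightarrow> g j k \<in> bdd_op (D k) (D j)"
    "\<And>j k p. j < k \<Longrightarrow> p \<in> U k \<Longrightarrow> F j k p - gr j k p = d j (g j k (d k p))" by metis
  define G where "G j k = (if j < k then g j k else mat_id D j k)" for j k
  have G: "G \<in> UM D D"
    by (rule UMI) (use g(1) UM_bdd[OF mat_id_UM[OF Ds]] in \<open>auto simp: G_def mat_id_apply[OF Ds]\<close>)
  have uni: "unipotent D G" by (simp add: unipotent_def G_def mat_id_apply[OF Ds])
  have "F = F_of G"
  proof (rule UM_eqI[OF F(1) F_of_UM[OF G]])
    fix j k p assume jk: "j \<le> k" and p: "p \<in> U k"
    show "F j k p = F_of G j k p"
    proof (cases "j = k")
      case True
      then show ?thesis using unipotentD[OF F(2) p] unipotentD[OF F_of_unipotent[OF uni] p] by simp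
    next
      case False
      then show ?thesis using g(2)[of j k p] jk p by (simp add: F_of_apply G_def algebra_simps)
    qed
  qed
  then show ?thesis using G uni by blast
qed

section \<open>Positivity of F and contractivity of the pair\<close>

lemma h_sum_nth:
  assumes u: "\<And>k. u k \<in> U k"
  shows "ell2_nth (\<Sum>k\<in>{a..b}. h k (u k)) j = (\<Sum>k\<in>{a..b}. H j k (u k))"
  by (simp add: ell2_nth_sum h_nth u)

lemma F_positive_imp_contractive_pair:
  assumes F: "F \<in> UM U U" "unipotent U F" and pos: "F_positive F"
  shows "contractive_pair U (mat_mul U H (mat_inv U F)) (mat_sub U (mat_id U) (mat_inv U F))"
  unfolding contractive_pair_def
proof (intro allI impI)
  fix a b v assume "\<forall>k. v k \<in> U k"
  then have v: "\<And>k. v k \<in> U k" by blast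
  note N = mat_inv_UM[OF Us F]
  let ?u = "mat_act (mat_inv U F) b v"
  have u: "?u k \<in> U k" for k by (rule mat_act_mem[OF Us N Us v])
  have Fu: "mat_act F b ?u j = v j" if "j \<in> {a..b}" for j
    using mat_act_inv(1)[OF Us F v, of j b] that by simp
  \<comment> \<open>The rows of H u below \<open>a\<close> are simply dropped here; the converse
    direction has to recover them.\<close>
  have Hu: "(\<Sum>j\<in>{a..b}. (norm (mat_act H b ?u j))\<^sup>2) \<le> (norm (\<Sum>k\<in>{a..b}. h k (?u k)))\<^sup>2"
  proof -
    have "(\<Sum>j\<in>{a..b}. (norm (mat_act H b ?u j))\<^sup>2) = (\<Sum>j\<in>{a..b}. (norm (ell2_nth (\<Sum>k\<in>{a..b}. h k (?u k)) j))\<^sup>2)"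
      by (intro sum.cong refl) (simp add: h_sum_nth[OF u] mat_act_wider[OF Us H_UM u, of a])
    then show ?thesis by (simp add: ell2_finite_le)
  qed
  have "(\<Sum>j\<in>{a..b}. (norm (mat_act (mat_mul U H (mat_inv U F)) b v j))\<^sup>2 +
           (norm (mat_act (mat_sub U (mat_id U) (mat_inv U F)) b v j))\<^sup>2)
     = (\<Sum>j\<in>{a..b}. (norm (mat_act H b ?u j))\<^sup>2) + (\<Sum>j\<in>{a..b}. (norm (v j - ?u j))\<^sup>2)"
    by (simp add: sum.distrib mat_act_mul[OF H_UM N Us Us v] mat_act_sub[OF Us v] mat_act_id[OF Us v])
  also have "\<dots> \<le> (\<Sum>j\<in>{a..b}. 2 * inner (mat_act F b ?u j) (?u j) - (norm (?u j))\<^sup>2) + (\<Sum>j\<in>{a..b}. (norm (v j - ?u j))\<^sup>2)"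
    using order_trans[OF Hu F_positiveD[OF pos u]] by simp
  also have "\<dots> = (\<Sum>j\<in>{a..b}. (norm (v j))\<^sup>2)"
    unfolding sum.distrib[symmetric] by (intro sum.cong refl) (simp add: Fu norm_diff_sq)
  finally show "(\<Sum>j\<in>{a..b}. (norm (mat_act (mat_mul U H (mat_inv U F)) b v j))\<^sup>2 +
           (norm (mat_act (mat_sub U (mat_id U) (mat_inv U F)) b v j))\<^sup>2) \<le> (\<Sum>k\<in>{a..b}. (norm (v k))\<^sup>2)" .
qed

text \<open>Applied to a vector supported in \<open>{a..b}\<close>, the rows below \<open>a\<close> of \<open>F u\<close> cancel in the
  contractivity estimate, so that they can be taken into account in the norm of \<open>H u\<close> for free.\<close>

lemma contractive_pair_imp_F_positive:
  assumes F: "F \<in> UM U U" "unipotent U F" and Z1: "Z1 \<in> UM U Y" and HZ: "H = mat_mul U Z1 F"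
    and pair: "contractive_pair U Z1 (mat_sub U (mat_id U) (mat_inv U F))"
  shows "F_positive F"
  unfolding F_positive_def
proof (intro allI impI)
  fix a b u assume "\<forall>k. u k \<in> U k"
  then have u0: "\<And>k. u k \<in> U k" by blast
  let ?N = "mat_inv U F"
  note N = mat_inv_UM[OF Us F]
  define u' where "u' k = (if k \<in> {a..b} then u k else 0)" for k
  have u: "u' k \<in> U k" for k using u0 csubspace_0[OF Uk] by (simp add: u'_def)
  define v where "v = mat_act F b u'"
  have v: "v k \<in> U k" for k unfolding v_def by (rule mat_act_mem[OF Us F(1) Us u])
  have Fu: "v j = mat_act F b u j" if "j \<in> {a..b}" for j
    unfolding v_def using that by (intro mat_act_cong) (auto simp: u'_def)
  have sumH: "(\<Sum>k\<in>{a..b}. H j k (u k)) = mat_act H b u' j" for j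
  proof -
    have "mat_act H b u' j = (\<Sum>k\<in>{min a j..b}. H j k (u' k))" by (rule mat_act_wider[OF Us H_UM u]) simp
    also have "\<dots> = (\<Sum>k\<in>{a..b}. H j k (u k))"
      by (rule sum.mono_neutral_cong_right) (auto simp: u'_def bdd_op_0[OF UM_bdd[OF H_UM] Uk])
    finally show ?thesis by simp
  qed
  let ?c = "\<Sum>j\<in>{a..b}. 2 * inner (mat_act F b u j) (u j) - (norm (u j))\<^sup>2"
  let ?w = "\<Sum>k\<in>{a..b}. h k (u k)"
  have wn: "ell2_nth ?w j = mat_act H b u' j" for j by (simp add: h_sum_nth[OF u0] sumH)
  have win: "(\<Sum>j\<in>{a'..b}. (norm (ell2_nth ?w j))\<^sup>2) \<le> ?c" if a': "a' \<le> a" for a'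
  proof -
    have "(\<Sum>j\<in>{a'..b}. (norm (mat_act Z1 b v j))\<^sup>2 + (norm (mat_act (mat_sub U (mat_id U) ?N) b v j))\<^sup>2)
       \<le> (\<Sum>j\<in>{a'..b}. (norm (v j))\<^sup>2)"
      using pair v unfolding contractive_pair_def by blast
    moreover have "mat_act Z1 b v j = ell2_nth ?w j" for j
      unfolding wn v_def by (subst HZ) (rule mat_act_mul[OF Z1 F(1) Us Us u, symmetric])
    moreover have "mat_act (mat_sub U (mat_id U) ?N) b v j = v j - u' j" if "j \<in> {a'..b}" for j
      using that mat_act_inv(2)[OF Us F u, of j b, folded v_def] by (simp add: mat_act_sub[OF Us v] mat_act_id[OF Us v])
    ultimately have "(\<Sum>j\<in>{a'..b}. (norm (ell2_nth ?w j))\<^sup>2) \<le> (\<Sum>j\<in>{a'..b}. (norm (v j))\<^sup>2 - (norm (v j - u' j))\<^sup>2)"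
      by (simp add: sum.distrib sum_subtractf)
    also have "\<dots> = ?c"
      by (rule sum.mono_neutral_cong_right) (use a' in \<open>auto simp: u'_def Fu norm_diff_sq\<close>)
    finally show ?thesis .
  qed
  have "(\<Sum>\<^sub>\<infinity>j. (norm (ell2_nth ?w j))\<^sup>2) \<le> ?c"
  \<comment> \<open>Rows above \<open>b\<close> vanish, and \<open>win\<close> holds with the same
    constant for every lower end of the window, so it controls the full norm of H u.\<close>
  proof (rule sq_summable_of_sections(2))
    fix m
    have "(\<Sum>j\<in>{- int m..int m}. (norm (ell2_nth ?w j))\<^sup>2) \<le> (\<Sum>j\<in>{min a (- int m)..max b (int m)}. (norm (ell2_nth ?w j))\<^sup>2)"
      by (rule sum_mono2) auto
    also have "\<dots> = (\<Sum>j\<in>{min a (- int m)..b}. (norm (ell2_nth ?w j))\<^sup>2)"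
      by (rule sum.mono_neutral_right) (auto simp: wn mat_act_def)
    also have "\<dots> \<le> ?c" by (rule win) simp
    finally show "(\<Sum>j\<in>{- int m..int m}. (norm (ell2_nth ?w j))\<^sup>2) \<le> ?c" .
  qed simp
  then show "(norm ?w)\<^sup>2 \<le> ?c" by (simp add: norm_ell2_sq)
qed

text \<open>\<open>mat_nonneg\<close> demands a value in the non-negative reals, so the section is
  brought into the visibly real form S + cnj S minus squared norms; swapping the two indices turns
  the adjoint part into \<open>cnj S\<close>.\<close>

lemma F_positive_imp_mat_ge:
  assumes F: "F \<in> UM U U" and pos: "F_positive F"
  shows "mat_ge U (mat_add U F (mat_adj U U F)) (mat_add U gr (mat_id U))"
  unfolding mat_ge_def mat_nonneg_def
proof (intro allI impI)
  fix a b u0 assume "\<forall>k\<in>{a..b}. u0 k \<in> U k" "a \<le> (b::int)"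
  define u where "u k = (if k \<in> {a..b} then u0 k else 0)" for k
  have u: "u k \<in> U k" for k using \<open>\<forall>k\<in>{a..b}. u0 k \<in> U k\<close> csubspace_0[OF Uk] by (simp add: u_def)
  let ?I = "{a..b}"
  note adj = adj_cinner'[OF closed_csubspacesD[OF U] Uk UM_bdd[OF F]]
  define S where "S = (\<Sum>i\<in>?I. \<Sum>k\<in>?I. cinner (F i k (u k)) (u i))"
  have "(\<Sum>i\<in>?I. cinner (\<Sum>k\<in>?I. mat_sub U (mat_add U F (mat_adj U U F)) (mat_add U gr (mat_id U)) i k (u0 k)) (u0 i))
     = (\<Sum>i\<in>?I. \<Sum>k\<in>?I. cinner (F i k (u k)) (u i) + cinner (u k) (F k i (u i))
         - cinner (h k (u k)) (h i (u i)) - (if i = k then cinner (u k) (u i) else 0))"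
    unfolding cinner.sum_left
  proof (intro sum.cong refl)
    fix i k assume ik: "i \<in> ?I" "k \<in> ?I"
    have [simp]: "u0 i = u i" "u0 k = u k" using ik by (auto simp: u_def)
    have [simp]: "mat_add U F (mat_adj U U F) i k (u k) = F i k (u k) + adj (U i) (U k) (F k i) (u k)"
        "mat_add U gr (mat_id U) i k (u k) = gr i k (u k) + (if i = k then u k else 0)"
      using u by (simp_all add: mat_add_def mat_adj_def mat_id_apply[OF Us])
    show "cinner (mat_sub U (mat_add U F (mat_adj U U F)) (mat_add U gr (mat_id U)) i k (u0 k)) (u0 i)
       = cinner (F i k (u k)) (u i) + cinner (u k) (F k i (u i)) - cinner (h k (u k)) (h i (u i))
         - (if i = k then cinner (u k) (u i) else 0)"
      using u by (simp add: mat_sub_def cinner.add_left cinner.diff_left adj gram_cinner cinner.zero_left)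
  qed
  also have "\<dots> = S + cnj S - cinner (\<Sum>k\<in>?I. h k (u k)) (\<Sum>k\<in>?I. h k (u k)) - (\<Sum>i\<in>?I. cinner (u i) (u i))"
  proof -
    have "cnj S = (\<Sum>i\<in>?I. \<Sum>k\<in>?I. cinner (u i) (F i k (u k)))"
      by (simp add: S_def cnj_sum flip: cinner_commute)
    also have "\<dots> = (\<Sum>i\<in>?I. \<Sum>k\<in>?I. cinner (u k) (F k i (u i)))" by (rule sum.swap)
    finally have 1: "cnj S = (\<Sum>i\<in>?I. \<Sum>k\<in>?I. cinner (u k) (F k i (u i)))" .
    have 2: "cinner (\<Sum>k\<in>?I. h k (u k)) (\<Sum>k\<in>?I. h k (u k)) = (\<Sum>i\<in>?I. \<Sum>k\<in>?I. cinner (h k (u k)) (h i (u i)))"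
      by (simp add: cinner.sum_right) (simp add: cinner.sum_left)
    show ?thesis unfolding 1 2 by (simp add: S_def sum.distrib sum_subtractf)
  qed
  also have "\<dots> = of_real (2 * Re S - (norm (\<Sum>k\<in>?I. h k (u k)))\<^sup>2 - (\<Sum>i\<in>?I. (norm (u i))\<^sup>2))"
    by (simp add: cinner_self complex_add_cnj)
  also have "\<dots> \<in> \<real>\<^sub>\<ge>\<^sub>0"
  proof -
    have "S = (\<Sum>i\<in>?I. cinner (mat_act F b u i) (u i))"
      unfolding S_def by (intro sum.cong refl) (simp add: mat_act_wider[OF Us F u, of a] cinner.sum_left)
    then have "2 * Re S - (\<Sum>i\<in>?I. (norm (u i))\<^sup>2) = (\<Sum>j\<in>?I. 2 * inner (mat_act F b u j) (u j) - (norm (u j))\<^sup>2)"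
      by (simp add: sum_subtractf sum_distrib_left Re_cinner)
    then show ?thesis using F_positiveD[OF pos u, where a = a and b = b]
      unfolding nonneg_Reals_of_real_iff by linarith
  qed
  finally show "(\<Sum>i\<in>?I. cinner (\<Sum>k\<in>?I. mat_sub U (mat_add U F (mat_adj U U F)) (mat_add U gr (mat_id U)) i k (u0 k)) (u0 i)) \<in> \<real>\<^sub>\<ge>\<^sub>0" .
qed

end

section \<open>The interpolation conditions\<close>

locale interpolation = column_contraction U Y H
  for U :: "int \<Rightarrow> 'u::chilbert set" and Y :: "int \<Rightarrow> 'y::chilbert set" and H :: "('u, 'y) opmat" +
  fixes \<F> :: "int \<Rightarrow> 'u set" and \<omega> :: "int \<Rightarrow> 'u \<Rightarrow> 'y \<times> 'u"
  assumes \<F>: "closed_csubspaces \<F>" and \<F>_sub: "\<F> k \<subseteq> U k"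
    and \<omega>: "\<omega> k \<in> contraction_op (\<F> k) (Y k \<times> U (k - 1))"
    and H_diag: "f \<in> \<F> k \<Longrightarrow> H k k f = fst (\<omega> k f)"
    and H_off: "j < k \<Longrightarrow> f \<in> \<F> k \<Longrightarrow> H j k f = H j (k - 1) (snd (\<omega> k f))"
begin

abbreviation "w k f \<equiv> snd (\<omega> k f)"
abbreviation "Fs \<equiv> F_space U Y \<F> H"
abbreviation "W \<equiv> omega_H U Y \<F> \<omega> H"

lemmas Fk = csubspacesD[OF closed_csubspaces_sub[OF \<F>]]

lemma FU: "f \<in> \<F> k \<Longrightarrow> f \<in> U k" using \<F>_sub by blast

lemma \<omega>_mem: "f \<in> \<F> k \<Longrightarrow> fst (\<omega> k f) \<in> Y k" "f \<in> \<F> k \<Longrightarrow> w k f \<in> U (k - 1)"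
proof -
  have "\<omega> k f \<in> Y k \<times> U (k - 1)" if "f \<in> \<F> k"
    by (rule bdd_op_mem) (use \<omega>[of k] that in \<open>auto simp: contraction_op_def\<close>)
  then show "f \<in> \<F> k \<Longrightarrow> fst (\<omega> k f) \<in> Y k" "f \<in> \<F> k \<Longrightarrow> w k f \<in> U (k - 1)" by auto
qed

lemma norm_\<omega>: 
  assumes "f \<in> \<F> k"
  shows "(norm (fst (\<omega> k f)))\<^sup>2 + (norm (w k f))\<^sup>2 \<le> (norm f)\<^sup>2"
proof -
  have "norm (\<omega> k f) \<le> norm f" using \<omega>[of k] assms by (auto simp: contraction_op_def)
  then have "(norm (\<omega> k f))\<^sup>2 \<le> (norm f)\<^sup>2" by (rule power_mono) simp
  then show ?thesis by (simp add: norm_prod_def)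
qed

lemma w_linear:
  "f \<in> \<F> k \<Longrightarrow> f' \<in> \<F> k \<Longrightarrow> w k (f + f') = w k f + w k f'" "f \<in> \<F> k \<Longrightarrow> w k (a *\<^sub>C f) = a *\<^sub>C w k f"
  using \<omega>[of k] bdd_op_add[of "\<omega> k"] bdd_op_scaleC[of "\<omega> k"] by (auto simp: contraction_op_def scaleC_prod_def)

text \<open>Row \<open>k\<close> comes from \<open>H_diag\<close>, the earlier rows from
  \<open>H_off\<close>, and the later ones vanish. The two summands occupy different rows, hence are
  orthogonal.\<close>

lemma h_on_F:
  assumes f: "f \<in> \<F> k"
  shows "h k f = h (k - 1) (w k f) + single k (fst (\<omega> k f))"
proof (rule ell2_eqI)
  fix j
  consider "j < k" | "j = k" | "k < j" by linarith
  then show "ell2_nth (h k f) j = ell2_nth (h (k - 1) (w k f) + single k (fst (\<omega> k f))) j"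
    by cases (use f in \<open>simp_all add: h_nth FU \<omega>_mem H_off H_diag UM_low[OF H_UM]\<close>)
qed

lemma norm_h_on_F:
  assumes f: "f \<in> \<F> k"
  shows "(norm (h k f))\<^sup>2 = (norm (h (k - 1) (w k f)))\<^sup>2 + (norm (fst (\<omega> k f)))\<^sup>2"
proof -
  have "cinner (h (k - 1) (w k f)) (single k (fst (\<omega> k f))) = 0"
    using f by (simp add: cinner_single h_nth \<omega>_mem UM_low[OF H_UM] cinner.zero_left)
  then show ?thesis
    by (simp add: h_on_F[OF f] norm_add_sq norm_single inner_eq_Re)
qed

text \<open>The summand from \<open>fst (\<omega> k f)\<close> occurs both in the bound for the norm
  of \<open>f\<close> and in the norm of \<open>h k f\<close>, and drops out of the
  difference.\<close>

lemma d_w_le: "f \<in> \<F> k \<Longrightarrow> norm (d (k - 1) (w k f)) \<le> norm (d k f)"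
  by (rule power2_le_imp_le) (use norm_\<omega>[of f k] in \<open>simp_all add: norm_d_sq FU \<omega>_mem norm_h_on_F\<close>)

section \<open>The contraction omega_H and membership in the parameter set\<close>

lemma Fs_eq: "Fs k = closure ((\<lambda>f\<in>\<F> k. d k f) ` \<F> k)"
  by (simp add: F_space_def)

lemma dF_bdd: "(\<lambda>f\<in>\<F> k. d k f) \<in> bdd_op (\<F> k) (U k)"
  by (rule bdd_op_restrict[OF d_bdd Fk \<F>_sub])

lemma Fs_closed: "closed_csubspace (Fs k)"
  unfolding Fs_eq by (rule closed_csubspace_closure_image[OF dF_bdd Fk])

lemmas Fsk = closed_csubspaceD(1)[OF Fs_closed]

lemma Fs_D: "x \<in> Fs k \<Longrightarrow> x \<in> D k"
proof -
  have "Fs k \<subseteq> D k" unfolding F_space_def defect_space_def by (rule closure_mono) (use \<F>_sub in blast)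
  then show "x \<in> Fs k \<Longrightarrow> x \<in> D k" by blast
qed

lemma d_in_Fs: "f \<in> \<F> k \<Longrightarrow> d k f \<in> Fs k"
  unfolding F_space_def by (rule closure_subset[THEN subsetD]) simp

lemma eq_on_Fs:
  assumes B: "B \<in> bdd_op (Fs k) V" "B' \<in> bdd_op (Fs k) V'" and eq: "\<And>f. f \<in> \<F> k \<Longrightarrow> B (d k f) = B' (d k f)"
    and x: "x \<in> Fs k"
  shows "B x = B' x"
  by (rule bdd_op_eq_on_closure[OF _ _ csubspace_image[OF dF_bdd Fk], of B k V B' V'])
     (use B eq x in \<open>auto simp: F_space_def\<close>)

text \<open>\<open>d_w_le\<close> lets \<open>dominated_factor\<close> with constant 1 produce the
  operator, and density of the vectors \<open>d k f\<close> makes it the one meant by the definite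
  description.\<close>

lemma W_props: "W k \<in> bdd_op (Fs k) (D (k - 1)) \<and> (\<forall>f\<in>\<F> k. W k (d k f) = d (k - 1) (w k f)) \<and>
   (\<forall>x\<in>Fs k. norm (W k x) \<le> norm x)"
proof -
  obtain B where B: "B \<in> bdd_op (closure ((\<lambda>f\<in>\<F> k. d k f) ` \<F> k)) (D (k - 1))"
     "\<And>f. f \<in> \<F> k \<Longrightarrow> B ((\<lambda>f\<in>\<F> k. d k f) f) = d (k - 1) (w k f)"
     "\<And>x. x \<in> closure ((\<lambda>f\<in>\<F> k. d k f) ` \<F> k) \<Longrightarrow> norm (B x) \<le> 1 * norm x"
    by (rule dominated_factor[OF Fk closed_csubspaceD(2)[OF closed_csubspacesD[OF D_closed]] dF_bdd,
        of k "\<lambda>f. d (k - 1) (w k f)" "k - 1" 1])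
       (auto simp: d_in_D \<omega>_mem w_linear bdd_op_add[OF d_bdd] bdd_op_scaleC[OF d_bdd] d_w_le)
  have B': "B \<in> bdd_op (Fs k) (D (k - 1))" "\<And>f. f \<in> \<F> k \<Longrightarrow> B (d k f) = d (k - 1) (w k f)"
    using B(1,2) by (simp_all add: F_space_def)
  have "W k = B"
    unfolding omega_H_def
  proof (rule the_equality)
    fix B2 assume B2: "B2 \<in> bdd_op (Fs k) (D (k - 1)) \<and> (\<forall>f\<in>\<F> k. B2 (d k f) = d (k - 1) (w k f))"
    show "B2 = B"
    proof (rule bdd_op_eqI)
      show "B2 \<in> bdd_op (Fs k) (D (k - 1))" "B \<in> bdd_op (Fs k) (D (k - 1))" using B2 B' by auto
      show "B2 x = B x" if "x \<in> Fs k" for x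
        by (rule eq_on_Fs[OF _ B'(1) _ that, of B2 "D (k - 1)"]) (use B2 B'(2) in auto)
    qed
  qed (use B' in auto)
  then show ?thesis using B' B(3) by (simp add: F_space_def)
qed

lemma W_bdd: "W k \<in> bdd_op (Fs k) (D (k - 1))" and W_d: "f \<in> \<F> k \<Longrightarrow> W k (d k f) = d (k - 1) (w k f)"
  and W_le: "x \<in> Fs k \<Longrightarrow> norm (W k x) \<le> norm x"
  using W_props by blast+

text \<open>By density the condition on \<open>F_space\<close> need only be tested on the vectors
  \<open>d k f\<close>, where \<open>omega_H\<close> is explicit. It then has the same columnwise
  shape as the conditions on \<open>F\<close>.\<close>

lemma C_set_iff:
  "C \<in> C_set U Y \<F> \<omega> H \<longleftrightarrow> C \<in> UM D D \<and> (\<forall>k. \<forall>x\<in>D k. C k k x = 0) \<and> contractive D C \<and>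
     (\<forall>j k. \<forall>f\<in>\<F> k. C j k (d k f) = unit_column (k - 1) (d (k - 1) (w k f)) j)"
proof -
  have strict: "C \<in> UM_strict D D \<longleftrightarrow> (\<forall>k. \<forall>x\<in>D k. C k k x = 0)" if C: "C \<in> UM D D"
    using C unfolding UM_strict_def UM_def by (auto simp: order_le_less)
  have col: "(\<forall>f\<in>Fs k. C j k f = (if j = k - 1 then W k f else 0)) \<longleftrightarrow>
      (\<forall>f\<in>\<F> k. C j k (d k f) = unit_column (k - 1) (d (k - 1) (w k f)) j)" if C: "C \<in> UM D D" for j k
  proof
    assume "\<forall>f\<in>Fs k. C j k f = (if j = k - 1 then W k f else 0)"
    then show "\<forall>f\<in>\<F> k. C j k (d k f) = unit_column (k - 1) (d (k - 1) (w k f)) j"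
      using d_in_Fs W_d by (auto simp: unit_column_def)
  next
    assume R: "\<forall>f\<in>\<F> k. C j k (d k f) = unit_column (k - 1) (d (k - 1) (w k f)) j"
    show "\<forall>f\<in>Fs k. C j k f = (if j = k - 1 then W k f else 0)"
    proof
      fix x assume x: "x \<in> Fs k"
      have "(\<lambda>x\<in>Fs k. C j k x) x = (if j = k - 1 then W k else (\<lambda>x\<in>Fs k. 0)) x"
      proof (rule eq_on_Fs[OF _ _ _ x])
        show "(\<lambda>x\<in>Fs k. C j k x) \<in> bdd_op (Fs k) (D j)"
          by (rule bdd_op_restrict[OF UM_bdd[OF C] Fsk]) (use Fs_D in blast)
        show "(if j = k - 1 then W k else (\<lambda>x\<in>Fs k. 0)) \<in> bdd_op (Fs k) (D (k - 1))"
          using W_bdd bdd_op_zero[OF Dk Fsk] by auto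
      qed (use R d_in_Fs in \<open>auto simp: unit_column_def W_d\<close>)
      then show "C j k x = (if j = k - 1 then W k x else 0)" using x by auto
    qed
  qed
  show ?thesis
  proof (cases "C \<in> UM D D")
    case True
    show ?thesis
      by (simp add: C_set_def UMinf_ball_iff[OF D_closed D_closed] True strict[OF True] col[OF True]) blast
  qed (simp add: C_set_def UMinf_ball_iff[OF D_closed D_closed])
qed

text \<open>The shift condition is imposed for all \<open>j\<close>, not only \<open>j < k\<close>:
  in the remaining rows it holds automatically, and as an identity of whole columns it fits
  \<open>inverse_column_iff\<close>.\<close>

definition F_set :: "('u, 'u) opmat set"
  where "F_set = {F \<in> UM U U. unipotent U F \<and> F_positive F \<and>
    (\<forall>j k. \<forall>f\<in>\<F> k. F j k f = unit_column k f j + F j (k - 1) (w k f))}"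

text \<open>For \<open>j < k\<close> column \<open>j\<close> has no entry in row \<open>k\<close>,
  so the extra summand of \<open>h_on_F\<close> is invisible to it. Hence \<open>N\<close> satisfies
  the shift condition above the diagonal whatever \<open>C\<close> is.\<close>

lemma gram_on_F:
  assumes f: "f \<in> \<F> k" and jk: "j < k"
  shows "gr j k f = gr j (k - 1) (w k f)"
proof (rule cinner_ext[OF bdd_op_mem[OF gram_bdd] bdd_op_mem[OF gram_bdd] Uk])
  show "f \<in> U k" "w k f \<in> U (k - 1)" using f by (simp_all add: FU \<omega>_mem)
  fix z assume z: "z \<in> U j"
  have "cinner (h j z) (single k (fst (\<omega> k f))) = 0"
    using z jk by (simp add: cinner_single h_nth UM_low[OF H_UM] cinner.zero_left)
  then show "cinner z (gr j k f) = cinner z (gr j (k - 1) (w k f))"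
    using f z by (simp add: gram_cinner' FU \<omega>_mem h_on_F[OF f] cinner.add_right)
qed

text \<open>Above the diagonal the contributions of \<open>N\<close> cancel by
  \<open>gram_on_F\<close>, and \<open>d j\<close> is cancelled by injectivity. In the other rows
  both identities hold anyway.\<close>

lemma F_shift_iff:
  assumes G: "G \<in> UM D D" "unipotent D G" and f: "f \<in> \<F> k"
  shows "(\<forall>j. F_of G j k f = unit_column k f j + F_of G j (k - 1) (w k f)) \<longleftrightarrow>
     (\<forall>j. G j k (d k f) = unit_column k (d k f) j + G j (k - 1) (d (k - 1) (w k f)))"
proof (intro iff_allI)
  fix j
  have wU: "w k f \<in> U (k - 1)" and fU: "f \<in> U k" using f by (simp_all add: FU \<omega>_mem)
  note F = F_of_UM[OF G(1)] F_of_unipotent[OF G(2)]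
  consider "j < k" | "j = k" | "k < j" by linarith
  then show "(F_of G j k f = unit_column k f j + F_of G j (k - 1) (w k f)) =
     (G j k (d k f) = unit_column k (d k f) j + G j (k - 1) (d (k - 1) (w k f)))"
  proof cases
    case 1
    have m: "G j k (d k f) \<in> D j" "G j (k - 1) (d (k - 1) (w k f)) \<in> D j"
      using UM_mem[OF G(1)] d_in_D fU wU by blast+
    show ?thesis
      using 1 d_inj[OF m] by (auto simp: F_of_apply fU wU gram_on_F[OF f] unit_column_def)
  next
    case 2
    then show ?thesis
      using fU wU by (simp add: unit_column_def unipotentD[OF F(2)] unipotentD[OF G(2)] d_in_D UM_low[OF F(1)] UM_low[OF G(1)])
  next
    case 3
    then show ?thesis
      using fU wU by (simp add: unit_column_def d_in_D UM_low[OF F(1)] UM_low[OF G(1)])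
  qed
qed

text \<open>\<open>C\<close>, I - C, its inverse \<open>G\<close> and \<open>F_of G\<close>
  determine one another: \<open>K\<close> and inversion are involutions, and \<open>F_of\<close> is
  injective with range given by \<open>F_factor\<close>. Along the chain contractive becomes
  accretive becomes positive, and \<open>shift\<close> carries the interpolation conditions.\<close>

lemma bij_C_F: "bij_betw (F_mat U Y H) (C_set U Y \<F> \<omega> H) F_set"
proof -
  define K where "K C = mat_sub D (mat_id D) C" for C
  define G where "G C = mat_inv D (K C)" for C
  have KU: "K C \<in> UM D D" if "C \<in> UM D D" for C unfolding K_def by (intro mat_sub_UM Ds mat_id_UM that)
  have Kuni: "unipotent D (K C)" if "\<forall>k. \<forall>x\<in>D k. C k k x = 0" for C
    using that by (simp add: unipotent_def K_def mat_sub_def mat_id_apply[OF Ds])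
  have KK: "K (K C) = C" if "C \<in> UM D D" for C unfolding K_def by (rule mat_sub_id_sub_id[OF Ds that])
  have shift: "(\<forall>j. \<forall>f\<in>\<F> k. C j k (d k f) = unit_column (k - 1) (d (k - 1) (w k f)) j) \<longleftrightarrow>
      (\<forall>j. \<forall>f\<in>\<F> k. F_of (G C) j k f = unit_column k f j + F_of (G C) j (k - 1) (w k f))"
    if C: "C \<in> UM D D" "\<forall>k. \<forall>x\<in>D k. C k k x = 0" for C k
  proof -
    note KC = KU[OF C(1)] Kuni[of C, OF C(2)]
    have GC: "G C \<in> UM D D" "unipotent D (G C)"
      unfolding G_def by (rule mat_inv_UM[OF Ds KC], rule mat_inv_unipotent[OF Ds KC])
    have "(\<forall>j. C j k (d k f) = unit_column (k - 1) (d (k - 1) (w k f)) j) \<longleftrightarrow>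
       (\<forall>j. F_of (G C) j k f = unit_column k f j + F_of (G C) j (k - 1) (w k f))" if f: "f \<in> \<F> k" for f
    proof -
      have m: "d k f \<in> D k" "d (k - 1) (w k f) \<in> D (k - 1)" using f by (simp_all add: d_in_D FU \<omega>_mem)
      have "(\<forall>j. C j k (d k f) = unit_column (k - 1) (d (k - 1) (w k f)) j) \<longleftrightarrow>
        (\<forall>j. K C j k (d k f) = unit_column k (d k f) j - unit_column (k - 1) (d (k - 1) (w k f)) j)"
        using m by (simp add: K_def mat_sub_def mat_id_apply[OF Ds] unit_column_def)
      also have "\<dots> \<longleftrightarrow> (\<forall>j. G C j k (d k f) = unit_column k (d k f) j + G C j (k - 1) (d (k - 1) (w k f)))"
        unfolding G_def by (rule inverse_column_iff[OF Ds KC m])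
      also have "\<dots> \<longleftrightarrow> (\<forall>j. F_of (G C) j k f = unit_column k f j + F_of (G C) j (k - 1) (w k f))"
        by (rule F_shift_iff[OF GC f, symmetric])
      finally show ?thesis .
    qed
    then show ?thesis by blast
  qed
  show ?thesis
    unfolding bij_betw_def
  proof
    have C: "F_mat U Y H C = F_of (G C)" "G C \<in> UM D D" "unipotent D (G C)" "K C \<in> UM D D" "unipotent D (K C)"
      "C \<in> UM D D" if "C \<in> C_set U Y \<F> \<omega> H" for C
    proof -
      have C: "C \<in> UM D D" "\<forall>k. \<forall>x\<in>D k. C k k x = 0" using that by (auto simp: C_set_iff)
      note KC = KU[OF C(1)] Kuni[of C, OF C(2)]
      show "C \<in> UM D D" "K C \<in> UM D D" "unipotent D (K C)" by (fact C(1) KC)+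
      show "G C \<in> UM D D" "unipotent D (G C)"
        unfolding G_def by (rule mat_inv_UM[OF Ds KC], rule mat_inv_unipotent[OF Ds KC])
      then show "F_mat U Y H C = F_of (G C)" using F_mat_eq[of C] by (simp add: G_def K_def)
    qed
    show "inj_on (F_mat U Y H) (C_set U Y \<F> \<omega> H)"
    proof (rule inj_onI)
      fix A B assume A: "A \<in> C_set U Y \<F> \<omega> H" and B: "B \<in> C_set U Y \<F> \<omega> H" and "F_mat U Y H A = F_mat U Y H B"
      then have "G A = G B" using F_of_inj[OF C(2)[OF A] C(2)[OF B]] C(1) by metis
      then have "K A = K B" unfolding G_def using mat_inv_inv[OF Ds] C(4,5) A B by metis
      then show "A = B" using KK C(6) A B by metis
    qed
    show "F_mat U Y H ` C_set U Y \<F> \<omega> H = F_set"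
    proof (intro equalityI subsetI)
      fix F assume "F \<in> F_mat U Y H ` C_set U Y \<F> \<omega> H"
      then obtain A where A: "A \<in> C_set U Y \<F> \<omega> H" "F = F_of (G A)" using C(1) by auto
      have A': "A \<in> UM D D" "\<forall>k. \<forall>x\<in>D k. A k k x = 0" "contractive D A"
        "\<forall>j k. \<forall>f\<in>\<F> k. A j k (d k f) = unit_column (k - 1) (d (k - 1) (w k f)) j" using A(1) C_set_iff by blast+
      have "accretive D (G A)"
        unfolding G_def K_def
        by (rule contractive_iff_accretive[OF Ds A'(1), THEN iffD1]) (use A' in auto)
      then have "F_positive F" unfolding A(2) using F_positive_iff[OF C(2)[OF A(1)]] by simp
      moreover have "\<forall>j k. \<forall>f\<in>\<F> k. F j k f = unit_column k f j + F j (k - 1) (w k f)"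
        using shift[of A, OF A'(1,2)] A'(4) unfolding A(2) by blast
      ultimately show "F \<in> F_set"
        using F_of_UM[OF C(2)[OF A(1)]] F_of_unipotent[OF C(3)[OF A(1)]] unfolding F_set_def A(2) by blast
    next
      fix F assume "F \<in> F_set"
      then have F: "F \<in> UM U U" "unipotent U F" "F_positive F"
        "\<forall>j k. \<forall>f\<in>\<F> k. F j k f = unit_column k f j + F j (k - 1) (w k f)" by (auto simp: F_set_def)
      obtain G' where G': "G' \<in> UM D D" "unipotent D G'" "F = F_of G'" using F_factor[OF F(1-3)] by blast
      \<comment> \<open>The solution of (I - A)^-1 = G'.\<close>
      define A where "A = K (mat_inv D G')"
      note N = mat_inv_UM[OF Ds G'(1,2)] mat_inv_unipotent[OF Ds G'(1,2)]
      have A: "A \<in> UM D D" "\<forall>k. \<forall>x\<in>D k. A k k x = 0"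
        unfolding A_def using KU[OF N(1)] by (simp_all add: K_def mat_sub_def mat_id_apply[OF Ds] unipotentD[OF N(2)])
      have GA: "G A = G'" unfolding G_def A_def KK[OF N(1)] by (rule mat_inv_inv[OF Ds G'(1,2)])
      have "contractive D A"
        by (rule contractive_iff_accretive[OF Ds A(1), THEN iffD2])
           (use A F(3) F_positive_iff[OF G'(1)] G'(3) GA in \<open>auto simp: G_def K_def\<close>)
      moreover have "\<forall>j k. \<forall>f\<in>\<F> k. A j k (d k f) = unit_column (k - 1) (d (k - 1) (w k f)) j"
        using shift[of A, OF A] F(4) unfolding GA G'(3) by blast
      ultimately have "A \<in> C_set U Y \<F> \<omega> H" using A by (simp add: C_set_iff)
      then show "F \<in> F_mat U Y H ` C_set U Y \<F> \<omega> H" using C(1) GA G'(3) by (metis imageI)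
    qed
  qed
qed

section \<open>From F to the pairs satisfying (a) to (d) and back\<close>

lemma F_set_inverse:
  assumes "F \<in> F_set" and f: "f \<in> \<F> k"
  shows "mat_inv U F j k f = unit_column k f j - unit_column (k - 1) (w k f) j"
proof -
  have F: "F \<in> UM U U" "unipotent U F" "\<forall>j. F j k f = unit_column k f j + F j (k - 1) (w k f)"
    using assms by (auto simp: F_set_def)
  note N = mat_inv_UM[OF Us F(1,2)] mat_inv_unipotent[OF Us F(1,2)]
  show ?thesis
    using inverse_column_iff[OF Us N FU[OF f] \<omega>_mem(2)[OF f]] F(3)
    by (simp add: mat_inv_inv[OF Us F(1,2)])
qed

lemma Z_props_of_F:
  assumes FF: "F \<in> F_set"
  shows "Z_props U Y \<F> \<omega> H (mat_mul U H (mat_inv U F)) (mat_sub U (mat_id U) (mat_inv U F))"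
proof -
  let ?N = "mat_inv U F"
  let ?Z1 = "mat_mul U H ?N" and ?Z2 = "mat_sub U (mat_id U) ?N"
  have F: "F \<in> UM U U" "unipotent U F" "F_positive F" using FF by (auto simp: F_set_def)
  note N = mat_inv_UM[OF Us F(1,2)] mat_inv_unipotent[OF Us F(1,2)]
  have Z1: "?Z1 \<in> UM U Y" by (rule mat_mul_UM[OF Us H_UM N(1) Ys])
  have Z2: "?Z2 \<in> UM U U" by (rule mat_sub_UM[OF Us mat_id_UM[OF Us] N(1) Us])
  have "contractive_pair U ?Z1 ?Z2" by (rule F_positive_imp_contractive_pair[OF F])
  then have ab: "?Z1 \<in> UMinf U Y" "?Z2 \<in> UMinf U U"
     "\<forall>u\<in>hsum U. (norm (induced_op U Y ?Z1 u))\<^sup>2 + (norm (induced_op U U ?Z2 u))\<^sup>2 \<le> (norm u)\<^sup>2"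
    using contractive_pair_iff[OF U Y U Z1 Z2] by blast+
  have strict: "?Z2 \<in> UM_strict U U"
    using Z2 unfolding UM_strict_def UM_def
    by (auto simp: order_le_less mat_sub_def mat_id_apply[OF Us] unipotentD[OF N(2)])
  have c2: "?Z2 j k f = (if j = k - 1 then w k f else 0)" if f: "f \<in> \<F> k" for j k f
    using f by (simp add: mat_sub_def mat_id_apply[OF Us] FU F_set_inverse[OF FF] unit_column_def)
  \<comment> \<open>On \<open>f\<close>, column \<open>k\<close> of the inverse of \<open>F\<close>
    is \<open>f\<close> in row \<open>k\<close> minus \<open>w k f\<close> in row k - 1. Its image
    under \<open>H\<close> is a difference that the interpolation conditions on \<open>H\<close>
    evaluate.\<close>
  have c1: "?Z1 j k f = (if j = k then fst (\<omega> k f) else 0)" if f: "f \<in> \<F> k" for j k f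
  proof -
    have "?Z1 j k f = mat_act H k (\<lambda>i. unit_column k f i - unit_column (k - 1) (w k f) i) j"
      using f by (simp add: mat_mul_eq_act FU F_set_inverse[OF FF])
    also have "\<dots> = H j k f - H j (k - 1) (w k f)"
      using mat_act_diff_arg[OF Us H_UM, of "unit_column k f" "unit_column (k - 1) (w k f)" k j] f
      by (simp add: unit_column_mem[OF Us] FU \<omega>_mem mat_act_unit_column[OF Us H_UM])
    also have "\<dots> = (if j = k then fst (\<omega> k f) else 0)"
      using f by (cases j k rule: linorder_cases) (simp_all add: H_diag H_off UM_low[OF H_UM] FU \<omega>_mem)
    finally show ?thesis .
  qed
  have "mat_mul U ?Z1 (mat_inv U (mat_sub U (mat_id U) ?Z2)) = H"
    by (simp add: mat_sub_id_sub_id[OF Us N(1)] mat_inv_inv[OF Us F(1,2)]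
        mat_mul_assoc[OF H_UM N(1) F(1) Us Us] mat_inv_left[OF Us F(1,2)] mat_mul_id_right[OF H_UM Us Ys])
  then show ?thesis
    unfolding Z_props_def using ab strict c1 c2 by simp
qed

text \<open>\<open>Z2\<close> leaves only F = (I - Z2)^-1, and then (d) reads H = Z1 F, which turns
  the estimate (b) into one for \<open>H\<close>.\<close>

lemma F_of_Z_props:
  assumes Z: "Z_props U Y \<F> \<omega> H Z1 Z2"
  shows "\<exists>F\<in>F_set. Z1 = mat_mul U H (mat_inv U F) \<and> Z2 = mat_sub U (mat_id U) (mat_inv U F)"
proof -
  have a: "Z1 \<in> UMinf U Y" "Z2 \<in> UMinf U U" "Z2 \<in> UM_strict U U"
    and b: "\<forall>u\<in>hsum U. (norm (induced_op U Y Z1 u))\<^sup>2 + (norm (induced_op U U Z2 u))\<^sup>2 \<le> (norm u)\<^sup>2"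
    and c: "\<And>j k f. f \<in> \<F> k \<Longrightarrow> Z2 j k f = (if j = k - 1 then w k f else 0)"
    and dd: "H = mat_mul U Z1 (mat_inv U (mat_sub U (mat_id U) Z2))"
    using Z by (auto simp: Z_props_def)
  have ZU: "Z1 \<in> UM U Y" "Z2 \<in> UM U U" using a by (auto simp: UMinf_def)
  let ?M = "mat_sub U (mat_id U) Z2"
  have M: "?M \<in> UM U U" by (rule mat_sub_UM[OF Us mat_id_UM[OF Us] ZU(2) Us])
  have Muni: "unipotent U ?M"
    using a(3) by (simp add: unipotent_def mat_sub_def mat_id_apply[OF Us] UM_strict_def)
  define F where "F = mat_inv U ?M"
  have F: "F \<in> UM U U" "unipotent U F"
    unfolding F_def by (rule mat_inv_UM[OF Us M Muni], rule mat_inv_unipotent[OF Us M Muni])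
  have inv: "mat_inv U F = ?M" unfolding F_def by (rule mat_inv_inv[OF Us M Muni])
  have Z2: "Z2 = mat_sub U (mat_id U) (mat_inv U F)"
    unfolding inv by (rule mat_sub_id_sub_id[OF Us ZU(2), symmetric])
  have H': "H = mat_mul U Z1 F" using dd by (simp add: F_def)
  have "mat_mul U H (mat_inv U F) = mat_mul U (mat_mul U Z1 F) (mat_inv U F)" using H' by simp
  also have "\<dots> = Z1"
    using mat_mul_assoc[OF ZU(1) F(1) mat_inv_UM[OF Us F] Us Us]
    by (simp add: mat_inv_right[OF Us F] mat_mul_id_right[OF ZU(1) Us Ys])
  finally have Z1: "Z1 = mat_mul U H (mat_inv U F)" ..
  have "contractive_pair U Z1 Z2"
    using contractive_pair_iff[OF U Y U ZU] a b by blast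
  then have "F_positive F"
    using contractive_pair_imp_F_positive[OF F ZU(1) H'] Z2 by simp
  moreover have "\<forall>j. F j k f = unit_column k f j + F j (k - 1) (w k f)" if f: "f \<in> \<F> k" for k f
    unfolding F_def
    using inverse_column_iff[OF Us M Muni FU[OF f] \<omega>_mem(2)[OF f]] f
    by (simp add: mat_sub_def mat_id_apply[OF Us] FU c unit_column_def)
  ultimately have "F \<in> F_set" using F by (auto simp: F_set_def)
  then show ?thesis using Z1 Z2 by blast
qed

lemma bij_F_Z:
  "bij_betw (\<lambda>F. (mat_mul U H (mat_inv U F), mat_sub U (mat_id U) (mat_inv U F))) F_set
     {(Z1, Z2). Z_props U Y \<F> \<omega> H Z1 Z2}"
  unfolding bij_betw_def
proof
  show "inj_on (\<lambda>F. (mat_mul U H (mat_inv U F), mat_sub U (mat_id U) (mat_inv U F))) F_set"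
  proof (rule inj_onI)
    fix F F' assume FF: "F \<in> F_set" "F' \<in> F_set"
      and "(mat_mul U H (mat_inv U F), mat_sub U (mat_id U) (mat_inv U F)) =
           (mat_mul U H (mat_inv U F'), mat_sub U (mat_id U) (mat_inv U F'))"
    \<comment> \<open>The second component alone determines \<open>F\<close>.\<close>
    then have eq: "mat_sub U (mat_id U) (mat_inv U F) = mat_sub U (mat_id U) (mat_inv U F')" by simp
    have F: "F \<in> UM U U" "unipotent U F" "F' \<in> UM U U" "unipotent U F'" using FF by (auto simp: F_set_def)
    have "mat_inv U F = mat_inv U F'"
      using eq mat_sub_id_sub_id[OF Us mat_inv_UM[OF Us F(1,2)]] mat_sub_id_sub_id[OF Us mat_inv_UM[OF Us F(3,4)]] by metis
    then show "F = F'" using mat_inv_inv[OF Us F(1,2)] mat_inv_inv[OF Us F(3,4)] by metis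
  qed
  show "(\<lambda>F. (mat_mul U H (mat_inv U F), mat_sub U (mat_id U) (mat_inv U F))) ` F_set
      = {(Z1, Z2). Z_props U Y \<F> \<omega> H Z1 Z2}"
  proof (intro equalityI subsetI)
    fix Z assume "Z \<in> (\<lambda>F. (mat_mul U H (mat_inv U F), mat_sub U (mat_id U) (mat_inv U F))) ` F_set"
    then obtain F where F: "F \<in> F_set" and Z: "Z = (mat_mul U H (mat_inv U F), mat_sub U (mat_id U) (mat_inv U F))"
      by (rule imageE)
    show "Z \<in> {(Z1, Z2). Z_props U Y \<F> \<omega> H Z1 Z2}"
      unfolding Z mem_Collect_eq case_prod_conv by (rule Z_props_of_F[OF F])
  next
    fix Z assume "Z \<in> {(Z1, Z2). Z_props U Y \<F> \<omega> H Z1 Z2}"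
    then obtain Z1 Z2 where Z: "Z = (Z1, Z2)" "Z_props U Y \<F> \<omega> H Z1 Z2" by auto
    obtain F where F: "F \<in> F_set" "Z1 = mat_mul U H (mat_inv U F)" "Z2 = mat_sub U (mat_id U) (mat_inv U F)"
      using F_of_Z_props[OF Z(2)] by (elim bexE conjE)
    show "Z \<in> (\<lambda>F. (mat_mul U H (mat_inv U F), mat_sub U (mat_id U) (mat_inv U F))) ` F_set"
      unfolding Z(1) F(2,3) by (rule imageI[OF F(1)])
  qed
qed

lemma bij_C_Z:
  "bij_betw (\<lambda>C. (Z1_mat U Y H C, Z2_mat U Y H C)) (C_set U Y \<F> \<omega> H) {(Z1, Z2). Z_props U Y \<F> \<omega> H Z1 Z2}"
  using bij_betw_trans[OF bij_C_F bij_F_Z] by (simp add: Z1_mat_def[abs_def] Z2_mat_def[abs_def] comp_def)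

section \<open>Uniqueness\<close>

lemma W_mem: "x \<in> Fs k \<Longrightarrow> W k x \<in> D (k - 1)" using bdd_op_mem[OF W_bdd] .

abbreviation "W_adj k \<equiv> adj (Fs k) (D (k - 1)) (W k)"

lemmas W_adj_bdd = adj_bdd[OF Fs_closed Dk W_bdd]
lemmas W_adj_cinner = adj_cinner[OF Fs_closed Dk W_bdd]

lemma W_adj_mem: "z \<in> D (k - 1) \<Longrightarrow> W_adj k z \<in> Fs k" using bdd_op_mem[OF W_adj_bdd] .

lemma norm_W_adj_sq: "z \<in> D (k - 1) \<Longrightarrow> cinner (W k (W_adj k z)) z = of_real ((norm (W_adj k z))\<^sup>2)"
  by (simp only: W_adj_cinner[OF W_adj_mem] cinner_self)

lemma norm_W_adj_le:
  assumes z: "z \<in> D (k - 1)"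
  shows "norm (W_adj k z) \<le> norm z"
proof -
  have "(norm (W_adj k z))\<^sup>2 = cmod (cinner (W k (W_adj k z)) z)"
    by (simp only: norm_W_adj_sq[OF z] norm_of_real) simp
  also have "\<dots> \<le> norm (W k (W_adj k z)) * norm z" by (rule cmod_cinner_le)
  also have "\<dots> \<le> norm (W_adj k z) * norm z" by (intro mult_right_mono W_le W_adj_mem z) simp
  finally have "norm (W_adj k z) * norm (W_adj k z) \<le> norm z * norm (W_adj k z)"
    by (simp add: power2_eq_square mult.commute)
  then show ?thesis by (cases "W_adj k z = 0") auto
qed

lemma coisometry_iff: "coisometry (Fs k) (D (k - 1)) (W k) \<longleftrightarrow> (\<forall>z\<in>D (k - 1). W k (W_adj k z) = z)"
  unfolding coisometry_def compose_def by (metis (no_types, lifting) restrict_apply' restrict_ext)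

text \<open>The row operator with entries \<open>W i\<close> and \<open>e\<close>, acting on F_Hi
  plus one scalar dimension, is contractive: there is room for \<open>e\<close> beside
  \<open>omega_H\<close>.\<close>

definition row_contraction :: "int \<Rightarrow> 'u \<Rightarrow> bool"
  where "row_contraction i e \<longleftrightarrow> (\<forall>p\<in>Fs i. \<forall>s. (norm (W i p + s *\<^sub>C e))\<^sup>2 \<le> (norm p)\<^sup>2 + (cmod s)\<^sup>2)"

lemma row_contraction_0: "row_contraction i 0"
proof -
  have "(norm (W i p))\<^sup>2 \<le> (norm p)\<^sup>2 + (cmod s)\<^sup>2" if "p \<in> Fs i" for p s
    using power_mono[OF W_le[OF that], of 2] by (simp add: add_increasing2)
  then show ?thesis by (simp add: row_contraction_def)
qed

text \<open>If \<open>\<omega>\<^sub>H\<close> is not a co-isometry, then \<open>e\<close> can be taken in the range of \<open>I - \<omega>\<^sub>H \<omega>\<^sub>H\<^sup>*\<close>.\<close>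

lemma row_contraction_exists:
  assumes "\<not> coisometry (Fs i) (D (i - 1)) (W i)"
  shows "\<exists>e\<in>D (i - 1). e \<noteq> 0 \<and> row_contraction i e"
proof -
  let ?X = "D (i - 1)"
  obtain y where y: "y \<in> ?X" "W i (W_adj i y) \<noteq> y" using assms coisometry_iff by blast
  define S where "S = (\<lambda>z\<in>?X. (\<lambda>z\<in>?X. z) z - (\<lambda>z\<in>?X. W i (W_adj i z)) z)"
  have Sb: "S \<in> bdd_op ?X ?X"
    unfolding S_def by (intro bdd_op_minus bdd_op_id bdd_op_compose[OF W_adj_bdd W_bdd] Dk order_refl)
  have Sz: "S z = z - W i (W_adj i z)" if "z \<in> ?X" for z using that by (simp add: S_def)
  have Szz: "cinner (S z) z = of_real ((norm z)\<^sup>2 - (norm (W_adj i z))\<^sup>2)" if "z \<in> ?X" for z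
    using that by (simp add: Sz cinner.diff_left norm_W_adj_sq cinner_self)
  have Snn: "nonneg_op ?X S"
    unfolding nonneg_op_def using Sb norm_W_adj_le power_mono[OF norm_W_adj_le, of _ i 2]
    by (simp add: Szz del: of_real_diff of_real_power)
  define q where "q = Re (cinner (S y) y)"
  have q: "q \<ge> 0" using Snn y(1) by (auto simp: nonneg_op_def q_def complex_nonneg_Reals_iff)
  \<comment> \<open>Chosen to be positive with \<open>c\<^sup>2 * q \<le> 1\<close>; the added 1
    covers \<open>q = 0\<close>.\<close>
  define c where "c = 1 / (1 + q)"
  have c: "c > 0" "c\<^sup>2 * q \<le> 1"
  proof -
    show "c > 0" using q by (simp add: c_def)
    have "q \<le> (1 + q)\<^sup>2" using q by (simp add: power2_eq_square algebra_simps)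
    then show "c\<^sup>2 * q \<le> 1" using q by (simp add: c_def power_divide divide_simps)
  qed
  define e where "e = c *\<^sub>R S y"
  have SyX: "S y \<in> ?X" using bdd_op_mem[OF Sb y(1)] .
  have e: "e \<in> ?X" "e \<noteq> 0"
    using csubspace_scaleR[OF Dk SyX] c(1) y by (auto simp: e_def Sz)
  \<comment> \<open>The operator inequality e e* \<le> I - W W*, from Cauchy-Schwarz for the form of
    \<open>S\<close>.\<close>
  have ez: "(cmod (cinner e z))\<^sup>2 \<le> (norm z)\<^sup>2 - (norm (W_adj i z))\<^sup>2" if z: "z \<in> ?X" for z
  proof -
    have "(cmod (cinner e z))\<^sup>2 = c\<^sup>2 * (cmod (cinner (S y) z))\<^sup>2"
      by (simp add: e_def cinner.scaleR_left power_mult_distrib)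
    also have "\<dots> \<le> c\<^sup>2 * (q * Re (cinner (S z) z))"
      unfolding q_def by (intro mult_left_mono nonneg_op_cauchy_schwarz[OF Snn Dk y(1) z]) simp
    also have "\<dots> = (c\<^sup>2 * q) * ((norm z)\<^sup>2 - (norm (W_adj i z))\<^sup>2)"
      unfolding Szz[OF z] Re_complex_of_real by (simp add: mult.assoc)
    also have "\<dots> \<le> 1 * ((norm z)\<^sup>2 - (norm (W_adj i z))\<^sup>2)"
      using c(2) power_mono[OF norm_W_adj_le[OF z], of 2] by (intro mult_right_mono) auto
    finally show ?thesis by simp
  qed
  \<comment> \<open>The row is estimated through its adjoint: by \<open>ez\<close>, the squares of
    \<open>W_adj i t\<close> and \<open>cinner e t\<close> add up to at most that of
    \<open>t\<close>. This bounds the fourth power of \<open>norm t\<close>, and one square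
    cancels.\<close>
  have "(norm (W i p + s *\<^sub>C e))\<^sup>2 \<le> (norm p)\<^sup>2 + (cmod s)\<^sup>2" if p: "p \<in> Fs i" for p s
  proof -
    define t where "t = W i p + s *\<^sub>C e"
    have t: "t \<in> ?X" unfolding t_def by (intro csubspace_add csubspace_scaleC Dk W_mem p e)
    let ?\<alpha> = "norm (W_adj i t)" and ?\<beta> = "cmod (cinner e t)"
    have "(norm t)\<^sup>2 = cmod (cinner t t)" by (simp add: cinner_self norm_power)
    also have "cinner t t = cinner p (W_adj i t) + s * cinner e t"
      by (subst t_def) (simp add: cinner.add_left cinner_scaleC_left W_adj_cinner[OF p t])
    also have "cmod \<dots> \<le> norm p * ?\<alpha> + cmod s * ?\<beta>"
      by (intro norm_triangle_mono cmod_cinner_le) (simp add: norm_mult)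
    finally have "((norm t)\<^sup>2)\<^sup>2 \<le> (norm p * ?\<alpha> + cmod s * ?\<beta>)\<^sup>2" by (intro power_mono) auto
    also have "\<dots> \<le> ((norm p)\<^sup>2 + (cmod s)\<^sup>2) * (?\<alpha>\<^sup>2 + ?\<beta>\<^sup>2)"
    proof -
      have "0 \<le> (norm p * ?\<beta> - cmod s * ?\<alpha>)\<^sup>2" by simp
      then show ?thesis by (simp add: power2_eq_square algebra_simps)
    qed
    also have "\<dots> \<le> ((norm p)\<^sup>2 + (cmod s)\<^sup>2) * (norm t)\<^sup>2"
      using ez[OF t] by (intro mult_left_mono) auto
    finally have le: "(norm t)\<^sup>2 * (norm t)\<^sup>2 \<le> ((norm p)\<^sup>2 + (cmod s)\<^sup>2) * (norm t)\<^sup>2"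
      by (simp add: power2_eq_square)
    show ?thesis
    proof (cases "t = 0")
      case False
      then show ?thesis unfolding t_def[symmetric] by (intro mult_right_le_imp_le[OF le]) simp
    qed (simp add: t_def[symmetric])
  qed
  then show ?thesis using e by (auto simp: row_contraction_def)
qed

text \<open>The first summand extends \<open>omega_H\<close> by 0 on the orthogonal complement of
  F_Hk. The second is a rank one entry in column \<open>m\<close> and row i - 1, the row that
  contains the \<open>omega_H\<close> of index \<open>i\<close>; for \<open>m = i\<close> both fall
  on the same entry.\<close>

definition C_ext :: "int \<Rightarrow> int \<Rightarrow> 'u \<Rightarrow> 'u \<Rightarrow> ('u, 'u) opmat"
  where "C_ext i m g e = (\<lambda>j k. \<lambda>x\<in>D k. (if j = k - 1 then W k (oproj (Fs k) x) else 0) +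
     (if j = i - 1 \<and> k = m then cinner x g *\<^sub>C e else 0))"

lemma C_ext_UM:
  assumes im: "i \<le> m" and e: "e \<in> D (i - 1)"
  shows "C_ext i m g e \<in> UM D D"
proof (rule UMI)
  fix j k
  have 1: "(\<lambda>x\<in>D k. if j = k - 1 then W k (oproj (Fs k) x) else 0) \<in> bdd_op (D k) (D j)"
  proof (cases "j = k - 1")
    case True
    have "(\<lambda>x\<in>D k. W k ((\<lambda>x\<in>D k. oproj (Fs k) x) x)) \<in> bdd_op (D k) (D (k - 1))"
      by (rule bdd_op_compose[OF bdd_op_oproj[OF Fs_closed Dk] W_bdd Dk])
    then show ?thesis using True by (simp cong: restrict_cong)
  qed (simp add: bdd_op_zero[OF Dk Dk])
  have 2: "(\<lambda>x\<in>D k. if j = i - 1 \<and> k = m then cinner x g *\<^sub>C e else 0) \<in> bdd_op (D k) (D j)"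
  proof (cases "j = i - 1 \<and> k = m")
    case True
    have "(\<lambda>x\<in>D k. cinner x g *\<^sub>C e) \<in> bdd_op (D k) (D j)"
    proof (rule bdd_opI[where K = "norm g * norm e"])
      show "norm ((\<lambda>x\<in>D k. cinner x g *\<^sub>C e) x) \<le> norm g * norm e * norm x" if "x \<in> D k" for x
        using that mult_right_mono[OF cmod_cinner_le[of x g], of "norm e"] by (simp add: norm_scaleC mult_ac)
    qed (use True e in \<open>auto simp: csubspace_scaleC[OF Dk] csubspace_add[OF Dk] cinner_add_left
        scaleC_add_left cinner_scaleC_left scaleC_scaleC\<close>)
    then show ?thesis using True by simp
  qed (simp add: bdd_op_zero[OF Dk Dk] del: de_Morgan_conj)
  have "C_ext i m g e j k = (\<lambda>x\<in>D k. (\<lambda>x\<in>D k. if j = k - 1 then W k (oproj (Fs k) x) else 0) x +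
     (\<lambda>x\<in>D k. if j = i - 1 \<and> k = m then cinner x g *\<^sub>C e else 0) x)"
    by (auto simp: C_ext_def fun_eq_iff)
  then show "C_ext i m g e j k \<in> bdd_op (D k) (D j)" using bdd_op_plus[OF 1 2 Dk Dk] by metis
qed (use im in \<open>auto simp: C_ext_def\<close>)

text \<open>Every component of \<open>x\<close> is split along F_Hk. Row i - 1 costs one extra
  square, that of \<open>l = cinner (x m) g\<close>, and since \<open>g\<close> is orthogonal to
  F_Hm this is paid by the complementary part of \<open>x m\<close>, which no other row
  uses.\<close>

lemma C_ext_contractive:
  assumes im: "i \<le> m" and e: "e \<in> D (i - 1)" "row_contraction i e"
    and g: "norm g \<le> 1" "\<And>x. x \<in> Fs m \<Longrightarrow> cinner x g = 0"
  shows "contractive D (C_ext i m g e)"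
  unfolding contractive_def
proof (intro allI impI)
  fix a b x assume "\<forall>k. x k \<in> D k"
  then have x: "\<And>k. x k \<in> D k" by blast
  define P where "P k = oproj (Fs k) (x k)" for k
  have P: "P k \<in> Fs k" for k unfolding P_def by (rule oproj_mem[OF Fs_closed])
  define l where "l = cinner (x m) g"
  \<comment> \<open>Zero above \<open>b\<close>: row \<open>j\<close> receives column
    \<open>j + 1\<close>, which for \<open>j = b\<close> is cut off.\<close>
  define q where "q k = (if k \<le> b then (norm (P k))\<^sup>2 else 0)" for k
  have act: "mat_act (C_ext i m g e) b x j = (if j + 1 \<le> b then W (j + 1) (P (j + 1)) else 0) +
       (if j = i - 1 \<and> m \<le> b then l *\<^sub>C e else 0)" for j
  proof -
    have "mat_act (C_ext i m g e) b x j = (\<Sum>k\<in>{j..b}. if k = j + 1 then W (j + 1) (P (j + 1)) else 0)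
        + (\<Sum>k\<in>{j..b}. if k = m then (if j = i - 1 then l *\<^sub>C e else 0) else 0)"
      unfolding mat_act_def sum.distrib[symmetric]
      by (intro sum.cong refl) (auto simp: C_ext_def x P_def l_def)
    also have "(\<Sum>k\<in>{j..b}. if k = j + 1 then W (j + 1) (P (j + 1)) else 0) = (if j + 1 \<le> b then W (j + 1) (P (j + 1)) else 0)"
      by simp
    also have "(\<Sum>k\<in>{j..b}. if k = m then (if j = i - 1 then l *\<^sub>C e else 0) else 0) = (if j = i - 1 \<and> m \<le> b then l *\<^sub>C e else 0)"
      using im by (simp add: sum.delta) 
    finally show ?thesis .
  qed
  have row: "(norm (mat_act (C_ext i m g e) b x j))\<^sup>2 \<le> q (j + 1) + (if j = i - 1 \<and> m \<le> b then (cmod l)\<^sup>2 else 0)" for j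
  proof (cases "j = i - 1 \<and> m \<le> b")
    case True
    then show ?thesis
      using im e(2)[unfolded row_contraction_def, rule_format, OF P, of l] by (simp add: act q_def)
  next
    case False
    have "(norm (W (j + 1) (P (j + 1))))\<^sup>2 \<le> (norm (P (j + 1)))\<^sup>2"
      by (intro power_mono W_le P) simp
    then show ?thesis using False by (auto simp: act q_def)
  qed
  have "(\<Sum>j\<in>{a..b}. (norm (mat_act (C_ext i m g e) b x j))\<^sup>2)
     \<le> (\<Sum>j\<in>{a..b}. q (j + 1)) + (\<Sum>j\<in>{a..b}. if j = i - 1 \<and> m \<le> b then (cmod l)\<^sup>2 else 0)"
    unfolding sum.distrib[symmetric] by (intro sum_mono row)
  also have "(\<Sum>j\<in>{a..b}. q (j + 1)) \<le> (\<Sum>k\<in>{a..b}. q k)"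
  proof -
    have "(\<Sum>j\<in>{a..b}. q (j + 1)) = (\<Sum>k\<in>{a + 1..b + 1}. q k)"
      by (rule sum.reindex_bij_witness[of _ "\<lambda>k. k - 1" "\<lambda>j. j + 1"]) auto
    also have "(\<Sum>k\<in>{a + 1..b + 1}. q k) = (\<Sum>k\<in>{a + 1..b}. q k)"
      by (rule sum.mono_neutral_right) (auto simp: q_def)
    also have "\<dots> \<le> (\<Sum>k\<in>{a..b}. q k)" by (rule sum_mono2) (auto simp: q_def)
    finally show ?thesis .
  qed
  \<comment> \<open>If row i - 1 lies in the window and \<open>m \<le> b\<close>, then
    \<open>i \<le> m\<close> puts column \<open>m\<close> into the window too.\<close>
  also have "(\<Sum>j\<in>{a..b}. if j = i - 1 \<and> m \<le> b then (cmod l)\<^sup>2 else 0) \<le> (\<Sum>k\<in>{a..b}. if k = m then (cmod l)\<^sup>2 else 0)"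
  proof (cases "i - 1 \<in> {a..b} \<and> m \<le> b")
    case True
    have "(\<Sum>j\<in>{a..b}. if j = i - 1 \<and> m \<le> b then (cmod l)\<^sup>2 else 0) = (\<Sum>j\<in>{a..b}. if j = i - 1 then (cmod l)\<^sup>2 else 0)"
      using True by (intro sum.cong) auto
    then show ?thesis using True im by simp
  next
    case False
    then have "(\<Sum>j\<in>{a..b}. if j = i - 1 \<and> m \<le> b then (cmod l)\<^sup>2 else 0) = 0"
      by (intro sum.neutral) auto
    then show ?thesis by (simp add: sum_nonneg)
  qed
  also have "(\<Sum>k\<in>{a..b}. q k) + (\<Sum>k\<in>{a..b}. if k = m then (cmod l)\<^sup>2 else 0) \<le> (\<Sum>k\<in>{a..b}. (norm (x k))\<^sup>2)"
    unfolding sum.distrib[symmetric]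
  proof (rule sum_mono)
    fix k assume "k \<in> {a..b}"
    have nx: "(norm (x k))\<^sup>2 = (norm (P k))\<^sup>2 + (norm (x k - P k))\<^sup>2"
      unfolding P_def by (rule norm_oproj_sq[OF Fs_closed])
    have "(cmod l)\<^sup>2 \<le> (norm (x k - P k))\<^sup>2" if "k = m"
    proof -
      have "l = cinner (x k - P k) g" using g(2)[OF P] that by (simp add: l_def cinner.diff_left)
      then have "cmod l \<le> norm (x k - P k) * norm g" using cmod_cinner_le by metis
      also have "\<dots> \<le> norm (x k - P k) * 1" by (intro mult_left_mono g) simp
      finally show ?thesis by (intro power_mono) auto
    qed
    then show "q k + (if k = m then (cmod l)\<^sup>2 else 0) \<le> (norm (x k))\<^sup>2"
      using nx \<open>k \<in> {a..b}\<close> by (auto simp: q_def)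
  qed
  finally show "(\<Sum>j\<in>{a..b}. (norm (mat_act (C_ext i m g e) b x j))\<^sup>2) \<le> (\<Sum>k\<in>{a..b}. (norm (x k))\<^sup>2)"
    by simp
qed

lemma C_ext_in_C_set:
  assumes im: "i \<le> m" and e: "e \<in> D (i - 1)" "row_contraction i e"
    and g: "norm g \<le> 1" "\<And>x. x \<in> Fs m \<Longrightarrow> cinner x g = 0"
  shows "C_ext i m g e \<in> C_set U Y \<F> \<omega> H"
  unfolding C_set_iff
proof (intro conjI allI ballI)
  show "C_ext i m g e j k (d k f) = unit_column (k - 1) (d (k - 1) (w k f)) j" if "f \<in> \<F> k" for j k f
    using that g(2) by (auto simp: C_ext_def d_in_D FU oproj_id[OF Fs_closed] d_in_Fs W_d unit_column_def)
  show "C_ext i m g e k k x = 0" if "x \<in> D k" for k x using that im by (auto simp: C_ext_def)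
qed (use C_ext_UM[OF im e(1)] C_ext_contractive[OF assms] in auto)

text \<open>Row \<open>j\<close> contains the \<open>omega_H\<close> of index j + 1. Co-isometry
  provides \<open>p\<close> in column j + 1 whose image is c = C_jk g and whose norm is that of
  \<open>c\<close>. Adding t g in column \<open>k\<close> changes the row to (1 + t) c but costs
  only a term quadratic in \<open>t\<close>, so the linear term 2 Re (t <c, c>) must vanish.\<close>

lemma C_zero_of_coisometry:
  assumes C: "C \<in> C_set U Y \<F> \<omega> H" and co: "coisometry (Fs (j + 1)) (D j) (W (j + 1))" and jk: "j < k"
    and g: "g \<in> D k" "\<And>x. x \<in> Fs k \<Longrightarrow> cinner x g = 0"
  shows "C j k g = 0"
proof -
  have CU: "C \<in> UM D D" and con: "contractive D C"
    using C by (auto simp: C_set_iff)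
  have CW: "C j (j + 1) x = W (j + 1) x" if "x \<in> Fs (j + 1)" for x
    using C that by (auto simp: C_set_def)
  let ?c = "C j k g"
  have c: "?c \<in> D j" by (rule UM_mem[OF CU g(1)])
  define p where "p = W_adj (j + 1) ?c"
  have p: "p \<in> Fs (j + 1)" unfolding p_def using W_adj_mem[of ?c "j + 1"] c by simp
  have Wp: "W (j + 1) p = ?c" using co coisometry_iff[of "j + 1"] c by (simp add: p_def)
  have np: "(norm p)\<^sup>2 = (norm ?c)\<^sup>2"
    using norm_W_adj_sq[of ?c "j + 1"] c Wp unfolding p_def[symmetric] by (simp add: cinner_self del: of_real_power)
  have "(cmod (- cinner ?c ?c))\<^sup>2 \<le> 0 * (norm g)\<^sup>2"
  proof (rule cross_term_le)
    fix t :: complex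
    let ?x = "\<lambda>i. unit_column (j + 1) p i + unit_column k (t *\<^sub>C g) i"
    have pD: "p \<in> D (j + 1)" and tg: "t *\<^sub>C g \<in> D k" using p g(1) by (auto intro: Fs_D csubspace_scaleC[OF Dk])
    have x: "?x i \<in> D i" for i by (intro csubspace_add[OF Dk] unit_column_mem[OF Ds] pD tg)
    have "mat_act C k ?x j = C j (j + 1) p + C j k (t *\<^sub>C g)"
      using jk by (simp add: mat_act_add_arg[OF Ds CU unit_column_mem[OF Ds pD] unit_column_mem[OF Ds tg]]
          mat_act_unit_column[OF Ds CU] pD tg)
    then have act: "mat_act C k ?x j = ?c + t *\<^sub>C ?c"
      by (simp add: CW p Wp bdd_op_scaleC[OF UM_bdd[OF CU] g(1)])
    have "(norm (?c + t *\<^sub>C ?c))\<^sup>2 \<le> (\<Sum>i\<in>{j..k}. (norm (mat_act C k ?x i))\<^sup>2)"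
      unfolding act[symmetric] using jk by (intro member_le_sum) auto
    also have "\<dots> \<le> (\<Sum>i\<in>{j..k}. (norm (?x i))\<^sup>2)" by (rule contractiveD[OF con x])
    also have "\<dots> = (norm p)\<^sup>2 + (cmod t)\<^sup>2 * (norm g)\<^sup>2"
    proof -
      \<comment> \<open>If j + 1 = k, both vectors sit in the same column, and orthogonality of
        \<open>g\<close> to F_Hk is what makes the squares add.\<close>
      have "(norm (?x i))\<^sup>2 = (norm (unit_column (j + 1) p i))\<^sup>2 + (norm (unit_column k (t *\<^sub>C g) i))\<^sup>2" for i
      proof (cases "i = j + 1 \<and> i = k")
        case True
        then have "cinner p g = 0" using p g(2) by metis
        then have "inner p (t *\<^sub>C g) = 0" by (simp add: inner_eq_Re cinner_scaleC_right)
        then show ?thesis using True by (simp add: unit_column_def norm_add_sq)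
      qed (auto simp: unit_column_def)
      then have "(\<Sum>i\<in>{j..k}. (norm (?x i))\<^sup>2) = (\<Sum>i\<in>{j..k}. (norm (unit_column (j + 1) p i))\<^sup>2) +
          (\<Sum>i\<in>{j..k}. (norm (unit_column k (t *\<^sub>C g) i))\<^sup>2)" by (simp add: sum.distrib)
      moreover have "(\<Sum>i\<in>{j..k}. (norm (unit_column n y i))\<^sup>2) = (norm y)\<^sup>2" if "n \<in> {j..k}" for n and y :: 'u
      proof -
        have "(\<Sum>i\<in>{j..k}. (norm (unit_column n y i))\<^sup>2) = (\<Sum>i\<in>{j..k}. if i = n then (norm y)\<^sup>2 else 0)"
          by (intro sum.cong) (auto simp: unit_column_def)
        then show ?thesis using that by simp
      qed
      ultimately show ?thesis using jk by (simp add: norm_scaleC power_mult_distrib)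
    qed
    finally have "(norm (?c + t *\<^sub>C ?c))\<^sup>2 \<le> (norm p)\<^sup>2 + (cmod t)\<^sup>2 * (norm g)\<^sup>2" .
    moreover have "(norm (?c + t *\<^sub>C ?c))\<^sup>2 = (norm ?c)\<^sup>2 + (norm (t *\<^sub>C ?c))\<^sup>2 + 2 * Re (t * cinner ?c ?c)"
      by (simp add: norm_add_sq inner_eq_Re cinner_scaleC_right cinner_self)
    moreover have "(norm (t *\<^sub>C ?c))\<^sup>2 \<ge> 0" by simp
    moreover have "Re (t * - cinner ?c ?c) = - Re (t * cinner ?c ?c)" by simp
    ultimately show "0 \<le> 0 + 2 * Re (t * - cinner ?c ?c) + (cmod t)\<^sup>2 * (norm g)\<^sup>2"
      using np by linarith
  qed simp
  then show ?thesis by (simp add: cinner_self)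
qed

text \<open>Freedom in column \<open>k\<close> is a vector orthogonal to F_Hk; some member sends it
  to a nonzero vector in row i - 1, with i \<le> k, exactly if the \<open>omega_H\<close> of index
  \<open>i\<close> is not a co-isometry. \<open>int_tail_cases\<close> rewrites this uniform
  criterion as the three conditions.\<close>

lemma Ex1_C_set_iff:
  "(\<exists>!C. C \<in> C_set U Y \<F> \<omega> H) \<longleftrightarrow>
     (\<forall>k. Fs k = D k \<or> (\<forall>i\<le>k. coisometry (Fs i) (D (i - 1)) (W i)))"
proof
  assume un: "\<exists>!C. C \<in> C_set U Y \<F> \<omega> H"
  show "\<forall>k. Fs k = D k \<or> (\<forall>i\<le>k. coisometry (Fs i) (D (i - 1)) (W i))"
  proof (rule ccontr)
    assume "\<not> (\<forall>k. Fs k = D k \<or> (\<forall>i\<le>k. coisometry (Fs i) (D (i - 1)) (W i)))"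
    then obtain k i where k: "Fs k \<noteq> D k" and i: "i \<le> k" "\<not> coisometry (Fs i) (D (i - 1)) (W i)" by blast
    obtain x where x: "x \<in> D k" "x \<notin> Fs k" using k Fs_D by blast
    define g' where "g' = x - oproj (Fs k) x"
    have g'D: "g' \<in> D k" unfolding g'_def by (intro csubspace_diff[OF Dk] x Fs_D oproj_mem[OF Fs_closed])
    have g'0: "g' \<noteq> 0" using x(2) oproj_mem[OF Fs_closed, of k x] by (auto simp: g'_def)
    have g'o: "cinner z g' = 0" if "z \<in> Fs k" for z
      using oproj_orth[OF Fs_closed that, of x] by (metis g'_def cinner_commute complex_cnj_zero)
    define g where "g = inverse (norm g') *\<^sub>R g'"
    have gD: "g \<in> D k" unfolding g_def by (rule csubspace_scaleR[OF Dk g'D])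
    have ng: "norm g = 1" using g'0 by (simp add: g_def)
    have go: "cinner z g = 0" if "z \<in> Fs k" for z using g'o[OF that] by (simp add: g_def cinner.scaleR_right)
    obtain e where e: "e \<in> D (i - 1)" "e \<noteq> 0" "row_contraction i e" using row_contraction_exists[OF i(2)] by blast
    have "C_ext i k g e \<in> C_set U Y \<F> \<omega> H"
      by (rule C_ext_in_C_set[OF i(1) e(1,3)]) (use ng go in auto)
    moreover have "C_ext i k g 0 \<in> C_set U Y \<F> \<omega> H"
      by (rule C_ext_in_C_set[OF i(1) csubspace_0[OF Dk] row_contraction_0]) (use ng go in auto)
    ultimately have "C_ext i k g e (i - 1) k g = C_ext i k g 0 (i - 1) k g" using un by metis
    then show False using gD ng e(2) by (simp add: C_ext_def cinner_self)
  qed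
next
  assume R: "\<forall>k. Fs k = D k \<or> (\<forall>i\<le>k. coisometry (Fs i) (D (i - 1)) (W i))"
  define C0 where "C0 = C_ext 0 0 0 0"
  have C0: "C0 \<in> C_set U Y \<F> \<omega> H"
    unfolding C0_def by (rule C_ext_in_C_set) (simp_all add: csubspace_0[OF Dk] row_contraction_0 cinner.zero_right)
  have "C = C0" if C: "C \<in> C_set U Y \<F> \<omega> H" for C
  proof (rule UM_eqI)
    show CU: "C \<in> UM D D" and "C0 \<in> UM D D" using C C0 by (auto simp: C_set_iff)
    then have C0U: "C0 \<in> UM D D" by blast
    fix j k x assume "j \<le> k" and x: "x \<in> D k"
    define p where "p = oproj (Fs k) x"
    define g where "g = x - p"
    have p: "p \<in> Fs k" unfolding p_def by (rule oproj_mem[OF Fs_closed])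
    have gD: "g \<in> D k" unfolding g_def by (intro csubspace_diff[OF Dk] x Fs_D p)
    have go: "cinner z g = 0" if "z \<in> Fs k" for z
      using oproj_orth[OF Fs_closed that, of x] by (metis g_def p_def cinner_commute complex_cnj_zero)
    \<comment> \<open>Members agree on F_Hk by definition, so only values on the orthogonal part
      \<open>g\<close> remain to be compared; all of them are 0.\<close>
    have zero: "A j k g = 0" if A: "A \<in> C_set U Y \<F> \<omega> H" for A
    proof -
      have AU: "A \<in> UM D D" and A0: "\<And>k x. x \<in> D k \<Longrightarrow> A k k x = 0" using A by (auto simp: C_set_iff)
      consider "j = k" | "Fs k = D k" | "j < k" "\<forall>i\<le>k. coisometry (Fs i) (D (i - 1)) (W i)"
        using R \<open>j \<le> k\<close> by force
      then show ?thesis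
      proof cases
        case 1
        then show ?thesis using A0 gD by simp
      next
        case 2
        then have "cinner g g = 0" using go gD by simp
        then have "g = 0" by (simp add: cinner_self)
        then show ?thesis by (simp add: bdd_op_0[OF UM_bdd[OF AU] Dk])
      next
        case 3
        then have "coisometry (Fs (j + 1)) (D j) (W (j + 1))" by (metis add_diff_cancel_right' zless_imp_add1_zle)
        then show ?thesis using C_zero_of_coisometry[OF A _ 3(1) gD go] by blast
      qed
    qed
    have "C j k p = C0 j k p" using C C0 p by (auto simp: C_set_def)
    moreover have split: "A j k x = A j k p + A j k g" if "A \<in> UM D D" for A
      using bdd_op_add[OF UM_bdd[OF that] Fs_D[OF p] gD] by (simp add: g_def)
    ultimately show "C j k x = C0 j k x"
      unfolding split[OF CU] split[OF C0U] zero[OF C] zero[OF C0] by simp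
  qed
  then show "\<exists>!C. C \<in> C_set U Y \<F> \<omega> H" using C0 by blast
qed

end

text \<open>If neither of the first two conditions holds, a failure of \<open>Q\<close> at
  \<open>l\<close> excludes failures of \<open>P\<close> from \<open>l\<close> on, so
  \<open>P\<close> fails at a last index, and that index is the \<open>k\<close> of the third
  condition.\<close>

lemma int_tail_cases:
  fixes P Q :: "int \<Rightarrow> bool"
  shows "(\<forall>k. P k \<or> (\<forall>i\<le>k. Q i)) \<longleftrightarrow>
    (\<forall>k. P k) \<or> (\<forall>k. Q k) \<or> (\<exists>k. (\<forall>j>k. P j) \<and> (\<forall>j\<le>k. Q j))"
proof
  assume L: "\<forall>k. P k \<or> (\<forall>i\<le>k. Q i)"
  show "(\<forall>k. P k) \<or> (\<forall>k. Q k) \<or> (\<exists>k. (\<forall>j>k. P j) \<and> (\<forall>j\<le>k. Q j))"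
  proof (rule ccontr)
    assume "\<not> ((\<forall>k. P k) \<or> (\<forall>k. Q k) \<or> (\<exists>k. (\<forall>j>k. P j) \<and> (\<forall>j\<le>k. Q j)))"
    then obtain k0 l where k0: "\<not> P k0" and l: "\<not> Q l" and n: "\<And>k. (\<forall>j\<le>k. Q j) \<Longrightarrow> \<exists>j>k. \<not> P j" by blast
    have below: "j < l" if "\<not> P j" for j using L l that by (meson not_le)
    let ?S = "{j. \<not> P j \<and> k0 \<le> j}"
    have fin: "finite ?S" by (rule finite_subset[of _ "{k0..l}"]) (use below in force)+
    have "Max ?S \<in> ?S" by (rule Max_in[OF fin]) (use k0 in auto)
    then have "\<forall>j\<le>Max ?S. Q j" using L by blast
    then obtain j where "j > Max ?S" "\<not> P j" using n by blast
    then show False using Max_ge[OF fin, of j] \<open>Max ?S \<in> ?S\<close> by fastforce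
  qed
qed (metis not_le order_trans)

lemma bij_betw_Ex1:
  assumes "bij_betw f A B"
  shows "(\<exists>!y. y \<in> B) \<longleftrightarrow> (\<exists>!x. x \<in> A)"
proof -
  have B: "B = f ` A" and inj: "inj_on f A" using assms by (auto simp: bij_betw_def)
  show ?thesis
  proof
    assume "\<exists>!y. y \<in> B"
    then obtain y where y: "y \<in> B" "\<And>z. z \<in> B \<Longrightarrow> z = y" by blast
    then obtain x where x: "x \<in> A" "y = f x" using B by blast
    have "z = x" if "z \<in> A" for z
      using inj_onD[OF inj _ that x(1)] y(2)[of "f z"] that x B by blast
    then show "\<exists>!x. x \<in> A" using x by blast
  next
    assume "\<exists>!x. x \<in> A"
    then show "\<exists>!y. y \<in> B" unfolding B by blast
  qed
qed

theorem theorem4p1: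
  fixes U :: "int \<Rightarrow> 'u::chilbert set" and Y :: "int \<Rightarrow> 'y::chilbert set"
    and \<F> :: "int \<Rightarrow> 'u set" and \<omega> :: "int \<Rightarrow> 'u \<Rightarrow> 'y \<times> 'u"
    and H :: "('u, 'y) opmat"
  assumes U: "\<And>k. closed_csubspace (U k)"
    and Y: "\<And>k. closed_csubspace (Y k)"
    and \<F>: "\<And>k. closed_csubspace (\<F> k)" "\<And>k. \<F> k \<subseteq> U k"
    and \<omega>: "\<And>k. \<omega> k \<in> contraction_op (\<F> k) (Y k \<times> U (k - 1))"
    and H: "H \<in> UM2_ball U Y"
    and H_diag: "\<And>k f. f \<in> \<F> k \<Longrightarrow> H k k f = fst (\<omega> k f)"
    and H_off: "\<And>j k f. j < k \<Longrightarrow> f \<in> \<F> k \<Longrightarrow> H j k f = H j (k - 1) (snd (\<omega> k f))"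
  shows "(\<forall>C \<in> C_set U Y \<F> \<omega> H.
            (let F = F_mat U Y H C in
              F \<in> UM U U \<and>
              mat_ge U (mat_add U F (mat_adj U U F)) (mat_add U (gram U Y H) (mat_id U)) \<and>
              (\<forall>j. F j j = (\<lambda>u\<in>U j. u)) \<and>
              (\<forall>j k. j < k \<longrightarrow> (\<forall>f\<in>\<F> k. F j k f = F j (k - 1) (snd (\<omega> k f))))) \<and>
            Z_props U Y \<F> \<omega> H (Z1_mat U Y H C) (Z2_mat U Y H C)) \<and>
         bij_betw (\<lambda>C. (Z1_mat U Y H C, Z2_mat U Y H C)) (C_set U Y \<F> \<omega> H)
           {(Z1, Z2). Z_props U Y \<F> \<omega> H Z1 Z2} \<and>
         ((\<exists>!(Z1, Z2). Z_props U Y \<F> \<omega> H Z1 Z2) \<longleftrightarrow>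
           (\<forall>k. F_space U Y \<F> H k = defect_space U Y H k) \<or>
           (\<forall>k. coisometry (F_space U Y \<F> H k) (defect_space U Y H (k - 1)) (omega_H U Y \<F> \<omega> H k)) \<or>
           (\<exists>k. (\<forall>j>k. F_space U Y \<F> H j = defect_space U Y H j) \<and>
                (\<forall>j\<le>k. coisometry (F_space U Y \<F> H j) (defect_space U Y H (j - 1)) (omega_H U Y \<F> \<omega> H j))))"
proof -
  interpret interpolation U Y H \<F> \<omega>
    by unfold_locales (use assms in \<open>auto simp: closed_csubspaces_def\<close>)
  have 1: "(let F = F_mat U Y H C in F \<in> UM U U \<and>
              mat_ge U (mat_add U F (mat_adj U U F)) (mat_add U (gram U Y H) (mat_id U)) \<and>
              (\<forall>j. F j j = (\<lambda>u\<in>U j. u)) \<and>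
              (\<forall>j k. j < k \<longrightarrow> (\<forall>f\<in>\<F> k. F j k f = F j (k - 1) (snd (\<omega> k f)))))"
    if C: "C \<in> C_set U Y \<F> \<omega> H" for C
  proof -
    define F where "F = F_mat U Y H C"
    have "F \<in> F_set" unfolding F_def by (rule bij_betwE[OF bij_C_F, rule_format, OF C])
    then have F: "F \<in> UM U U" "unipotent U F" "F_positive F"
      "\<forall>j k. \<forall>f\<in>\<F> k. F j k f = unit_column k f j + F j (k - 1) (w k f)"
      by (auto simp: F_set_def)
    have "F j j = (\<lambda>u\<in>U j. u)" for j
      by (rule bdd_op_eqI[OF UM_bdd[OF F(1)] bdd_op_id[OF Uk order_refl]]) (simp add: unipotentD[OF F(2)])
    moreover have "\<forall>j k. j < k \<longrightarrow> (\<forall>f\<in>\<F> k. F j k f = F j (k - 1) (w k f))"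
      using F(4) by (auto simp: unit_column_def)
    ultimately show ?thesis
      using F(1) F_positive_imp_mat_ge[OF F(1,3)] by (simp add: F_def[symmetric])
  qed
  have 2: "Z_props U Y \<F> \<omega> H (Z1_mat U Y H C) (Z2_mat U Y H C)" if "C \<in> C_set U Y \<F> \<omega> H" for C
    using bij_betwE[OF bij_C_Z] that by auto
  have "(\<exists>!(Z1, Z2). Z_props U Y \<F> \<omega> H Z1 Z2) \<longleftrightarrow> (\<exists>!Z. Z \<in> {(Z1, Z2). Z_props U Y \<F> \<omega> H Z1 Z2})"
    by simp
  also have "\<dots> \<longleftrightarrow> (\<exists>!C. C \<in> C_set U Y \<F> \<omega> H)"
    by (rule bij_betw_Ex1[OF bij_C_Z])
  also note Ex1_C_set_iff
  also note int_tail_cases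
  finally show ?thesis using 1 2 bij_C_Z by blast
qed

end
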